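(* Let $M\ge 2$ and let $\mathcal V_3(\tau_n)$ be defined with this $M$. Assume $\mathbf{E}\{\xi^5\}<\infty$. Then, for some $0<\gamma<1$, we have $\mathbf{P}\{|\mathcal V_3(\tau_n)|\ge \gamma n\}\to 0$ as $n\to\infty$ ($n\in I$). Also, there exists a constant $\upsilon>0$ such that $$\lim_{n\to\infty}\mathbf{P}\{B_n\ge \upsilon n\}=1\qquad (n\in I).$$
   Context: Let $\xi$ be a random variable with values in $\{0,1,2,\dots\}$, $p_i=\mathbf{P}\{\xi=i\}$, with $\mathbf{E}\{\xi\}=1$ and $0<\sigma^2:=\mathbf{E}\{\xi^2\}-1<\infty$. Let $\mathcal T$ be the (ordered, rooted) Galton-Watson tree with offspring distribution $(p_i)$, let $I=\{n\ge1:\mathbf{P}\{|\mathcal T|=n\}>0\}$, and for $n\in I$ let $\tau_n$ be $\mathcal T$ conditioned on $|\mathcal T|=n$ (with $|\cdot|$ the number of vertices). For a finite ordered rooted tree, order the children of each node by the sizes of the subtrees rooted at them, from large to small, ties being broken by preorder index; the rank of a non-root node is its position in this ordering among its siblings. The 2-heavy tree consists of the root and all nodes $v$ such that $v$ and all non-root ancestors of $v$ have rank at most 2. $B_n$ is the number of nodes of the 2-heavy tree of $\tau_n$. For an integer $M\ge 2$ and a finite ordered rooted tree $\mathbb T$: $\mathbb T_1$ is the subtree of the 2-heavy tree of $\mathbb T$ containing all its nodes whose subtree in $\mathbb T$ has size at least $M$; $\mathcal V_2$ is the set of nodes of the 2-heavy tree at graph distance 1 from $\mathbb T_1$; $\mathcal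 V_4$ is the set of all nodes of $\mathbb T$ lying in a subtree of $\mathbb T$ rooted at a node of $\mathcal V_2$; and $\mathcal V_3$ is the set of all nodes of $\mathbb T$ that are neither in $\mathbb T_1$ nor in $\mathcal V_4$. $\mathcal V_3(\tau_n)$ denotes $\mathcal V_3$ for $\mathbb T=\tau_n$. *)

theory Defs
  imports "HOL-Probability.Probability" "HOL-Library.Sublist"
begin

section \<open>Ordered rooted trees\<close>

text \<open>
  A finite ordered rooted tree is the set of its nodes in Ulam--Harris notation: the root is
  the empty word, and the children of the node \<open>v\<close>, in order, are
  \<open>v @ [0], v @ [1], \<dots>\<close>. Hence \<open>v\<close> is an ancestor of (or equal to) \<open>u\<close> iff it is a prefix of
  \<open>u\<close>, and preorder is the lexicographic order with prefixes first.
  Cardinalities are only meaningful for finite trees.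
\<close>

type_synonym tree = "nat list set"

definition is_parent :: "nat list \<Rightarrow> nat list \<Rightarrow> bool" where
  "is_parent u v \<longleftrightarrow> (\<exists>i. v = u @ [i])"

definition subtree :: "tree \<Rightarrow> nat list \<Rightarrow> tree" where
  "subtree T v = {u \<in> T. prefix v u}"

definition siblings :: "tree \<Rightarrow> nat list \<Rightarrow> nat list set" where
  "siblings T v = {u \<in> T. \<exists>w. is_parent w u \<and> is_parent w v}"

definition preorder_less :: "nat list \<Rightarrow> nat list \<Rightarrow> bool" where
  "preorder_less u v \<longleftrightarrow> (u, v) \<in> lexord less_than"

definition ranked_before :: "tree \<Rightarrow> nat list \<Rightarrow> nat list \<Rightarrow> bool" where
  "ranked_before T u v \<longleftrightarrow>
     card (subtree T u) > card (subtree T v) \<or>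
     card (subtree T u) = card (subtree T v) \<and> preorder_less u v"

text \<open>
  The position is counted from 1; a node is a member of its own \<^const>\<open>siblings\<close> but is not
  ranked before itself.
\<close>

definition rank :: "tree \<Rightarrow> nat list \<Rightarrow> nat" where
  "rank T v = card {u \<in> siblings T v. ranked_before T u v} + 1"

definition two_heavy :: "tree \<Rightarrow> tree" where
  "two_heavy T = {v \<in> T. \<forall>u. prefix u v \<and> u \<noteq> [] \<longrightarrow> rank T u \<le> 2}"

definition tree_edges :: "tree \<Rightarrow> (nat list \<times> nat list) set" where
  "tree_edges T = {(u, v). u \<in> T \<and> v \<in> T \<and> (is_parent u v \<or> is_parent v u)}"

text \<open>
  Graph distance in \<open>T\<close> from the node \<open>v\<close> to the set \<open>S\<close>: the least length of a walk
  connecting \<open>v\<close> to a node of \<open>S\<close>. It is \<open>\<infinity>\<close> if \<open>S\<close> is empty.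
\<close>

definition graph_dist :: "tree \<Rightarrow> tree \<Rightarrow> nat list \<Rightarrow> enat" where
  "graph_dist T S v = Inf {enat k | k. \<exists>u\<in>S. (v, u) \<in> tree_edges T ^^ k}"

definition T1 :: "nat \<Rightarrow> tree \<Rightarrow> tree" where
  "T1 M T = {v \<in> two_heavy T. card (subtree T v) \<ge> M}"

definition V2 :: "nat \<Rightarrow> tree \<Rightarrow> nat list set" where
  "V2 M T = {v \<in> two_heavy T. graph_dist T (T1 M T) v = 1}"

definition V4 :: "nat \<Rightarrow> tree \<Rightarrow> nat list set" where
  "V4 M T = (\<Union>v \<in> V2 M T. subtree T v)"

definition V3 :: "nat \<Rightarrow> tree \<Rightarrow> nat list set" where
  "V3 M T = {v \<in> T. v \<notin> T1 M T \<and> v \<notin> V4 M T}"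


section \<open>Galton--Watson trees\<close>

text \<open>
  Every word \<open>v\<close> carries an independent copy \<open>X v\<close> of the offspring variable, and
  \<open>X v\<close> is the number of children of \<open>v\<close> if \<open>v\<close> belongs to the tree.
\<close>

definition offspring_space :: "nat pmf \<Rightarrow> (nat list \<Rightarrow> nat) measure" where
  "offspring_space p = Pi\<^sub>M UNIV (\<lambda>_. measure_pmf p)"

inductive_set gw_tree :: "(nat list \<Rightarrow> nat) \<Rightarrow> tree" for X where
  root: "[] \<in> gw_tree X"
| child: "v \<in> gw_tree X \<Longrightarrow> i < X v \<Longrightarrow> v @ [i] \<in> gw_tree X"

definition has_size :: "nat \<Rightarrow> tree \<Rightarrow> bool" where
  "has_size n T \<longleftrightarrow> finite T \<and> card T = n"

definition sizes :: "nat pmf \<Rightarrow> nat set" where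
  "sizes p = {n. n \<ge> 1 \<and> \<P>(X in offspring_space p. has_size n (gw_tree X)) > 0}"

text \<open>
  The probability that the Galton--Watson tree conditioned to have \<open>n\<close> nodes satisfies
  \<open>Q\<close>; it is meaningful for \<open>n \<in> sizes p\<close>.
\<close>

definition cond_gw_prob :: "nat pmf \<Rightarrow> nat \<Rightarrow> (tree \<Rightarrow> bool) \<Rightarrow> real" where
  "cond_gw_prob p n Q = \<P>(X in offspring_space p. Q (gw_tree X) \<bar> has_size n (gw_tree X))"

end

theory Submission
  imports Defs "HOL-Real_Asymp.Real_Asymp"
begin

text \<open>
  It suffices to show that \<open>T1\<close> has linear size with high probability, because \<open>V3\<close> avoids
  \<open>T1\<close> and \<open>T1\<close> is part of the 2-heavy tree. Every node outside \<open>T1\<close> lies below a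
  child, itself outside \<open>T1\<close>, of some \<open>u\<close> in \<open>T1\<close>. The at most two such children of rank at
  most 2 are roots of subtrees with fewer than \<open>M\<close> nodes, so up to a constant per \<open>u\<close> only the
  subtrees of rank at least 3 matter. If the children of \<open>u\<close> have subtree sizes \<open>s\<^sub>1 \<ge> s\<^sub>2 \<ge> \<dots>\<close>, then
  \<open>s\<^sub>3 + s\<^sub>4 + \<dots>\<close> is at most the sum of \<open>sqrt (s\<^sub>i * s\<^sub>j)\<close> over \<open>2 \<le> i < j\<close>, a fringe functional \<open>f\<close> of the
  subtree at \<open>u\<close>. Hence it is enough that the total of \<open>f\<close> over the nodes whose subtree has more than \<open>L\<close> nodes
  is at most \<open>n/2\<close> with high probability for some fixed \<open>L\<close>.

  The cycle lemma gives \<open>n P(|T| = n) = P(S\<^sub>n = n - 1)\<close> and, for a fringe functional \<open>f\<close>,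
  \<open>E[sum of f over the fringe subtrees; |T| = n] = \<Sum>k. E[f(T); |T| = k] P(S\<^sub>n\<^sub>-\<^sub>k = n - k)\<close>, where \<open>S\<close> is the random walk with
  steps \<open>\<xi>\<close>. A local limit theorem bounds the walk probabilities, and the fifth moment gives
  \<open>E[f(T); |T| = k] = O(k\<^sup>-\<^sup>5\<^sup>/\<^sup>4)\<close>. Therefore subtrees with more than \<open>K\<close> nodes contribute at most \<open>n/4\<close>
  except with probability \<open>O(K\<^sup>-\<^sup>1\<^sup>/\<^sup>4 + n\<^sup>-\<^sup>1\<^sup>/\<^sup>4)\<close>, while those of size between \<open>L\<close> and \<open>K\<close> form a bounded
  functional whose exponential moments are controlled by induction on the height of the
  tree, so that they exceed \<open>n/4\<close> with exponentially small probability.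
\<close>

section \<open>Lukasiewicz words and the cycle lemma\<close>

text \<open>The constant \<open>v\<close> in the linear bound may depend on \<open>L\<close> but not
  on the error probability. A first-moment bound over all subtrees with more than \<open>L\<close>
  nodes only gives a failure probability of order L^(-1/4), which does not vanish as n grows. Hence
  the second threshold \<open>K\<close>, chosen after the error, and a separate bound for the sizes
  in between. That bound has to be exponential, because conditioning on |T| = n divides by a
  probability of order n^(-3/2), so an estimate for the unconditioned tree survives only if it beats
  a power of n. Geometric means of two sizes are used because they factor over independent subtrees,
  and because E[sqrt |T|; |T| <= k] is only logarithmic in k, whereas E[|T|; |T| <= k] grows like
  sqrt k. The fifth moment pays for a count of powers of the degree d: d choices of a large child,
  d^2 for the pairs, and d^(3/2) because that child is only known to have size at least k/d. The
  offspring law may be periodic, so walk probabilities are recovered by Fourier inversion over one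
  period of the lattice.\<close>

datatype otree = Node "otree list"

primrec code :: "otree \<Rightarrow> nat list" where
  "code (Node ts) = length ts # concat (map code ts)"

abbreviation forest_code :: "otree list \<Rightarrow> nat list" where
  "forest_code ts \<equiv> concat (map code ts)"

abbreviation nodes :: "otree \<Rightarrow> nat" where
  "nodes t \<equiv> length (code t)"

lemma code_nonempty [simp]: "code t \<noteq> []"
  by (cases t) auto

lemma nodes_pos [simp]: "0 < nodes t"
  by simp

lemma nodes_Node: "nodes (Node ts) = Suc (sum_list (map nodes ts))"
  by (simp add: length_concat comp_def)

lemma sum_list_code: "Suc (sum_list (code t)) = nodes t"
proof (induction t)
  case (Node ts)
  have "length ts + sum_list (forest_code ts) = length (forest_code ts)"
    using Node by (induction ts) (simp_all del: length_concat, force)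
  then show ?case by simp
qed

text \<open>Here \<open>k\<close> is the number of trees still to be read. A letter \<open>a\<close>
  opens one node and turns a demand for k' + 1 trees into one for a + k', and the inequality carries
  over to the rest of the word.\<close>

lemma parse_forest:
  "sum_list d + k \<le> length d \<Longrightarrow> \<exists>ts r. length ts = k \<and> d = forest_code ts @ r"
proof (induction d arbitrary: k)
  case Nil
  then show ?case by simp
next
  case (Cons a d)
  show ?case
  proof (cases k)
    case 0
    then show ?thesis by (intro exI[of _ "[]"] exI[of _ "a # d"]) simp
  next
    case (Suc k')
    then have "sum_list d + (a + k') \<le> length d" using Cons.prems by simp
    from Cons.IH[OF this] obtain ts r where ts: "length ts = a + k'" "d = forest_code ts @ r"
      by blast
    have "forest_code ts = forest_code (take a ts) @ forest_code (drop a ts)"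
      by (metis append_take_drop_id concat_append map_append)
    then have "a # d = forest_code (Node (take a ts) # drop a ts) @ r"
      using ts by simp
    then show ?thesis using ts Suc
      by (intro exI[of _ "Node (take a ts) # drop a ts"] exI[of _ r]) simp
  qed
qed

text \<open>Codes are prefix-free. Stripping the first letter merges the children of the first tree
  with the remaining trees, so the induction runs on the code length for whole forests.\<close>

lemma forest_code_inject:
  assumes "length ts = length us" "forest_code ts @ r = forest_code us @ s"
  shows "ts = us \<and> r = s"
  using assms
proof (induction "length (forest_code ts)" arbitrary: ts us rule: less_induct)
  case less
  show ?case
  proof (cases ts)
    case Nil
    then show ?thesis using less by simp
  next
    case (Cons t ts')
    then obtain u us' where us: "us = u # us'" using less(2) by (cases us) auto
    obtain xs ys where t: "t = Node xs" and u: "u = Node ys" by (cases t, cases u)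
    have l: "length xs = length ys"
      and e: "forest_code (xs @ ts') @ r = forest_code (ys @ us') @ s"
      using less(3) by (simp_all add: Cons us t u)
    have "xs @ ts' = ys @ us' \<and> r = s"
      by (rule less(1)) (use less(2) l e in \<open>auto simp: Cons us t\<close>)
    then show ?thesis using l Cons us t u by simp
  qed
qed

lemma code_append_inject: "code t @ r = code u @ s \<longleftrightarrow> t = u \<and> r = s"
  using forest_code_inject[of "[t]" "[u]" r s] by auto

lemma code_inject [simp]: "code t = code u \<longleftrightarrow> t = u"
  using code_append_inject[of t "[]" u "[]"] by simp

lemma parse_tree:
  assumes "sum_list d < length d"
  obtains t r where "d = code t @ r"
proof -
  have "sum_list d + 1 \<le> length d" using assms by simp
  from parse_forest[OF this] obtain ts r where "length ts = 1" "d = forest_code ts @ r" by blast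
  then show ?thesis using that by (auto simp: length_Suc_conv)
qed

text \<open>Unspecified if no \<^term>\<open>code t\<close> is a prefix of the word.\<close>

definition first_tree :: "nat list \<Rightarrow> otree" where
  "first_tree d = (THE t. prefix (code t) d)"

lemma first_tree_code [simp]: "first_tree (code t @ r) = t"
  unfolding first_tree_def prefix_def by (rule the_equality) (auto simp: code_append_inject)

text \<open>In walk terms, a Lukasiewicz path stays nonnegative until its last step. A prefix
  violating this would already contain a complete code, against prefix-freeness.\<close>

lemma code_proper_prefix:
  assumes "code t = u @ v" "v \<noteq> []"
  shows "length u \<le> sum_list u"
proof (rule ccontr)
  assume "\<not> ?thesis"
  then obtain t' r where "u = code t' @ r" using parse_tree[of u] by (metis not_le)
  then show False using assms code_append_inject[of t "[]" t' "r @ v"] by simp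
qed

lemma code_proper_suffix:
  assumes "code t = u @ v" "v \<noteq> []"
  shows "sum_list v < length v"
  using code_proper_prefix[OF assms] sum_list_code[of t] assms(1) by simp

text \<open>If j < i, one and the same segment of i - j letters of the common rotation is a proper
  prefix of \<open>code t\<close> and a proper suffix of \<open>code u\<close>. The first forces its
  sum to be at least its length, the second forces it to be smaller.\<close>

lemma rotate_code_less:
  assumes "drop i (code t) @ take i (code t) = drop j (code u) @ take j (code u)"
    and "nodes t = nodes u" "i < nodes t"
  shows "i \<le> j"
proof (rule ccontr)
  assume "\<not> i \<le> j"
  then have ij: "j < i" by simp
  let ?n = "nodes t"
  let ?w = "drop i (code t) @ take i (code t)"
  define v where "v = take (i - j) (drop (?n - i) ?w)"
  have 1: "v = take (i - j) (code t)"
    using ij assms(3) by (simp add: v_def)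
  have "v = take (i - j) (drop (?n - i) (drop j (code u) @ take j (code u)))"
    using assms(1) by (simp add: v_def)
  also have "\<dots> = drop (?n - i + j) (code u)"
    using ij assms(2,3) by simp
  finally have 2: "v = drop (?n - i + j) (code u)" .
  have "v \<noteq> []" using 1 ij by simp
  then have "sum_list v < length v"
    using code_proper_suffix[of u "take (?n - i + j) (code u)" v] 2 by simp
  moreover have "length v \<le> sum_list v"
    using code_proper_prefix[of t v "drop (i - j) (code t)"] 1 ij assms(3) by simp
  ultimately show False by simp
qed

lemma rotate_code_inject:
  assumes "rotate i (code t) = rotate j (code u)" "nodes t = nodes u" "i < nodes t" "j < nodes t"
  shows "i = j \<and> t = u"
proof -
  have e: "drop i (code t) @ take i (code t) = drop j (code u) @ take j (code u)"
    using assms by (simp add: rotate_drop_take)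
  have "i = j"
    using rotate_code_less[OF e] rotate_code_less[OF e[symmetric]] assms by auto
  moreover have "take i (code t) = take j (code u)" "drop i (code t) = drop j (code u)"
    using e \<open>i = j\<close> assms by (auto simp: append_eq_append_conv)
  ultimately show ?thesis by (metis append_take_drop_id code_inject)
qed

text \<open>Start the cyclic word at the first time the walk \<open>W\<close> attains its minimum
  \<open>m\<close>. The tree parsed from there cannot end early: ending before the wrap-around would
  take \<open>W\<close> to m - 1, and ending after it would give the value \<open>m\<close> at a
  time before \<open>j\<close>.\<close>

lemma rotate_code_exists:
  assumes "Suc (sum_list d) = length d"
  shows "\<exists>t i. nodes t = length d \<and> i < length d \<and> d = rotate i (code t)"
proof -
  let ?n = "length d"
  define W where "W i = int (sum_list (take i d)) - int i" for i
  define m where "m = Min (W ` {..?n})"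
  define j where "j = (LEAST i. i \<le> ?n \<and> W i = m)"
  have "m \<in> W ` {..?n}" unfolding m_def by (rule Min_in) auto
  then have ex: "\<exists>i. i \<le> ?n \<and> W i = m" by auto
  have j: "j \<le> ?n" "W j = m" using LeastI_ex[OF ex] unfolding j_def by auto
  have min: "m \<le> W i" if "i \<le> ?n" for i unfolding m_def using that by simp
  have first: "m < W i" if "i < j" for i
    using not_less_Least[of i "\<lambda>i. i \<le> ?n \<and> W i = m"] that min[of i] j(1)
    unfolding j_def[symmetric] by force
  have Wn: "W ?n = -1" using assms by (simp add: W_def)
  \<comment> \<open>Since \<open>W\<close> starts at 0 and ends at -1, the minimum is not at the
    start; so the offset ?n - j is a legal one below ?n.\<close>
  have "j \<noteq> 0" using min[of ?n] Wn j(2) unfolding W_def by (intro notI) simp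
  let ?d = "drop j d @ take j d"
  have sd: "sum_list ?d = sum_list d"
    by (metis add.commute append_take_drop_id sum_list_append)
  have ln: "length ?d = ?n" using j(1) by simp
  then have "sum_list ?d < length ?d" using sd assms by linarith
  then obtain t r where t: "?d = code t @ r" by (rule parse_tree)
  let ?l = "nodes t"
  have lle: "?l \<le> ?n" using ln t by (metis length_append le_add1)
  have c: "code t = take ?l ?d" using t by simp
  have sl: "int (sum_list (take ?l ?d)) = int ?l - 1"
    using sum_list_code[of t] c by simp
  have split: "sum_list (take i d) + sum_list (take k (drop i d)) = sum_list (take (i + k) d)" for i k
    by (simp add: take_add)
  have "?l = ?n"
  proof (rule ccontr)
    assume "?l \<noteq> ?n"
    with lle have l: "?l < ?n" by simp
    show False
    proof (cases "?l \<le> ?n - j")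
      case True
      then have "sum_list (take ?l ?d) = sum_list (take ?l (drop j d))" by simp
      then have "W (j + ?l) = m - 1"
        using sl split[of j ?l] j(2) unfolding W_def by (simp only: of_nat_add)
      moreover have "j + ?l \<le> ?n" using True j(1) by linarith
      ultimately show False using min[of "j + ?l"] by simp
    next
      case False
      define k where "k = ?l - (?n - j)"
      have k: "k < j" "?l = ?n - j + k" using False l j(1) by (auto simp: k_def)
      have "take ?l ?d = drop j d @ take k d" using k by simp
      moreover have "sum_list (take j d) + sum_list (drop j d) = sum_list d"
        by (metis append_take_drop_id sum_list_append)
      ultimately have "int (sum_list (drop j d)) + int (sum_list (take k d)) = int (?n - j + k) - 1"
          and "int (sum_list (take j d)) + int (sum_list (drop j d)) = int ?n - 1"
        using sl assms k(2) by auto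
      then have "W k = m"
        using j unfolding W_def by (simp add: of_nat_diff)
      then show False using first[OF k(1)] by simp
    qed
  qed
  then have "code t = ?d" using c ln take_all[of ?d ?l] by (metis order_refl)
  then have "code t = rotate j d"
    using j(1) by (cases "j = ?n") (auto simp: rotate_drop_take)
  then have "rotate (?n - j) (code t) = d"
    using j(1) by (simp add: rotate_rotate)
  then show ?thesis
    using \<open>?l = ?n\<close> \<open>j \<noteq> 0\<close> assms
    by (intro exI[of _ t] exI[of _ "?n - j"]) auto
qed

text \<open>Injectivity includes the offset \<open>i\<close>: words of this sum have no rotational
  symmetry, so all \<open>n\<close> rotations of a code are distinct.\<close>

lemma cycle_lemma:
  "bij_betw (\<lambda>(t, i). rotate i (code t)) ({t. nodes t = n} \<times> {..<n})
     {d. length d = n \<and> Suc (sum_list d) = n}"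
  unfolding bij_betw_def
proof
  show "inj_on (\<lambda>(t, i). rotate i (code t)) ({t. nodes t = n} \<times> {..<n})"
    by (auto simp: inj_on_def dest: rotate_code_inject)
  have sr: "sum_list (rotate i d) = sum_list d" for i and d :: "nat list"
  proof -
    have "sum_list (drop k d) + sum_list (take k d) = sum_list d" for k
      by (metis add.commute append_take_drop_id sum_list_append)
    then show ?thesis by (simp add: rotate_drop_take)
  qed
  show "(\<lambda>(t, i). rotate i (code t)) ` ({t. nodes t = n} \<times> {..<n}) =
      {d. length d = n \<and> Suc (sum_list d) = n}"
  proof (intro set_eqI iffI)
    fix d assume "d \<in> {d. length d = n \<and> Suc (sum_list d) = n}"
    then obtain t i where "nodes t = n" "i < n" "d = rotate i (code t)"
      using rotate_code_exists[of d] by auto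
    then show "d \<in> (\<lambda>(t, i). rotate i (code t)) ` ({t. nodes t = n} \<times> {..<n})"
      by (intro image_eqI[of _ _ "(t, i)"]) auto
  next
    fix d assume "d \<in> (\<lambda>(t, i). rotate i (code t)) ` ({t. nodes t = n} \<times> {..<n})"
    then show "d \<in> {d. length d = n \<and> Suc (sum_list d) = n}"
      using sum_list_code by (auto simp: sr simp del: length_greater_0_conv)
  qed
qed

section \<open>Fringe functionals and their expression through the code\<close>

primrec fringe_sum :: "(otree \<Rightarrow> 'a::comm_monoid_add) \<Rightarrow> otree \<Rightarrow> 'a" where
  "fringe_sum f (Node ts) = f (Node ts) + sum_list (map (fringe_sum f) ts)"


lemma sum_lessThan_add:
  fixes f :: "nat \<Rightarrow> 'a::comm_monoid_add"
  shows "(\<Sum>i<m + n. f i) = (\<Sum>i<m. f i) + (\<Sum>i<n. f (m + i))"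
  by (induction n) (simp_all add: add.assoc)

text \<open>The suffix of a preorder code that starts at some node begins with the code of the
  subtree at that node. The arbitrary tail \<open>r\<close> lets the induction pass through a
  concatenation of codes.\<close>

lemma fringe_sum_positions:
  "fringe_sum f t = (\<Sum>i<nodes t. f (first_tree (drop i (code t @ r))))"
proof (induction t arbitrary: r)
  case (Node ts)
  have *: "(\<Sum>i<length (forest_code ts). f (first_tree (drop i (forest_code ts @ r)))) =
      sum_list (map (fringe_sum f) ts)"
    using Node
  proof (induction ts)
    case (Cons t ts)
    have "(\<Sum>i<length (forest_code (t # ts)). f (first_tree (drop i (forest_code (t # ts) @ r)))) =
       (\<Sum>i<nodes t. f (first_tree (drop i (code t @ forest_code ts @ r)))) +
       (\<Sum>i<length (forest_code ts). f (first_tree (drop (nodes t + i) (code t @ forest_code ts @ r))))"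
      by (simp add: sum_lessThan_add del: length_concat)
    also have "\<dots> = fringe_sum f t + sum_list (map (fringe_sum f) ts)"
      using Cons by (simp del: length_concat)
    finally show ?case by simp
  qed simp
  have "first_tree (length ts # forest_code ts @ r) = Node ts"
    using first_tree_code[of "Node ts" r] by simp
  then show ?case
    using * by (simp add: sum.lessThan_Suc_shift del: length_concat sum.lessThan_Suc)
qed

section \<open>A local limit theorem\<close>

definition walk :: "nat pmf \<Rightarrow> nat \<Rightarrow> nat pmf" where
  "walk p n = map_pmf (\<lambda>f. \<Sum>i<n. f i) (Pi_pmf {..<n} 0 (\<lambda>_. p))"

lemma walk_0 [simp]: "walk p 0 = return_pmf 0"
  by (simp add: walk_def)

lemma walk_Suc: "walk p (Suc n) = map_pmf (\<lambda>(a, b). a + b) (pair_pmf p (walk p n))"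
  by (simp add: walk_def lessThan_Suc Pi_pmf_insert pair_map_pmf2 map_pmf_comp case_prod_unfold add.commute)

section \<open>Characteristic function of the centred walk and Fourier inversion\<close>

definition centred_char :: "nat pmf \<Rightarrow> real \<Rightarrow> complex" where
  "centred_char p = char (distr (measure_pmf p) borel (\<lambda>x. real x - 1))"

lemma centred_char_eq: "centred_char p t = (CLINT x|measure_pmf p. iexp (t * (real x - 1)))"
  unfolding centred_char_def char_def by (subst integral_distr) auto

lemma char_walk:
  "(CLINT s|measure_pmf (walk p n). iexp (t * (real s - real n))) = centred_char p t ^ n"
proof -
  let ?M = "measure_pmf (Pi_pmf {..<n} 0 (\<lambda>_. p))"
  let ?X = "\<lambda>i f. real (f i) - 1 :: real"
  note M = measure_pmf.prob_space_axioms[of "Pi_pmf {..<n} 0 (\<lambda>_. p)"]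
  have "prob_space.indep_vars ?M (\<lambda>_. count_space UNIV) (\<lambda>x f. f x) {..<n}"
    by (rule indep_vars_Pi_pmf) simp
  then have ind: "prob_space.indep_vars ?M (\<lambda>_. borel) ?X {..<n}"
    by (rule prob_space.indep_vars_compose2[OF M]) simp
  have comp: "char (distr ?M borel (?X i)) t = centred_char p t" if "i < n" for i
  proof -
    have "centred_char p t = char (distr (measure_pmf (map_pmf (\<lambda>f. f i) (Pi_pmf {..<n} 0 (\<lambda>_. p)))) borel (\<lambda>x. real x - 1)) t"
      using that by (simp add: Pi_pmf_component centred_char_def)
    also have "\<dots> = char (distr ?M borel (?X i)) t"
      by (simp add: map_pmf_rep_eq distr_distr comp_def)
    finally show ?thesis ..
  qed
  have "(CLINT s|measure_pmf (walk p n). iexp (t * (real s - real n))) =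
      (CLINT f|?M. iexp (t * (\<Sum>i<n. ?X i f)))"
    by (simp add: walk_def sum_subtractf)
  also have "\<dots> = char (distr ?M borel (\<lambda>f. \<Sum>i<n. ?X i f)) t"
    unfolding char_def by (subst integral_distr) auto
  also have "\<dots> = (\<Prod>i<n. char (distr ?M borel (?X i)) t)"
    by (rule prob_space.char_distr_sum[OF M ind])
  also have "\<dots> = centred_char p t ^ n"
    by (simp add: comp)
  finally show ?thesis .
qed

lemma integral_cos_period:
  fixes h :: nat and m :: int
  assumes "h > 0" "int h dvd m"
  shows "(LBINT t:{-(pi / h)..pi / h}. cos (t * m)) = (if m = 0 then 2 * pi / h else 0)"
proof (cases "m = 0")
  case True
  then show ?thesis using assms by (simp add: set_lebesgue_integral_def)
next
  case False
  obtain k where k: "m = int h * k" using assms(2) by auto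
  have "(LBINT t:{-(pi / h)..pi / h}. cos (t * m)) = sin (pi / h * m) / m - sin (-(pi / h) * m) / m"
    unfolding set_lebesgue_integral_def
  proof (rule integral_FTC_Icc)
    fix x :: real
    show "((\<lambda>t. sin (t * real_of_int m) / real_of_int m) has_vector_derivative cos (x * real_of_int m)) (at x within {-(pi / h)..pi / h})"
      unfolding has_real_derivative_iff_has_vector_derivative[symmetric]
      using False by (auto intro!: derivative_eq_intros)
  qed (auto intro!: continuous_intros)
  also have "pi / h * m = pi * k" using assms(1) by (simp add: k)
  also have "-(pi / h) * m = - (pi * k)" using assms(1) by (simp add: k)
  finally show ?thesis using False by (simp add: sin_zero_iff_int2 mult.commute)
qed

text \<open>When the walk lives in a single residue class modulo \<open>h\<close>, orthogonality of
  the cosines over one period of length 2 * pi / h isolates the value \<open>j\<close>. A longer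
  interval would contain further points where the characteristic function has modulus 1.\<close>

lemma walk_inversion:
  fixes h :: nat
  assumes h: "h > 0" and dvd: "\<And>s. s \<in> set_pmf (walk p n) \<Longrightarrow> int h dvd int s - int j"
  shows "pmf (walk p n) j =
     h / (2 * pi) * (LBINT t:{-(pi / h)..pi / h}. Re (centred_char p t ^ n * iexp (t * (real n - real j))))"
proof -
  let ?M = "measure_pmf (walk p n)" and ?I = "{-(pi / h)..pi / h}"
  interpret P: pair_sigma_finite lborel ?M ..
  have Re: "Re (centred_char p t ^ n * iexp (t * (real n - real j))) =
      (LINT s|?M. cos (t * (real s - real j)))" for t
  proof -
    have i: "integrable ?M (\<lambda>s. iexp (t * (real s - real n)))"
      by (rule prob_space.integrable_iexp[OF measure_pmf.prob_space_axioms]) auto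
    have "centred_char p t ^ n * iexp (t * (real n - real j)) =
       (CLINT s|?M. iexp (t * (real s - real n)) * iexp (t * (real n - real j)))"
      by (simp add: char_walk[symmetric])
    also have "\<dots> = (CLINT s|?M. iexp (t * (real s - real j)))"
      by (intro Bochner_Integration.integral_cong) (auto simp: exp_add[symmetric] algebra_simps)
    finally have "Re (centred_char p t ^ n * iexp (t * (real n - real j))) =
        Re (CLINT s|?M. iexp (t * (real s - real j)))" by simp
    also have "\<dots> = (LINT s|?M. Re (iexp (t * (real s - real j))))"
      by (rule integral_Re[symmetric]) (auto intro!: prob_space.integrable_iexp[OF measure_pmf.prob_space_axioms])
    finally show ?thesis by (simp add: Re_exp)
  qed
  have "(LBINT t:?I. Re (centred_char p t ^ n * iexp (t * (real n - real j)))) =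
     (LBINT t. (LINT s|?M. indicator ?I t * cos (t * (real s - real j))))"
    unfolding set_lebesgue_integral_def Re by simp
  also have "\<dots> = (LINT s|?M. (LBINT t. indicator ?I t * cos (t * (real s - real j))))"
  proof (rule P.Fubini_integral[symmetric], rule integrableI_bounded_set[where B = 1 and A = "?I \<times> UNIV"])
    show "emeasure (lborel \<Otimes>\<^sub>M ?M) (?I \<times> UNIV) < \<infinity>"
      by (subst measure_pmf.emeasure_pair_measure_Times) (auto simp: ennreal_mult_less_top)
  qed (auto intro!: AE_I2 simp: indicator_def split: if_splits)
  also have "\<dots> = (LINT s|?M. 2 * pi / h * indicator {j} s)"
  proof (rule integral_cong_AE)
    show "AE s in ?M. (LBINT t. indicator ?I t * cos (t * (real s - real j))) = 2 * pi / h * indicator {j} s"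
    proof (rule AE_pmfI)
      fix s assume "s \<in> set_pmf (walk p n)"
      from integral_cos_period[OF h dvd[OF this]]
      show "(LBINT t. indicator ?I t * cos (t * (real s - real j))) = 2 * pi / h * indicator {j} s"
        by (auto simp: set_lebesgue_integral_def)
    qed
  qed auto
  also have "\<dots> = 2 * pi / h * pmf (walk p n) j"
    by (simp add: pmf.rep_eq)
  finally show ?thesis using h by simp
qed

lemma abs_sin_ge:
  assumes "\<bar>x\<bar> \<le> pi / 2"
  shows "\<bar>x\<bar> / 2 \<le> \<bar>sin x\<bar>"
proof -
  have s: "sin_coeff 2 = 0" "sin_coeff 1 = 1" "sin_coeff 0 = 0" by (simp_all add: sin_coeff_def)
  have "\<bar>sin x - x\<bar> \<le> \<bar>x\<bar> ^ 3 / 6"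
    using Maclaurin_sin_bound[of x 3] s by (simp add: eval_nat_numeral lessThan_Suc)
  also have "\<bar>x\<bar> ^ 3 = \<bar>x\<bar> * x\<^sup>2" by (simp add: power3_eq_cube power2_eq_square abs_mult_self_eq)
  \<comment> \<open>This makes the cubic Taylor error at most half of \<bar>x\<bar>. The rough bound
    pi / 2 \<le> 1.7 is enough.\<close>
  also have "x\<^sup>2 \<le> 3"
  proof -
    have "\<bar>x\<bar> \<le> 1.7" using assms pi_less_4 pi_approx by simp
    then have "\<bar>x\<bar>\<^sup>2 \<le> 1.7\<^sup>2" by (intro power_mono) auto
    then show ?thesis by (simp add: power2_eq_square)
  qed
  finally have "\<bar>sin x - x\<bar> \<le> \<bar>x\<bar> / 2" by (simp add: mult_left_mono)
  then show ?thesis by linarith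
qed


lemma has_bochner_integral_gaussian:
  fixes a :: real
  assumes a: "a > 0"
  shows "has_bochner_integral lborel (\<lambda>x. exp (- (a * x\<^sup>2))) (sqrt (pi / a))"
proof -
  define s where "s = 1 / sqrt (2 * a)"
  have s: "s > 0" "2 * s\<^sup>2 = 1 / a" using a by (auto simp: s_def power_divide)
  have "has_bochner_integral lborel (\<lambda>x. sqrt (pi / a) * normal_density 0 s x) (sqrt (pi / a) * 1)"
    using s by (intro has_bochner_integral_mult_right)
      (simp add: has_bochner_integral_iff integral_normal_density integrable_normal_density)
  moreover have "sqrt (pi / a) * normal_density 0 s x = exp (- (a * x\<^sup>2))" for x
  proof -
    have "2 * pi * s\<^sup>2 = pi / a" using s by (simp add: mult.assoc mult.commute[of 2] )
    moreover have "- (x\<^sup>2) / (2 * s\<^sup>2) = - (a * x\<^sup>2)" using s a by simp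
    ultimately show ?thesis using a by (simp add: normal_density_def)
  qed
  ultimately show ?thesis by simp
qed

section \<open>Critical offspring laws and Gaussian decay of their characteristic function\<close>

locale critical_offspring =
  fixes p :: "nat pmf"
  assumes integrable_offspring: "integrable (measure_pmf p) (\<lambda>i. real i)"
    and mean_offspring: "measure_pmf.expectation p (\<lambda>i. real i) = 1"
    and integrable_offspring_sq: "integrable (measure_pmf p) (\<lambda>i. real i ^ 2)"
    and variance_pos: "0 < measure_pmf.expectation p (\<lambda>i. real i ^ 2) - 1"
    and integrable_offspring_5: "integrable (measure_pmf p) (\<lambda>i. real i ^ 5)"
begin

text \<open>Without an atom at 0 the variable is at least 1 with mean 1, hence constant, which
  contradicts the positive variance.\<close>

lemma pmf_0_pos: "0 < pmf p 0"
proof (rule ccontr)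
  assume "\<not> ?thesis"
  then have "pmf p 0 = 0" using pmf_nonneg[of p 0] by linarith
  then have z: "0 \<notin> set_pmf p" by (simp add: set_pmf_iff)
  have "integrable p (\<lambda>x. real x - 1)" using integrable_offspring by simp
  moreover have "AE x in p. 0 \<le> real x - 1"
  proof (rule AE_pmfI)
    fix x assume "x \<in> set_pmf p" then show "0 \<le> real x - 1" using z by (cases x) auto
  qed
  moreover have "measure_pmf.expectation p (\<lambda>x. real x - 1) = 0"
    using integrable_offspring mean_offspring by simp
  ultimately have "AE x in p. real x - 1 = 0"
    using integral_nonneg_eq_0_iff_AE by blast
  then have "measure_pmf.expectation p (\<lambda>i. real i ^ 2) = measure_pmf.expectation p (\<lambda>i. 1)"
    by (intro integral_cong_AE) auto
  then show False using variance_pos by simp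
qed

text \<open>Equal to half of 1 - Re E exp(i t \<xi>), by the half-angle formula.\<close>

definition sin_energy :: "real \<Rightarrow> real" where
  "sin_energy t = measure_pmf.expectation p (\<lambda>x. (sin (t * real x / 2))\<^sup>2)"

lemma integrable_sin_sq [simp]: "integrable (measure_pmf p) (\<lambda>x. (sin (f x :: real))\<^sup>2)"
  by (rule measure_pmf.integrable_const_bound[where B = 1])
    (auto simp: power_abs[symmetric] abs_square_le_1)

lemma pmf_le_expectation:
  assumes "\<And>x. 0 \<le> f x" "integrable (measure_pmf p) f"
  shows "pmf p a * f a \<le> measure_pmf.expectation p f"
proof -
  have i: "integrable p (indicat_real {a})"
    by (rule measure_pmf.integrable_const_bound[where B = 1]) auto
  have "pmf p a * f a = measure_pmf.expectation p (\<lambda>x. f a * indicator {a} x)"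
    by (simp add: pmf.rep_eq)
  also have "\<dots> \<le> measure_pmf.expectation p f"
    using assms i by (intro integral_mono) (auto split: split_indicator)
  finally show ?thesis .
qed

lemma sin_diff_sq_le: "(sin (x - y :: real))\<^sup>2 \<le> 2 * (sin x)\<^sup>2 + 2 * (sin y)\<^sup>2"
proof -
  have "\<bar>sin (x - y)\<bar> \<le> \<bar>sin x\<bar> + \<bar>sin y\<bar>"
  proof -
    have "\<bar>sin (x - y)\<bar> \<le> \<bar>sin x * cos y\<bar> + \<bar>cos x * sin y\<bar>" by (simp add: sin_diff)
    also have "\<dots> \<le> \<bar>sin x\<bar> * 1 + 1 * \<bar>sin y\<bar>"
      unfolding abs_mult by (intro add_mono mult_mono) auto
    finally show ?thesis by simp
  qed
  then have "(sin (x - y))\<^sup>2 \<le> (\<bar>sin x\<bar> + \<bar>sin y\<bar>)\<^sup>2"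
    by (metis abs_ge_zero power2_abs power_mono)
  also have "\<dots> \<le> 2 * \<bar>sin x\<bar>\<^sup>2 + 2 * \<bar>sin y\<bar>\<^sup>2"
    using sum_squares_bound[of "\<bar>sin x\<bar>" "\<bar>sin y\<bar>"] by (simp add: power2_sum)
  finally show ?thesis by simp
qed

text \<open>Rotating by the argument \<theta> makes the value real, and its defect from 1 is then 2
  * S with S the mean of squared sines of the half phases \<open>a x\<close>. The unknown \<theta>
  is removed with the atom at 0: it bounds the squared sine of \<open>a 0\<close> by S / p_0, and x
  t / 2 is the difference of \<open>a x\<close> and \<open>a 0\<close>.\<close>

lemma norm_centred_char_le: "cmod (centred_char p t) \<le> 1 - sin_energy t / (1 + 1 / pmf p 0)"
proof -
  let ?z = "centred_char p t"
  define \<theta> where "\<theta> = Arg ?z"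
  define a where "a x = (t * (real x - 1) - \<theta>) / 2" for x :: nat
  define S where "S = measure_pmf.expectation p (\<lambda>x. (sin (a x))\<^sup>2)"
  have z: "?z = of_real (cmod ?z) * iexp \<theta>"
    using rcis_cmod_Arg[of ?z] by (simp add: rcis_def cis_conv_exp \<theta>_def)
  have "?z * iexp (- \<theta>) = of_real (cmod ?z)"
    by (subst z) (simp add: exp_minus)
  then have "cmod ?z = Re (?z * iexp (- \<theta>))" by simp
  also have "?z * iexp (- \<theta>) = (CLINT x|measure_pmf p. iexp (t * (real x - 1)) * iexp (- \<theta>))"
    by (simp add: centred_char_eq)
  also have "\<dots> = (CLINT x|measure_pmf p. iexp (2 * a x))"
  proof -
    have "iexp (t * (real x - 1)) * iexp (- \<theta>) = iexp (2 * a x)" for x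
    proof -
      have "2 * a x = t * (real x - 1) + - \<theta>" by (simp add: a_def)
      then show ?thesis by (simp only: of_real_add distrib_left exp_add)
    qed
    then show ?thesis by (simp only:)
  qed
  also have "Re \<dots> = (LINT x|measure_pmf p. Re (iexp (2 * a x)))"
    by (rule integral_Re[symmetric])
      (auto intro!: prob_space.integrable_iexp[OF measure_pmf.prob_space_axioms])
  also have "\<dots> = (LINT x|measure_pmf p. 1 - 2 * (sin (a x))\<^sup>2)"
    by (simp add: Re_exp cos_double_sin)
  also have "\<dots> = 1 - 2 * S" by (simp add: S_def)
  finally have 1: "cmod ?z = 1 - 2 * S" .
  have 2: "pmf p 0 * (sin (a 0))\<^sup>2 \<le> S"
    unfolding S_def by (rule pmf_le_expectation) auto
  have "sin_energy t \<le> (LINT x|measure_pmf p. 2 * (sin (a x))\<^sup>2 + 2 * (sin (a 0))\<^sup>2)"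
    unfolding sin_energy_def
  proof (rule integral_mono)
    fix x
    have "t * real x / 2 = a x - a 0" by (simp add: a_def field_simps)
    then show "(sin (t * real x / 2))\<^sup>2 \<le> 2 * (sin (a x))\<^sup>2 + 2 * (sin (a 0))\<^sup>2"
      by (metis sin_diff_sq_le)
  qed auto
  also have "\<dots> = 2 * S + 2 * (sin (a 0))\<^sup>2" by (simp add: S_def)
  also have "(sin (a 0))\<^sup>2 \<le> S / pmf p 0"
    using 2 pmf_0_pos by (simp add: field_simps)
  finally have "sin_energy t \<le> 2 * S * (1 + 1 / pmf p 0)"
    by (simp add: algebra_simps)
  then have "sin_energy t / (1 + 1 / pmf p 0) \<le> 2 * S"
    using pmf_0_pos by (simp add: divide_le_eq add_pos_pos)
  then show ?thesis using 1 by simp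
qed

text \<open>
  The admissible multiples \<open>K\<close> are closed under subtraction, so the least positive one plays the
  role of the span of the offspring distribution.
\<close>

lemma span_exists:
  obtains h :: nat and C :: real where "h > 0" "C > 0" "\<And>a. a \<in> set_pmf p \<Longrightarrow> h dvd a"
    "\<And>t. (sin (t * real h / 2))\<^sup>2 \<le> C * sin_energy t"
proof -
  define K where "K = {k::nat. \<exists>C>0. \<forall>t. (sin (t * real k / 2))\<^sup>2 \<le> C * sin_energy t}"
  have supp: "a \<in> K" if "a \<in> set_pmf p" for a
  proof -
    have pos: "pmf p a > 0" using that by (simp add: pmf_positive)
    have "pmf p a * (sin (t * real a / 2))\<^sup>2 \<le> sin_energy t" for t
      unfolding sin_energy_def by (rule pmf_le_expectation) auto
    then have "(sin (t * real a / 2))\<^sup>2 \<le> 1 / pmf p a * sin_energy t" for t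
      using pos by (simp add: pos_le_divide_eq mult.commute)
    moreover have "1 / pmf p a > 0" using pos by simp
    ultimately show ?thesis
      unfolding K_def by (intro CollectI exI[of _ "1 / pmf p a"] conjI allI)
  qed
  have diff: "a - b \<in> K" if "a \<in> K" "b \<in> K" "b \<le> a" for a b
  proof -
    from that(1) obtain C where C: "C > 0" "\<And>t. (sin (t * real a / 2))\<^sup>2 \<le> C * sin_energy t"
      unfolding K_def by blast
    from that(2) obtain E where E: "E > 0" "\<And>t. (sin (t * real b / 2))\<^sup>2 \<le> E * sin_energy t"
      unfolding K_def by blast
    have "(sin (t * real (a - b) / 2))\<^sup>2 \<le> (2 * C + 2 * E) * sin_energy t" for t
    proof -
      have "t * real (a - b) / 2 = t * real a / 2 - t * real b / 2"
        using that(3) by (simp add: of_nat_diff algebra_simps diff_divide_distrib)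
      then have "(sin (t * real (a - b) / 2))\<^sup>2 \<le> 2 * (sin (t * real a / 2))\<^sup>2 + 2 * (sin (t * real b / 2))\<^sup>2"
        by (simp only: sin_diff_sq_le)
      also have "\<dots> \<le> 2 * (C * sin_energy t) + 2 * (E * sin_energy t)"
        using C(2) E(2) by (intro add_mono mult_left_mono) auto
      finally show ?thesis by (simp add: algebra_simps)
    qed
    moreover have "2 * C + 2 * E > 0" using C E by simp
    ultimately show ?thesis
      unfolding K_def by (intro CollectI exI[of _ "2 * C + 2 * E"] conjI allI)
  qed
  have "\<exists>a\<in>set_pmf p. a > 0"
  proof (rule ccontr)
    assume "\<not> ?thesis"
    then have "AE x in p. real x = 0" by (auto intro!: AE_pmfI)
    then have "measure_pmf.expectation p (\<lambda>x. real x) = measure_pmf.expectation p (\<lambda>x. 0)"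
      by (intro integral_cong_AE) auto
    then show False using mean_offspring by simp
  qed
  then have ex: "\<exists>h. h \<in> K \<and> h > 0" using supp by blast
  define h where "h = (LEAST h. h \<in> K \<and> h > 0)"
  have h: "h \<in> K" "h > 0" using LeastI_ex[OF ex] unfolding h_def by auto
  have min: "h \<le> k" if "k \<in> K" "k > 0" for k
    unfolding h_def by (rule Least_le) (use that in auto)
  have dvd: "h dvd a" if "a \<in> K" for a
    using that
  proof (induction a rule: less_induct)
    case (less a)
    show ?case
    proof (cases "a = 0")
      case False
      then have le: "h \<le> a" using min less by simp
      have "h dvd a - h"
        by (rule less.IH) (use h(2) False in simp, rule diff[OF \<open>a \<in> K\<close> h(1) le])
      then have "h dvd (a - h) + h" by simp
      then show ?thesis using le by (simp only: le_add_diff_inverse2)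
    qed simp
  qed
  obtain C where C: "C > 0" "\<And>t. (sin (t * real h / 2))\<^sup>2 \<le> C * sin_energy t"
    using h(1) unfolding K_def by blast
  show ?thesis
  proof (rule that)
    show "h dvd a" if "a \<in> set_pmf p" for a using dvd[OF supp[OF that]] .
  qed (fact h C)+
qed

definition span_bound :: "nat \<Rightarrow> real \<Rightarrow> bool" where
  "span_bound h c \<longleftrightarrow> h > 0 \<and> c > 0 \<and> (\<forall>a\<in>set_pmf p. h dvd a) \<and>
     (\<forall>t. \<bar>t\<bar> \<le> pi / real h \<longrightarrow> cmod (centred_char p t) \<le> exp (- (c * t\<^sup>2)))"

lemma span_bound_exists: "\<exists>h c. span_bound h c"
proof -
  obtain h C where h: "h > 0" "C > 0" "\<And>a. a \<in> set_pmf p \<Longrightarrow> h dvd a"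
    and C: "\<And>t. (sin (t * real h / 2))\<^sup>2 \<le> C * sin_energy t" by (rule span_exists) blast
  let ?q = "1 + 1 / pmf p 0"
  have q: "?q > 0" using pmf_0_pos by (simp add: add_pos_pos)
  \<comment> \<open>The 16 comes from squaring \<bar>sin x\<bar> \<ge> \<bar>x\<bar> / 2 at x = t h
    / 2; \<open>C\<close> comes from \<open>span_exists\<close> and \<open>?q\<close> from
    \<open>norm_centred_char_le\<close>.\<close>
  define c where "c = (real h)\<^sup>2 / (16 * C * ?q)"
  have c: "c > 0" using h q by (simp add: c_def)
  have "cmod (centred_char p t) \<le> exp (- (c * t\<^sup>2))" if t: "\<bar>t\<bar> \<le> pi / real h" for t
  proof -
    have "\<bar>t * real h / 2\<bar> \<le> pi / 2" using t h(1) by (simp add: abs_mult field_simps)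
    from abs_sin_ge[OF this] have "(\<bar>t * real h / 2\<bar> / 2)\<^sup>2 \<le> \<bar>sin (t * real h / 2)\<bar>\<^sup>2"
      by (intro power_mono) auto
    also have "\<dots> \<le> C * sin_energy t" using C by simp
    finally have "t\<^sup>2 * (real h)\<^sup>2 / 16 \<le> C * sin_energy t"
      by (simp add: power_mult_distrib power_divide)
    then have "t\<^sup>2 * (real h)\<^sup>2 / 16 / (C * ?q) \<le> C * sin_energy t / (C * ?q)"
      using h(2) q by (intro divide_right_mono mult_nonneg_nonneg) auto
    also have "\<dots> = sin_energy t / ?q" using h(2) by simp
    finally have "c * t\<^sup>2 \<le> sin_energy t / ?q"
      by (simp add: c_def mult.commute mult.left_commute)
    then have "cmod (centred_char p t) \<le> 1 + (- (c * t\<^sup>2))"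
      using norm_centred_char_le[of t] by simp
    also have "\<dots> \<le> exp (- (c * t\<^sup>2))" by (rule exp_ge_add_one_self)
    finally show ?thesis .
  qed
  then show ?thesis using h c unfolding span_bound_def by blast
qed

lemma dvd_walk:
  assumes "\<forall>a\<in>set_pmf p. h dvd a" "s \<in> set_pmf (walk p n)"
  shows "h dvd s"
  using assms(2)
proof (induction n arbitrary: s)
  case (Suc n)
  then show ?case using assms(1) by (auto simp: walk_Suc)
qed simp

lemma centred_char_measurable [measurable]: "centred_char p \<in> borel_measurable borel"
  unfolding centred_char_def
  by (intro real_distribution.char_measurable prob_space.real_distribution_distr
      measure_pmf.prob_space_axioms) auto

text \<open>Writing n + 1 under the root includes the empty walk, which occurs later when the fringe
  subtree is the whole tree.\<close>

lemma walk_upper: "\<exists>C. \<forall>n j. pmf (walk p n) j \<le> C / sqrt (real n + 1)"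
proof -
  obtain h c where hc: "span_bound h c" using span_bound_exists by blast
  then have h: "h > 0" and c: "c > 0" and supp: "\<forall>a\<in>set_pmf p. h dvd a"
    and bd: "\<And>t. \<bar>t\<bar> \<le> pi / real h \<Longrightarrow> cmod (centred_char p t) \<le> exp (- (c * t\<^sup>2))"
    by (auto simp: span_bound_def)
  \<comment> \<open>The 1 serves n = 0; the factor 2 under the root comes from replacing n by (n +
    1) / 2 for positive n.\<close>
  define C where "C = max 1 (h / (2 * pi) * sqrt (2 * pi / c))"
  have "pmf (walk p n) j \<le> C / sqrt (real n + 1)" for n j
  proof -
    consider "n = 0" | "n > 0" "j \<notin> set_pmf (walk p n)" | "n > 0" "j \<in> set_pmf (walk p n)" by auto
    then show ?thesis
    proof cases
      case 1
      then show ?thesis by (auto simp: C_def split: split_indicator)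
    next
      case 2
      then show ?thesis by (simp add: set_pmf_iff C_def)
    next
      case 3
      let ?I = "{-(pi / h)..pi / h}"
      have "int h dvd int s - int j" if "s \<in> set_pmf (walk p n)" for s
        using dvd_walk[OF supp that] dvd_walk[OF supp 3(2)] by (intro dvd_diff) auto
      from walk_inversion[OF h this]
      have "pmf (walk p n) j = h / (2 * pi) *
          (LBINT t:?I. Re (centred_char p t ^ n * iexp (t * (real n - real j))))" by simp
      also have "(LBINT t:?I. Re (centred_char p t ^ n * iexp (t * (real n - real j)))) \<le>
          (LBINT t. exp (- (c * real n * t\<^sup>2)))"
        unfolding set_lebesgue_integral_def
      proof (rule integral_mono')
        show "integrable lborel (\<lambda>t. exp (- (c * real n * t\<^sup>2)))"
          using has_bochner_integral_gaussian[of "c * real n"] c 3 by (auto simp: has_bochner_integral_iff)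
        fix t :: real
        have "Re (centred_char p t ^ n * iexp (t * (real n - real j))) \<le> exp (- (c * real n * t\<^sup>2))"
          if "t \<in> ?I"
        proof -
          have "Re (centred_char p t ^ n * iexp (t * (real n - real j))) \<le>
              cmod (centred_char p t ^ n * iexp (t * (real n - real j)))"
            by (rule complex_Re_le_cmod)
          also have "\<dots> = cmod (centred_char p t) ^ n"
            by (simp only: norm_mult norm_power norm_exp_i_times mult_1_right)
          also have "\<dots> \<le> exp (- (c * t\<^sup>2)) ^ n"
            using that by (intro power_mono bd) auto
          also have "\<dots> = exp (- (c * real n * t\<^sup>2))"
            by (simp add: exp_of_nat_mult[symmetric] algebra_simps)
          finally show ?thesis .
        qed
        then show "indicat_real ?I t *\<^sub>R Re (centred_char p t ^ n * iexp (t * (real n - real j)))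
            \<le> exp (- (c * real n * t\<^sup>2))"
          by (cases "t \<in> ?I")
            (simp_all only: indicator_simps scaleR_one scaleR_zero_left exp_ge_zero not_False_eq_True)
      qed auto
      also have "(LBINT t. exp (- (c * real n * t\<^sup>2))) = sqrt (pi / (c * real n))"
        using has_bochner_integral_gaussian[of "c * real n"] c 3 by (auto simp: has_bochner_integral_iff)
      also have "\<dots> \<le> sqrt (2 * pi / c / (real n + 1))"
      proof (rule real_sqrt_le_mono)
        have "pi / c * (1 / real n) \<le> pi / c * (2 / (real n + 1))"
          using c 3 by (intro mult_left_mono) (auto simp: field_simps)
        then show "pi / (c * real n) \<le> 2 * pi / c / (real n + 1)" by (simp add: mult.commute)
      qed
      also have "\<dots> = sqrt (2 * pi / c) / sqrt (real n + 1)"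
        by (rule real_sqrt_divide)
      finally have "pmf (walk p n) j \<le> h / (2 * pi) * (sqrt (2 * pi / c) / sqrt (real n + 1))"
        using h by (auto simp: mult_left_mono divide_right_mono)
      also have "\<dots> = h / (2 * pi) * sqrt (2 * pi / c) / sqrt (real n + 1)" by simp
      also have "\<dots> \<le> C / sqrt (real n + 1)"
        by (intro divide_right_mono) (auto simp: C_def)
      finally show ?thesis .
    qed
  qed
  then show ?thesis by blast
qed

definition offspring_var :: real where
  "offspring_var = measure_pmf.expectation p (\<lambda>x. (real x - 1)\<^sup>2)"

lemma integrable_centred_sq: "integrable p (\<lambda>x. (real x - 1)\<^sup>2)"
  using integrable_offspring integrable_offspring_sq by (simp add: power2_diff)

lemma offspring_var_pos: "offspring_var > 0"
  using integrable_offspring integrable_offspring_sq mean_offspring variance_pos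
  unfolding offspring_var_def by (simp add: power2_diff)

lemma centred_char_approx:
  obtains B where "\<And>t. cmod (centred_char p t - (1 - t\<^sup>2 * offspring_var / 2)) \<le> B * \<bar>t\<bar> ^ 3"
proof -
  let ?X = "\<lambda>x. real x - 1"
  define B where "B = measure_pmf.expectation p (\<lambda>x. \<bar>?X x\<bar> ^ 3) / 6"
  have i3: "integrable p (\<lambda>x. \<bar>?X x\<bar> ^ 3)"
  proof (rule Bochner_Integration.integrable_bound)
    show "integrable p (\<lambda>x. 1 + real x ^ 5)" using integrable_offspring_5 by simp
    show "AE x in p. norm (\<bar>?X x\<bar> ^ 3) \<le> norm (1 + real x ^ 5)"
    proof (rule AE_I2)
      fix x :: nat
      have "\<bar>?X x\<bar> ^ 3 \<le> 1 + real x ^ 5"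
      proof (cases "x = 0")
        case False
        then have "\<bar>?X x\<bar> ^ 3 \<le> real x ^ 3" by (intro power_mono) auto
        also have "\<dots> \<le> real x ^ 5" using False by (intro power_increasing) auto
        finally show ?thesis by simp
      qed simp
      then show "norm (\<bar>?X x\<bar> ^ 3) \<le> norm (1 + real x ^ 5)" by simp
    qed
  qed auto
  have "cmod (centred_char p t - (1 - t\<^sup>2 * offspring_var / 2)) \<le> B * \<bar>t\<bar> ^ 3" for t
  proof -
    have "cmod (centred_char p t - (1 - t\<^sup>2 * offspring_var / 2)) \<le>
        t\<^sup>2 / 6 * measure_pmf.expectation p (\<lambda>x. min (6 * (?X x)\<^sup>2) (\<bar>t\<bar> * \<bar>?X x\<bar> ^ 3))"
      unfolding centred_char_def
      by (rule prob_space.char_approx3'[OF measure_pmf.prob_space_axioms])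
        (use integrable_offspring integrable_centred_sq mean_offspring in \<open>auto simp: offspring_var_def\<close>)
    also have "\<dots> \<le> t\<^sup>2 / 6 * measure_pmf.expectation p (\<lambda>x. \<bar>t\<bar> * \<bar>?X x\<bar> ^ 3)"
      using i3 by (intro mult_left_mono integral_mono') auto
    also have "\<dots> = B * \<bar>t\<bar> ^ 3"
      by (simp add: B_def power3_eq_cube power2_eq_square)
    finally show ?thesis .
  qed
  then show ?thesis by (rule that)
qed

lemma cmod_centred_char_le_1: "cmod (centred_char p t) \<le> 1"
  unfolding centred_char_def
  by (intro real_distribution.cmod_char_le_1 prob_space.real_distribution_distr
      measure_pmf.prob_space_axioms) auto

text \<open>The n-th powers of two numbers in the unit disc differ by at most n times the difference
  of the numbers. The cubic error of \<open>centred_char_approx\<close> at s / sqrt n makes this of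
  order 1 / sqrt n.\<close>

lemma centred_char_power_limit:
  "(\<lambda>n. centred_char p (s / sqrt n) ^ n) \<longlonglongrightarrow> of_real (exp (- (offspring_var / 2 * s\<^sup>2)))"
proof -
  obtain B where B: "\<And>t. cmod (centred_char p t - (1 - t\<^sup>2 * offspring_var / 2)) \<le> B * \<bar>t\<bar> ^ 3"
    by (rule centred_char_approx) blast
  let ?x = "- (offspring_var / 2 * s\<^sup>2)"
  \<comment> \<open>From this index on, 1 + ?x / n lies in the unit disc, as the comparison of
    powers demands.\<close>
  let ?N = "nat \<lceil>offspring_var * s\<^sup>2\<rceil> + 1"
  have "\<forall>\<^sub>F n in sequentially. cmod (centred_char p (s / sqrt n) ^ n - of_real ((1 + ?x / n) ^ n))
     \<le> B * \<bar>s\<bar> ^ 3 / sqrt n"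
  proof (rule eventually_sequentiallyI)
    fix n assume n: "n \<ge> ?N"
    then have npos: "n > 0" by simp
    have nb: "offspring_var * s\<^sup>2 \<le> real n" using n by linarith
    have w: "\<bar>1 + ?x / n\<bar> \<le> 1"
    proof -
      have "offspring_var / 2 * s\<^sup>2 \<ge> 0" using offspring_var_pos by simp
      moreover have "offspring_var / 2 * s\<^sup>2 / n \<le> 1"
        using nb npos offspring_var_pos by (simp add: divide_le_eq)
      ultimately show ?thesis by (simp add: abs_le_iff)
    qed
    have "cmod (centred_char p (s / sqrt n) ^ n - of_real (1 + ?x / n) ^ n) \<le>
        n * cmod (centred_char p (s / sqrt n) - of_real (1 + ?x / n))"
      by (rule norm_power_diff) (use w cmod_centred_char_le_1 in \<open>simp_all only: norm_of_real\<close>)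
    also have "\<dots> \<le> n * (B * \<bar>s / sqrt n\<bar> ^ 3)"
    proof -
      have "1 + ?x / n = 1 - (s / sqrt n)\<^sup>2 * offspring_var / 2"
        by (simp add: power_divide mult.commute)
      then show ?thesis using B[of "s / sqrt n"] by (intro mult_left_mono) (simp_all only: of_nat_0_le_iff)
    qed
    also have "\<dots> = B * \<bar>s\<bar> ^ 3 / sqrt n"
    proof -
      have "sqrt n ^ 3 = n * sqrt n" by (simp add: power3_eq_cube)
      then show ?thesis using npos by (simp add: power_divide)
    qed
    finally show "cmod (centred_char p (s / sqrt n) ^ n - of_real ((1 + ?x / n) ^ n)) \<le> B * \<bar>s\<bar> ^ 3 / sqrt n"
      by (simp only: of_real_power)
  qed
  moreover have "(\<lambda>n. B * \<bar>s\<bar> ^ 3 / sqrt n) \<longlonglongrightarrow> 0"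
    by real_asymp
  ultimately have "(\<lambda>n. centred_char p (s / sqrt n) ^ n - of_real ((1 + ?x / n) ^ n)) \<longlonglongrightarrow> 0"
    by (rule Lim_null_comparison)
  moreover have "(\<lambda>n. complex_of_real ((1 + ?x / n) ^ n)) \<longlonglongrightarrow> of_real (exp ?x)"
    by (rule tendsto_of_real) (rule tendsto_exp_limit_sequentially)
  ultimately have "(\<lambda>n. (centred_char p (s / sqrt n) ^ n - of_real ((1 + ?x / n) ^ n)) + of_real ((1 + ?x / n) ^ n))
     \<longlonglongrightarrow> 0 + of_real (exp ?x)"
    by (rule tendsto_add)
  then show ?thesis by simp
qed

text \<open>Periodicity can make the value n - 1 unreachable, hence the positivity premise. When it
  is reachable, inversion at the scale t = s / sqrt n and dominated convergence, with the Gaussian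
  of \<open>span_bound\<close> as majorant, give a positive limit after multiplication by sqrt
  n.\<close>

lemma walk_lower:
  "\<exists>c>0. \<forall>\<^sub>F n in sequentially. pmf (walk p n) (n - 1) > 0 \<longrightarrow> c / sqrt (real n) \<le> pmf (walk p n) (n - 1)"
proof -
  obtain h c where hc: "span_bound h c" using span_bound_exists by blast
  then have h: "h > 0" and c: "c > 0" and supp: "\<forall>a\<in>set_pmf p. h dvd a"
    and bd: "\<And>t. \<bar>t\<bar> \<le> pi / real h \<Longrightarrow> cmod (centred_char p t) \<le> exp (- (c * t\<^sup>2))"
    by (auto simp: span_bound_def)
  let ?I = "\<lambda>n. {-(pi * sqrt n / h)..pi * sqrt n / h}"
  \<comment> \<open>The inversion integrand after the substitution t = s / sqrt n. The remaining
    phase is s / sqrt n because the target n - 1 is 1 below the mean, so it disappears in the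
    limit.\<close>
  define g where "g n s = indicator (?I n) s * Re (centred_char p (s / sqrt n) ^ n * iexp (s / sqrt n))"
    for n s
  let ?G = "\<lambda>s. exp (- (offspring_var / 2 * s\<^sup>2))"
  have [measurable]: "g n \<in> borel_measurable borel" for n unfolding g_def by measurable
  define J where "J = (LBINT s. ?G s)"
  have J: "J > 0"
    using has_bochner_integral_gaussian[of "offspring_var / 2"] offspring_var_pos
    by (simp add: J_def has_bochner_integral_iff)
  have "(\<lambda>n. LBINT s. g n s) \<longlonglongrightarrow> J"
    unfolding J_def
  proof (rule integral_dominated_convergence[where w = "\<lambda>s. exp (- (c * s\<^sup>2))"])
    show "integrable lborel (\<lambda>s. exp (- (c * s\<^sup>2)))"
      using has_bochner_integral_gaussian[OF c] by (simp add: has_bochner_integral_iff)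
    show "AE s in lborel. (\<lambda>n. g n s) \<longlonglongrightarrow> ?G s"
    proof (rule AE_I2)
      fix s :: real
      have "(\<lambda>n. s / sqrt (real n)) \<longlonglongrightarrow> 0" by real_asymp
      then have "(\<lambda>n. iexp (s / sqrt (real n))) \<longlonglongrightarrow> iexp 0"
        by (rule isCont_tendsto_compose[OF isCont_iexp])
      from tendsto_mult[OF centred_char_power_limit[of s] this]
      have "(\<lambda>n. centred_char p (s / sqrt n) ^ n * iexp (s / sqrt n)) \<longlonglongrightarrow> of_real (?G s)" by simp
      from tendsto_Re[OF this]
      have "(\<lambda>n. Re (centred_char p (s / sqrt n) ^ n * iexp (s / sqrt n))) \<longlonglongrightarrow> ?G s"
        by (simp only: Re_complex_of_real)
      moreover have "\<forall>\<^sub>F n in sequentially. Re (centred_char p (s / sqrt n) ^ n * iexp (s / sqrt n)) = g n s"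
      proof -
        have "filterlim (\<lambda>n. pi * sqrt (real n) / h) at_top sequentially"
          using h by real_asymp
        then have "\<forall>\<^sub>F n in sequentially. \<bar>s\<bar> \<le> pi * sqrt (real n) / h"
          by (simp add: filterlim_at_top)
        then show ?thesis
        proof eventually_elim
          case (elim n)
          then have "s \<in> ?I n" by auto
          then show ?case by (simp only: g_def indicator_simps mult_1)
        qed
      qed
      ultimately show "(\<lambda>n. g n s) \<longlonglongrightarrow> ?G s" by (rule Lim_transform_eventually)
    qed
    show "AE s in lborel. norm (g n s) \<le> exp (- (c * s\<^sup>2))" for n
    proof (rule AE_I2)
      fix s :: real
      show "norm (g n s) \<le> exp (- (c * s\<^sup>2))"
      proof (cases "s \<in> ?I n")
        case True
        have "\<bar>Re (centred_char p (s / sqrt n) ^ n * iexp (s / sqrt n))\<bar> \<le>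
            cmod (centred_char p (s / sqrt n) ^ n * iexp (s / sqrt n))"
          by (rule abs_Re_le_cmod)
        also have "\<dots> = cmod (centred_char p (s / sqrt n)) ^ n"
          by (simp only: norm_mult norm_power norm_exp_i_times mult_1_right)
        also have "\<dots> \<le> exp (- (c * s\<^sup>2))"
        proof (cases "n = 0")
          case False
          have "\<bar>s / sqrt n\<bar> \<le> pi / h"
          proof -
            have "\<bar>s\<bar> \<le> pi * sqrt n / h" using True by auto
            then have "\<bar>s\<bar> / sqrt n \<le> pi * sqrt n / h / sqrt n" by (intro divide_right_mono) auto
            then show ?thesis using False by (simp add: abs_divide)
          qed
          then have "cmod (centred_char p (s / sqrt n)) ^ n \<le> exp (- (c * (s / sqrt n)\<^sup>2)) ^ n"
            by (intro power_mono bd) auto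
          also have "\<dots> = exp (- (c * s\<^sup>2))"
            using False by (simp add: exp_of_nat_mult[symmetric] power_divide)
          finally show ?thesis .
        qed (use True in simp)
        finally show ?thesis using True by (simp only: g_def indicator_simps mult_1 real_norm_def)
      qed (simp add: g_def)
    qed
  qed auto
  then have ev: "\<forall>\<^sub>F n in sequentially. J / 2 < (LBINT s. g n s)"
    by (rule order_tendstoD) (use J in simp)
  have eq: "pmf (walk p n) (n - 1) = h / (2 * pi) * (LBINT s. g n s) / sqrt n"
    if n: "n > 0" and pos: "pmf (walk p n) (n - 1) > 0" for n
  proof -
    have "n - 1 \<in> set_pmf (walk p n)" using pos by (simp add: set_pmf_iff)
    then have "int h dvd int s - int (n - 1)" if "s \<in> set_pmf (walk p n)" for s
      using dvd_walk[OF supp that] dvd_walk[OF supp] by (intro dvd_diff) auto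
    from walk_inversion[OF h this]
    have "pmf (walk p n) (n - 1) = h / (2 * pi) *
        (LBINT t:{-(pi / h)..pi / h}. Re (centred_char p t ^ n * iexp (t * (real n - real (n - 1)))))"
      by simp
    also have "(LBINT t:{-(pi / h)..pi / h}. Re (centred_char p t ^ n * iexp (t * (real n - real (n - 1))))) =
        (LBINT t. indicator {-(pi / h)..pi / h} t * Re (centred_char p t ^ n * iexp t))"
      using n unfolding set_lebesgue_integral_def by (simp add: of_nat_diff)
    also have "\<dots> = \<bar>1 / sqrt n\<bar> *\<^sub>R (LBINT s. indicator {-(pi / h)..pi / h} (0 + 1 / sqrt n * s) *
        Re (centred_char p (0 + 1 / sqrt n * s) ^ n * iexp (0 + 1 / sqrt n * s)))"
      by (rule lborel_integral_real_affine) (use n in simp)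
    also have "(LBINT s. indicator {-(pi / h)..pi / h} (0 + 1 / sqrt n * s) *
        Re (centred_char p (0 + 1 / sqrt n * s) ^ n * iexp (0 + 1 / sqrt n * s))) = (LBINT s. g n s)"
    proof (rule Bochner_Integration.integral_cong)
      fix s :: real
      have "0 + 1 / sqrt n * s = s / sqrt n" by simp
      moreover have "indicator {-(pi / h)..pi / h} (s / sqrt n) = (indicator (?I n) s :: real)"
        using n h by (auto simp: indicator_def field_simps)
      ultimately show "indicator {-(pi / h)..pi / h} (0 + 1 / sqrt n * s) *
        Re (centred_char p (0 + 1 / sqrt n * s) ^ n * iexp (0 + 1 / sqrt n * s)) = g n s"
        by (simp only: g_def)
    qed simp
    finally show ?thesis by (simp add: algebra_simps)
  qed
  have "\<forall>\<^sub>F n in sequentially. pmf (walk p n) (n - 1) > 0 \<longrightarrow>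
      (h / (2 * pi) * (J / 2)) / sqrt (real n) \<le> pmf (walk p n) (n - 1)"
    using ev eventually_gt_at_top[of 0]
  proof eventually_elim
    case (elim n)
    show ?case
    proof
      assume pos: "pmf (walk p n) (n - 1) > 0"
      have "h / (2 * pi) * (J / 2) \<le> h / (2 * pi) * (LBINT s. g n s)"
        using elim(1) by (intro mult_left_mono) auto
      then show "h / (2 * pi) * (J / 2) / sqrt (real n) \<le> pmf (walk p n) (n - 1)"
        unfolding eq[OF elim(2) pos] by (intro divide_right_mono) auto
    qed
  qed
  moreover have "h / (2 * pi) * (J / 2) > 0" using h J by simp
  ultimately show ?thesis by blast
qed

end

section \<open>Sums over trees and words\<close>

instance otree :: countable by countable_datatype

text \<open>Sums over trees and words are kept as nonnegative integrals over counting measures, so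
  that they can be rearranged before any summability is known.\<close>

lemma nn_integral_count_space_Sigma:
  "(\<integral>\<^sup>+z. f z \<partial>count_space (Sigma A B)) = (\<integral>\<^sup>+x. (\<integral>\<^sup>+y. f (x, y) \<partial>count_space (B x)) \<partial>count_space A)"
proof -
  have "(\<integral>\<^sup>+z. f z \<partial>count_space (Sigma A B)) = (\<integral>\<^sup>+z. f z * indicator (Sigma A B) z \<partial>count_space UNIV)"
    by (rule nn_integral_count_space_indicator) simp
  also have "\<dots> = (\<integral>\<^sup>+x. (\<integral>\<^sup>+y. f (x, y) * indicator (Sigma A B) (x, y) \<partial>count_space UNIV) \<partial>count_space UNIV)"
    by (rule nn_integral_fst_count_space[symmetric])
  also have "\<dots> = (\<integral>\<^sup>+x. (\<integral>\<^sup>+y. f (x, y) * indicator (B x) y * indicator A x \<partial>count_space UNIV) \<partial>count_space UNIV)"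
    by (intro nn_integral_cong) (auto split: split_indicator)
  also have "\<dots> = (\<integral>\<^sup>+x. (\<integral>\<^sup>+y. f (x, y) * indicator (B x) y \<partial>count_space UNIV) * indicator A x \<partial>count_space UNIV)"
    by (simp add: nn_integral_multc)
  finally show ?thesis by (simp add: nn_integral_count_space_indicator)
qed

lemma nn_integral_count_space_restrict:
  "(\<integral>\<^sup>+x. f x * indicator B x \<partial>count_space A) = (\<integral>\<^sup>+x. f x \<partial>count_space (A \<inter> B))"
  by (simp add: nn_integral_count_space_indicator mult.assoc)
    (intro nn_integral_cong, simp split: split_indicator)

lemma nn_integral_count_space_subset:
  assumes "A \<subseteq> B"
  shows "(\<integral>\<^sup>+x. f x \<partial>count_space A) \<le> (\<integral>\<^sup>+x. f x \<partial>count_space B)"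
  using assms by (auto simp: nn_integral_count_space_indicator intro!: nn_integral_mono split: split_indicator)

lemma nn_integral_lists_Suc:
  "(\<integral>\<^sup>+xs. f xs \<partial>count_space {xs. length xs = Suc n \<and> set xs \<subseteq> A}) =
   (\<integral>\<^sup>+x. (\<integral>\<^sup>+xs. f (x # xs) \<partial>count_space {xs. length xs = n \<and> set xs \<subseteq> A}) \<partial>count_space A)"
proof -
  have "bij_betw (\<lambda>(x, xs). x # xs) (A \<times> {xs. length xs = n \<and> set xs \<subseteq> A}) {xs. length xs = Suc n \<and> set xs \<subseteq> A}"
    by (rule bij_betwI[where g = "\<lambda>xs. (hd xs, tl xs)"]) (auto simp: length_Suc_conv)
  from nn_integral_bij_count_space[OF this, of f, symmetric] show ?thesis
    by (simp add: nn_integral_count_space_Sigma case_prod_unfold)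
qed

lemma nn_integral_lists_0:
  "(\<integral>\<^sup>+xs. f xs \<partial>count_space {xs. length xs = 0 \<and> set xs \<subseteq> A}) = f []"
proof -
  have "{xs. length xs = 0 \<and> set xs \<subseteq> A} = {[]}" by auto
  then show ?thesis by (simp add: nn_integral_count_space_finite)
qed

lemma nn_integral_lists_prod:
  "(\<integral>\<^sup>+xs. prod_list (map f xs) \<partial>count_space {xs. length xs = n \<and> set xs \<subseteq> A}) =
   (\<integral>\<^sup>+x. f x \<partial>count_space A) ^ n"
proof (induction n)
  case 0
  then show ?case by (simp only: nn_integral_lists_0) simp
next
  case (Suc n)
  show ?case
    unfolding nn_integral_lists_Suc list.map prod_list.Cons
    by (simp add: nn_integral_cmult nn_integral_multc Suc.IH)
qed

section \<open>Weights of words and trees, and the cycle lemma in terms of probabilities\<close>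

context
  fixes p :: "nat pmf"
begin

definition word_weight :: "nat list \<Rightarrow> ennreal" where
  "word_weight d = prod_list (map (\<lambda>a. ennreal (pmf p a)) d)"

abbreviation tree_weight :: "otree \<Rightarrow> ennreal" where
  "tree_weight t \<equiv> word_weight (code t)"

lemma word_weight_append: "word_weight (d @ e) = word_weight d * word_weight e"
  by (simp add: word_weight_def)

lemma word_weight_rotate: "word_weight (rotate i d) = word_weight d"
proof -
  have "word_weight (rotate i d) = word_weight (drop k d) * word_weight (take k d)" if "k = i mod length d" for k
    using that by (simp add: rotate_drop_take word_weight_append)
  then show ?thesis
    by (metis append_take_drop_id mult.commute word_weight_append)
qed

lemma tree_weight_Node:
  "tree_weight (Node ts) = ennreal (pmf p (length ts)) * prod_list (map tree_weight ts)"
proof -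
  have "word_weight (forest_code ts) = prod_list (map tree_weight ts)"
    by (induction ts) (simp_all add: word_weight_append, simp add: word_weight_def)
  then show ?thesis by (simp add: word_weight_def)
qed

lemma nn_integral_walk:
  "(\<integral>\<^sup>+s. f s \<partial>measure_pmf (walk p n)) =
   (\<integral>\<^sup>+d. word_weight d * f (sum_list d) \<partial>count_space {d. length d = n \<and> set d \<subseteq> UNIV})"
proof (induction n arbitrary: f)
  case 0
  then show ?case by (simp only: nn_integral_lists_0) (simp add: word_weight_def)
next
  case (Suc n)
  have "(\<integral>\<^sup>+s. f s \<partial>measure_pmf (walk p (Suc n))) = (\<integral>\<^sup>+a. (\<integral>\<^sup>+b. f (a + b) \<partial>measure_pmf (walk p n)) \<partial>measure_pmf p)"
    by (simp add: walk_Suc nn_integral_pair_pmf')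
  also have "\<dots> = (\<integral>\<^sup>+a. ennreal (pmf p a) * (\<integral>\<^sup>+d. word_weight d * f (a + sum_list d) \<partial>count_space {d. length d = n \<and> set d \<subseteq> UNIV}) \<partial>count_space UNIV)"
    by (simp only: Suc.IH) (rule nn_integral_measure_pmf)
  also have "\<dots> = (\<integral>\<^sup>+a. (\<integral>\<^sup>+d. word_weight (a # d) * f (sum_list (a # d)) \<partial>count_space {d. length d = n \<and> set d \<subseteq> UNIV}) \<partial>count_space UNIV)"
    by (simp add: nn_integral_cmult[symmetric] word_weight_def mult.assoc)
  finally show ?case by (simp only: nn_integral_lists_Suc)
qed

lemma pmf_walk:
  "ennreal (pmf (walk p n) s) = (\<integral>\<^sup>+d. word_weight d \<partial>count_space {d. length d = n \<and> sum_list d = s})"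
proof -
  have "ennreal (pmf (walk p n) s) = (\<integral>\<^sup>+x. indicator {s} x \<partial>measure_pmf (walk p n))"
    by (simp add: emeasure_pmf_single)
  also have "\<dots> = (\<integral>\<^sup>+d. word_weight d * indicator {d. sum_list d = s} d \<partial>count_space {d. length d = n \<and> set d \<subseteq> UNIV})"
    unfolding nn_integral_walk by (intro nn_integral_cong) (simp split: split_indicator)
  also have "\<dots> = (\<integral>\<^sup>+d. word_weight d \<partial>count_space {d. length d = n \<and> sum_list d = s})"
    unfolding nn_integral_count_space_restrict by (intro arg_cong2[where f = nn_integral]) (auto simp: Collect_conj_eq)
  finally show ?thesis .
qed

text \<open>The suffix from position \<open>i\<close> already contains a complete code, so the
  letters that wrap around do not affect the tree read first.\<close>

lemma first_tree_rotate:
  assumes "i < nodes t"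
  shows "first_tree (rotate i (code t)) = first_tree (drop i (code t))"
proof -
  have "sum_list (drop i (code t)) < length (drop i (code t))"
    using code_proper_suffix[of t "take i (code t)" "drop i (code t)"] assms by simp
  then obtain s r where s: "drop i (code t) = code s @ r" by (rule parse_tree)
  then have "rotate i (code t) = code s @ (r @ take i (code t))"
    using assms by (simp add: rotate_drop_take)
  then show ?thesis using s by (simp only: first_tree_code)
qed

text \<open>A node of \<open>t\<close> is a position \<open>i\<close> in its code, and rotation by
  \<open>i\<close> keeps the weight while moving the subtree at that node to the front. The cycle
  lemma then trades the pairs (t, i) for words.\<close>

lemma nn_integral_fringe_sum:
  fixes f :: "otree \<Rightarrow> ennreal"
  shows "(\<integral>\<^sup>+t. tree_weight t * fringe_sum f t \<partial>count_space {t. nodes t = n}) =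
    (\<integral>\<^sup>+d. word_weight d * f (first_tree d) \<partial>count_space {d. length d = n \<and> Suc (sum_list d) = n})"
proof -
  have "(\<integral>\<^sup>+t. tree_weight t * fringe_sum f t \<partial>count_space {t. nodes t = n}) =
      (\<integral>\<^sup>+t. (\<integral>\<^sup>+i. word_weight (rotate i (code t)) * f (first_tree (rotate i (code t))) \<partial>count_space {..<n}) \<partial>count_space {t. nodes t = n})"
  proof (rule nn_integral_cong)
    fix t assume "t \<in> space (count_space {t. nodes t = n})"
    then have t: "nodes t = n" by simp
    show "tree_weight t * fringe_sum f t =
       (\<integral>\<^sup>+i. word_weight (rotate i (code t)) * f (first_tree (rotate i (code t))) \<partial>count_space {..<n})"
      using fringe_sum_positions[of f t "[]"]
      by (simp add: t nn_integral_count_space_finite word_weight_rotate sum_distrib_left first_tree_rotate)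
  qed
  also have "\<dots> = (\<integral>\<^sup>+(t, i). word_weight (rotate i (code t)) * f (first_tree (rotate i (code t))) \<partial>count_space ({t. nodes t = n} \<times> {..<n}))"
    by (simp add: nn_integral_count_space_Sigma)
  also have "\<dots> = (\<integral>\<^sup>+d. word_weight d * f (first_tree d) \<partial>count_space {d. length d = n \<and> Suc (sum_list d) = n})"
    using nn_integral_bij_count_space[OF cycle_lemma[of n], of "\<lambda>d. word_weight d * f (first_tree d)"]
    by (simp add: case_prod_unfold)
  finally show ?thesis .
qed

text \<open>This is P(|T| = n); \<open>emeasure_gw_size\<close> links it to the probability
  space.\<close>

definition size_mass :: "nat \<Rightarrow> ennreal" where
  "size_mass n = (\<integral>\<^sup>+t. tree_weight t \<partial>count_space {t. nodes t = n})"

lemma size_mass_0 [simp]: "size_mass 0 = 0"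
  by (simp add: size_mass_def nn_integral_count_space_finite)

lemma fringe_sum_const: "fringe_sum (\<lambda>_. 1) t = (of_nat (nodes t) :: ennreal)"
proof (induction t)
  case (Node ts)
  then have "sum_list (map (fringe_sum (\<lambda>_. 1 :: ennreal)) ts) = of_nat (length (forest_code ts))"
    by (induction ts) auto
  then show ?case by simp
qed

text \<open>The Otter-Dwass formula, obtained from the functional that is constantly 1.\<close>

lemma size_mass_walk:
  assumes "n > 0"
  shows "of_nat n * size_mass n = ennreal (pmf (walk p n) (n - 1))"
proof -
  have "of_nat n * size_mass n = (\<integral>\<^sup>+t. tree_weight t * fringe_sum (\<lambda>_. 1) t \<partial>count_space {t. nodes t = n})"
    unfolding size_mass_def
    by (subst nn_integral_cmult[symmetric]) (auto simp: fringe_sum_const mult.commute intro!: nn_integral_cong)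
  also have "\<dots> = (\<integral>\<^sup>+d. word_weight d \<partial>count_space {d. length d = n \<and> Suc (sum_list d) = n})"
    by (simp add: nn_integral_fringe_sum)
  also have "{d. length d = n \<and> Suc (sum_list d) = n} = {d. length d = n \<and> sum_list d = n - 1}"
    using assms by auto
  finally show ?thesis by (simp add: pmf_walk)
qed

text \<open>Cutting a word after its first tree leaves a remainder constrained only by having its
  sum equal to its length, because a code falls short of its length by exactly 1. The weight of all
  remainders is a walk probability.\<close>

lemma nn_integral_fringe_sum_walk:
  fixes f :: "otree \<Rightarrow> ennreal"
  shows "(\<integral>\<^sup>+t. tree_weight t * fringe_sum f t \<partial>count_space {t. nodes t = n}) =
    (\<integral>\<^sup>+s. tree_weight s * f s * ennreal (pmf (walk p (n - nodes s)) (n - nodes s)) \<partial>count_space {s. nodes s \<le> n})"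
proof -
  let ?R = "\<lambda>s. {r. length r = n - nodes s \<and> sum_list r = n - nodes s}"
  have "bij_betw (\<lambda>(s, r). code s @ r) (SIGMA s:{s. nodes s \<le> n}. ?R s) {d. length d = n \<and> Suc (sum_list d) = n}"
    unfolding bij_betw_def
  proof
    show "inj_on (\<lambda>(s, r). code s @ r) (SIGMA s:{s. nodes s \<le> n}. ?R s)"
      by (auto simp: inj_on_def code_append_inject)
    show "(\<lambda>(s, r). code s @ r) ` (SIGMA s:{s. nodes s \<le> n}. ?R s) = {d. length d = n \<and> Suc (sum_list d) = n}"
    proof (intro set_eqI iffI)
      fix d assume "d \<in> (\<lambda>(s, r). code s @ r) ` (SIGMA s:{s. nodes s \<le> n}. ?R s)"
      then obtain s r where "d = code s @ r" "nodes s \<le> n" "length r = n - nodes s" "sum_list r = n - nodes s" by auto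
      then show "d \<in> {d. length d = n \<and> Suc (sum_list d) = n}"
        using sum_list_code[of s] by simp
    next
      fix d assume d: "d \<in> {d. length d = n \<and> Suc (sum_list d) = n}"
      then have "sum_list d < length d" by simp
      then obtain s r where s: "d = code s @ r" by (rule parse_tree)
      have "nodes s \<le> n" "length r = n - nodes s" "sum_list r = n - nodes s"
        using d s sum_list_code[of s] by auto
      then show "d \<in> (\<lambda>(s, r). code s @ r) ` (SIGMA s:{s. nodes s \<le> n}. ?R s)"
        using s by (intro image_eqI[of _ _ "(s, r)"]) auto
    qed
  qed
  from nn_integral_bij_count_space[OF this, of "\<lambda>d. word_weight d * f (first_tree d)"]
  have "(\<integral>\<^sup>+t. tree_weight t * fringe_sum f t \<partial>count_space {t. nodes t = n}) =
      (\<integral>\<^sup>+(s, r). word_weight (code s @ r) * f (first_tree (code s @ r)) \<partial>count_space (SIGMA s:{s. nodes s \<le> n}. ?R s))"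
    by (simp add: nn_integral_fringe_sum case_prod_unfold)
  also have "\<dots> = (\<integral>\<^sup>+s. (\<integral>\<^sup>+r. tree_weight s * f s * word_weight r \<partial>count_space (?R s)) \<partial>count_space {s. nodes s \<le> n})"
    by (simp add: nn_integral_count_space_Sigma word_weight_append mult_ac)
  also have "\<dots> = (\<integral>\<^sup>+s. tree_weight s * f s * ennreal (pmf (walk p (n - nodes s)) (n - nodes s)) \<partial>count_space {s. nodes s \<le> n})"
    by (simp add: nn_integral_cmult pmf_walk)
  finally show ?thesis .
qed

end

section \<open>Exponential moments of bounded fringe functionals\<close>

lemma nn_integral_lists_length:
  "(\<integral>\<^sup>+xs. f xs \<partial>count_space {xs. set xs \<subseteq> A}) =
   (\<integral>\<^sup>+n. (\<integral>\<^sup>+xs. f xs \<partial>count_space {xs. length xs = n \<and> set xs \<subseteq> A}) \<partial>count_space UNIV)"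
proof -
  have "bij_betw snd (SIGMA n:UNIV. {xs. length xs = n \<and> set xs \<subseteq> A}) {xs. set xs \<subseteq> A}"
    by (rule bij_betwI[where g = "\<lambda>xs. (length xs, xs)"]) auto
  from nn_integral_bij_count_space[OF this, of f, symmetric] show ?thesis
    by (simp add: nn_integral_count_space_Sigma)
qed

lemma fringe_sum_le:
  fixes f :: "otree \<Rightarrow> real"
  assumes "\<And>t. f t \<le> B"
  shows "fringe_sum f t \<le> B * nodes t"
proof (induction t)
  case (Node ts)
  then have "sum_list (map (fringe_sum f) ts) \<le> B * length (forest_code ts)"
    by (induction ts) (auto simp: distrib_left add_mono)
  then show ?case using assms[of "Node ts"] by (simp add: distrib_left add_mono)
qed

text \<open>The trees of height less than \<open>H\<close>, where a single node has height
  0.\<close>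

primrec level :: "nat \<Rightarrow> otree set" where
  "level 0 = {}"
| "level (Suc H) = Node ` {ts. set ts \<subseteq> level H}"

lemma level_Suc: "level H \<subseteq> level (Suc H)"
  by (induction H) auto

lemma level_mono: "H \<le> K \<Longrightarrow> level H \<subseteq> level K"
  by (rule lift_Suc_mono_le[of level]) (rule level_Suc)

lemma UN_level: "(\<Union>H. level H) = UNIV"
proof -
  have "t \<in> level (nodes t)" for t
  proof (induction t)
    case (Node ts)
    have "s \<in> level (length (forest_code ts))" if "s \<in> set ts" for s
    proof -
      have "nodes s \<le> length (forest_code ts)"
        using that by (simp add: length_concat comp_def member_le_sum_list)
      then show ?thesis using Node[OF that] level_mono by blast
    qed
    then show ?case by auto
  qed
  then show ?thesis by blast
qed

text \<open>
  The factor \<open>\<theta> ^ nodes t\<close> absorbs the mean of \<open>g\<close>: the tilted mass of the trees of bounded height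
  stays at most 1 because \<open>\<theta> + 2 * c * \<mu> = 1\<close>.
\<close>

context
  fixes p :: "nat pmf" and g :: "otree \<Rightarrow> real" and c \<theta> \<mu> :: real
  assumes g_nonneg: "\<And>t. 0 \<le> g t" and c_nonneg: "0 \<le> c"
    and small: "\<And>t. g t \<noteq> 0 \<Longrightarrow> c * fringe_sum g t \<le> ln 2"
    and mean: "(\<integral>\<^sup>+t. tree_weight p t * ennreal (g t) \<partial>count_space UNIV) \<le> ennreal \<mu>"
    and \<mu>_nonneg: "0 \<le> \<mu>" and \<theta>: "\<theta> = 1 - 2 * c * \<mu>" "0 < \<theta>"
begin

definition tilt :: "otree \<Rightarrow> real" where
  "tilt t = exp (c * fringe_sum g t) * \<theta> ^ nodes t"

lemma tilt_pos: "tilt t > 0" using \<theta>(2) by (simp add: tilt_def)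

lemma tilt_Node: "tilt (Node ts) = exp (c * g (Node ts)) * (\<theta> * prod_list (map tilt ts))"
proof -
  have "prod_list (map tilt ts) = exp (c * sum_list (map (fringe_sum g) ts)) * \<theta> ^ length (forest_code ts)"
    by (induction ts) (auto simp: tilt_def distrib_left exp_add power_add)
  then show ?thesis by (simp add: tilt_def distrib_left exp_add)
qed

lemma prod_tilt_nonneg: "0 \<le> prod_list (map tilt ts)"
  by (induction ts) (auto intro!: mult_nonneg_nonneg less_imp_le[OF tilt_pos])

text \<open>With x = c * g (Node ts), the inequality 1 - x \<le> exp (- x) gives tilt * (1 - x)
  \<le> \<theta> * product. Where \<open>g\<close> is nonzero the tilt is at most 2 by
  \<open>small\<close>. The additive form separates \<open>g\<close> from the product, so that only
  the mean of \<open>g\<close> enters.\<close>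

lemma tilt_Node_le: "tilt (Node ts) \<le> \<theta> * prod_list (map tilt ts) + 2 * c * g (Node ts)"
proof (cases "g (Node ts) = 0")
  case True
  then show ?thesis by (simp add: tilt_Node)
next
  case False
  let ?x = "c * g (Node ts)" and ?P = "\<theta> * prod_list (map tilt ts)"
  have x: "0 \<le> ?x" using g_nonneg c_nonneg by simp
  have \<theta>1: "\<theta> \<le> 1" using \<theta>(1) c_nonneg \<mu>_nonneg by simp
  have "tilt (Node ts) \<le> exp (ln 2) * 1"
    unfolding tilt_def using small[OF False] \<theta> \<theta>1
    by (intro mult_mono power_le_one) (auto simp del: exp_ln)
  then have 2: "tilt (Node ts) \<le> 2" by simp
  have "1 - ?x \<le> exp (- ?x)" using exp_ge_add_one_self[of "- ?x"] by simp
  then have "tilt (Node ts) * (1 - ?x) \<le> tilt (Node ts) * exp (- ?x)"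
    by (intro mult_left_mono less_imp_le[OF tilt_pos])
  also have "\<dots> = ?P" by (simp add: tilt_Node exp_minus)
  finally have "tilt (Node ts) \<le> ?P + tilt (Node ts) * ?x" by (simp add: algebra_simps)
  also have "tilt (Node ts) * ?x \<le> 2 * ?x" using 2 x by (rule mult_right_mono)
  finally show ?thesis by simp
qed

text \<open>Independence of the branches gives mass(H + 1) \<le> \<theta> * E[mass(H) ^ \<xi>] + 2 *
  c * \<mu>, which preserves the bound 1. Truncating the height turns a fixed-point equation into an
  iteration started at 0; the equation alone would not exclude an infinite mass.\<close>

lemma exponential_moment_level:
  "(\<integral>\<^sup>+t. tree_weight p t * ennreal (tilt t) \<partial>count_space (level H)) \<le> 1"
proof (induction H)
  case (Suc H)
  let ?E = "\<lambda>t. tree_weight p t * ennreal (tilt t)"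
  have prod: "prod_list (map (tree_weight p) ts) * ennreal (prod_list (map tilt ts)) = prod_list (map ?E ts)" for ts
  proof (induction ts)
    case (Cons t ts)
    have "ennreal (tilt t * prod_list (map tilt ts)) = ennreal (tilt t) * ennreal (prod_list (map tilt ts))"
      by (rule ennreal_mult) (auto intro: less_imp_le[OF tilt_pos] prod_tilt_nonneg)
    then show ?case using Cons by (simp add: mult_ac)
  qed simp
  have bij: "bij_betw Node {ts. set ts \<subseteq> level H} (level (Suc H))"
    by (simp add: bij_betw_def inj_on_def)
  have "(\<integral>\<^sup>+t. ?E t \<partial>count_space (level (Suc H))) = (\<integral>\<^sup>+ts. ?E (Node ts) \<partial>count_space {ts. set ts \<subseteq> level H})"
    by (rule nn_integral_bij_count_space[OF bij, symmetric])
  also have "\<dots> \<le> (\<integral>\<^sup>+ts. ennreal \<theta> * (ennreal (pmf p (length ts)) * prod_list (map ?E ts)) +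
      ennreal (2 * c) * (tree_weight p (Node ts) * ennreal (g (Node ts))) \<partial>count_space {ts. set ts \<subseteq> level H})"
  proof (rule nn_integral_mono)
    fix ts
    have "ennreal (tilt (Node ts)) \<le> ennreal (\<theta> * prod_list (map tilt ts) + 2 * c * g (Node ts))"
      using tilt_Node_le by (rule ennreal_leI)
    also have "\<dots> = ennreal \<theta> * ennreal (prod_list (map tilt ts)) + ennreal (2 * c) * ennreal (g (Node ts))"
      using \<theta>(2) prod_tilt_nonneg c_nonneg g_nonneg
      by (subst ennreal_plus) (auto simp: ennreal_mult[symmetric])
    finally have "?E (Node ts) \<le> tree_weight p (Node ts) *
        (ennreal \<theta> * ennreal (prod_list (map tilt ts)) + ennreal (2 * c) * ennreal (g (Node ts)))"
      by (rule mult_left_mono) simp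
    also have "\<dots> = ennreal \<theta> * (ennreal (pmf p (length ts)) * prod_list (map ?E ts)) +
      ennreal (2 * c) * (tree_weight p (Node ts) * ennreal (g (Node ts)))"
      by (simp only: prod[symmetric] tree_weight_Node distrib_left) (simp only: mult_ac)
    finally show "?E (Node ts) \<le> \<dots>" .
  qed
  also have "\<dots> = ennreal \<theta> * (\<integral>\<^sup>+ts. ennreal (pmf p (length ts)) * prod_list (map ?E ts) \<partial>count_space {ts. set ts \<subseteq> level H}) +
      ennreal (2 * c) * (\<integral>\<^sup>+ts. tree_weight p (Node ts) * ennreal (g (Node ts)) \<partial>count_space {ts. set ts \<subseteq> level H})"
    by (simp add: nn_integral_add nn_integral_cmult)
  also have "\<dots> \<le> ennreal \<theta> * 1 + ennreal (2 * c) * ennreal \<mu>"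
  proof (intro add_mono mult_left_mono)
    have "(\<integral>\<^sup>+ts. tree_weight p (Node ts) * ennreal (g (Node ts)) \<partial>count_space {ts. set ts \<subseteq> level H}) =
       (\<integral>\<^sup>+t. tree_weight p t * ennreal (g t) \<partial>count_space (level (Suc H)))"
      by (rule nn_integral_bij_count_space[OF bij])
    also have "\<dots> \<le> (\<integral>\<^sup>+t. tree_weight p t * ennreal (g t) \<partial>count_space UNIV)"
      by (rule nn_integral_count_space_subset) simp
    finally show "(\<integral>\<^sup>+ts. tree_weight p (Node ts) * ennreal (g (Node ts)) \<partial>count_space {ts. set ts \<subseteq> level H}) \<le> ennreal \<mu>"
      using mean by (rule order_trans)
    have "(\<integral>\<^sup>+ts. ennreal (pmf p (length ts)) * prod_list (map ?E ts) \<partial>count_space {ts. set ts \<subseteq> level H}) =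
       (\<integral>\<^sup>+n. ennreal (pmf p n) * (\<integral>\<^sup>+t. ?E t \<partial>count_space (level H)) ^ n \<partial>count_space UNIV)"
      unfolding nn_integral_lists_length
    proof (rule nn_integral_cong)
      fix n
      have "(\<integral>\<^sup>+ts. ennreal (pmf p (length ts)) * prod_list (map ?E ts) \<partial>count_space {ts. length ts = n \<and> set ts \<subseteq> level H}) =
        (\<integral>\<^sup>+ts. ennreal (pmf p n) * prod_list (map ?E ts) \<partial>count_space {ts. length ts = n \<and> set ts \<subseteq> level H})"
        by (intro nn_integral_cong) simp
      then show "(\<integral>\<^sup>+ts. ennreal (pmf p (length ts)) * prod_list (map ?E ts) \<partial>count_space {ts. length ts = n \<and> set ts \<subseteq> level H}) =
         ennreal (pmf p n) * (\<integral>\<^sup>+t. ?E t \<partial>count_space (level H)) ^ n"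
        by (simp only: nn_integral_lists_prod[symmetric]) (simp add: nn_integral_cmult)
    qed
    also have "\<dots> \<le> (\<integral>\<^sup>+n. ennreal (pmf p n) * 1 \<partial>count_space UNIV)"
      using Suc.IH by (intro nn_integral_mono mult_left_mono power_le_one) auto
    also have "\<dots> = 1" by (simp add: nn_integral_pmf_eq_1)
    finally show "(\<integral>\<^sup>+ts. ennreal (pmf p (length ts)) * prod_list (map ?E ts) \<partial>count_space {ts. set ts \<subseteq> level H}) \<le> 1" .
  qed auto
  also have "\<dots> = 1"
    using \<theta> c_nonneg \<mu>_nonneg by (simp add: ennreal_mult[symmetric] ennreal_plus[symmetric] del: ennreal_plus)
  finally show ?case .
qed (simp add: nn_integral_count_space_finite)

lemma exponential_moment:
  "(\<integral>\<^sup>+t. tree_weight p t * ennreal (tilt t) \<partial>count_space UNIV) \<le> 1"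
proof -
  let ?E = "\<lambda>t. tree_weight p t * ennreal (tilt t)"
  have "(\<integral>\<^sup>+t. ?E t \<partial>count_space UNIV) = (\<integral>\<^sup>+t. (SUP H. ?E t * indicator (level H) t) \<partial>count_space UNIV)"
  proof (rule nn_integral_cong)
    fix t
    obtain H where H: "t \<in> level H" using UN_level by blast
    show "?E t = (SUP H. ?E t * indicator (level H) t)"
      by (intro antisym SUP_upper2[of H] SUP_least) (use H in \<open>auto split: split_indicator\<close>)
  qed
  also have "\<dots> = (SUP H. \<integral>\<^sup>+t. ?E t * indicator (level H) t \<partial>count_space UNIV)"
  proof (rule nn_integral_monotone_convergence_SUP)
    show "incseq (\<lambda>H t. ?E t * indicator (level H) t)"
      using level_Suc by (intro incseq_SucI le_funI mult_left_mono) (auto split: split_indicator)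
  qed auto
  also have "\<dots> \<le> 1"
    using exponential_moment_level by (intro SUP_least) (simp add: nn_integral_count_space_indicator)
  finally show ?thesis .
qed

text \<open>A Chernoff bound: on the event, the tilt is at least (exp (c * \<delta>) * \<theta>) ^
  n. It is useful when exp (c * \<delta>) exceeds 1 / \<theta>.\<close>

lemma exponential_tail:
  "(\<integral>\<^sup>+t. tree_weight p t \<partial>count_space {t. nodes t = n \<and> \<delta> * n \<le> fringe_sum g t}) \<le>
    ennreal ((exp (- (c * \<delta>)) / \<theta>) ^ n)"
proof -
  let ?r = "(exp (- (c * \<delta>)) / \<theta>) ^ n"
  have r: "?r \<ge> 0" using \<theta>(2) by simp
  have "(\<integral>\<^sup>+t. tree_weight p t \<partial>count_space {t. nodes t = n \<and> \<delta> * n \<le> fringe_sum g t}) \<le>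
     (\<integral>\<^sup>+t. ennreal ?r * (tree_weight p t * ennreal (tilt t)) \<partial>count_space {t. nodes t = n \<and> \<delta> * n \<le> fringe_sum g t})"
  proof (rule nn_integral_mono)
    fix t assume "t \<in> space (count_space {t. nodes t = n \<and> \<delta> * n \<le> fringe_sum g t})"
    then have t: "nodes t = n" "\<delta> * n \<le> fringe_sum g t" by auto
    have "exp (- (c * \<delta>)) / \<theta> * (exp (c * \<delta>) * \<theta>) = 1"
      using \<theta>(2) by (simp add: exp_minus)
    then have "1 = ?r * (exp (c * \<delta>) ^ n * \<theta> ^ n)"
      by (metis power_mult_distrib power_one)
    also have "\<dots> \<le> ?r * tilt t"
    proof -
      have "exp (c * \<delta>) ^ n = exp (c * (\<delta> * n))"
        by (simp add: exp_of_nat_mult[symmetric] mult_ac)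
      also have "\<dots> \<le> exp (c * fringe_sum g t)"
        using mult_left_mono[OF t(2) c_nonneg] by simp
      finally show ?thesis
        unfolding tilt_def t(1) using \<theta>(2) r by (intro mult_left_mono mult_right_mono) auto
    qed
    finally have "1 \<le> ennreal (?r * tilt t)" by simp
    also have "\<dots> = ennreal ?r * ennreal (tilt t)" using r tilt_pos[of t] by (intro ennreal_mult) auto
    finally have "tree_weight p t * 1 \<le> tree_weight p t * (ennreal ?r * ennreal (tilt t))"
      by (rule mult_left_mono) simp
    then show "tree_weight p t \<le> ennreal ?r * (tree_weight p t * ennreal (tilt t))"
      by (simp add: mult_ac)
  qed
  also have "\<dots> \<le> (\<integral>\<^sup>+t. ennreal ?r * (tree_weight p t * ennreal (tilt t)) \<partial>count_space UNIV)"
    by (rule nn_integral_count_space_subset) simp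
  also have "\<dots> \<le> ennreal ?r * 1"
    using mult_left_mono[OF exponential_moment, of "ennreal ?r"] by (simp add: nn_integral_cmult)
  finally show ?thesis by simp
qed

end

text \<open>The case g = 0, c = 0, \<theta> = 1 of the moment bound, where the tilt is constantly
  1.\<close>

lemma tree_weight_total: "(\<integral>\<^sup>+t. tree_weight p t \<partial>count_space UNIV) \<le> 1"
proof -
  have "fringe_sum (\<lambda>_. 0 :: real) t = 0" for t
    using fringe_sum_positions[of "\<lambda>_. 0 :: real" t "[]"] by simp
  then show ?thesis
    using exponential_moment[of "\<lambda>_. 0" 0 p 0 1] tilt_def[of "\<lambda>_. 0" 0 p 0 1] by simp
qed

text \<open>A mean of at most \<delta> / 8 makes the cost per node \<theta> = 1 - c * \<delta> / 4,
  against a Chernoff gain of exp (- c * \<delta>). Half of the exponent survives.\<close>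

lemma bounded_fringe_tail:
  fixes g :: "otree \<Rightarrow> real"
  assumes g: "\<And>t. 0 \<le> g t" "\<And>t. g t \<le> B" "\<And>t. g t \<noteq> 0 \<Longrightarrow> nodes t \<le> L"
    and \<delta>: "\<delta> > 0"
    and mean: "(\<integral>\<^sup>+t. tree_weight p t * ennreal (g t) \<partial>count_space UNIV) \<le> ennreal (\<delta> / 8)"
  obtains e where "e > 0"
    "\<And>n. (\<integral>\<^sup>+t. tree_weight p t \<partial>count_space {t. nodes t = n \<and> \<delta> * n \<le> fringe_sum g t}) \<le> ennreal (exp (- e * n))"
proof -
  have B: "B \<ge> 0" using g(1,2) order_trans by blast
  \<comment> \<open>The first term gives \<open>small\<close>, as a tree with nonzero
    \<open>g\<close> has fringe sum at most B * L; the 1 keeps the denominator positive. The second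
    term gives c * \<delta> \<le> 1.\<close>
  define c where "c = min (ln 2 / (B * L + 1)) (1 / \<delta>)"
  have BL: "B * L + 1 > 0" using B by (simp add: add_nonneg_pos)
  have c: "c > 0" using BL \<delta> by (simp add: c_def)
  have c1: "c * \<delta> \<le> 1" using \<delta> by (simp add: c_def min_def field_simps)
  have "c \<le> ln 2 / (B * L + 1)" by (simp add: c_def)
  then have c2: "c * (B * L + 1) \<le> ln 2" using BL by (simp add: pos_le_divide_eq)
  have small: "c * fringe_sum g t \<le> ln 2" if "g t \<noteq> 0" for t
  proof -
    have "fringe_sum g t \<le> B * nodes t" by (rule fringe_sum_le) (rule g(2))
    also have "\<dots> \<le> B * L" using B g(3)[OF that] by (intro mult_left_mono) auto
    finally have "c * fringe_sum g t \<le> c * (B * L + 1)" using c by (intro mult_left_mono) auto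
    then show ?thesis using c2 by simp
  qed
  define \<theta> where "\<theta> = 1 - 2 * c * (\<delta> / 8)"
  have "\<theta> = 1 - c * \<delta> / 4" by (simp add: \<theta>_def)
  with c1 have \<theta>0: "\<theta> > 0" by linarith
  define x where "x = c * \<delta> / 2"
  have x: "0 < x" "x \<le> 1" using c \<delta> c1 by (auto simp: x_def)
  \<comment> \<open>As \<theta> = 1 - x / 2, this yields exp (- x) \<le> \<theta>; one of the two
    factors exp (- x) in exp (- c * \<delta>) then pays for the division by \<theta>.\<close>
  have "1 \<le> (1 + x) * (1 - x / 2)"
  proof -
    have "x * x \<le> x * 1" using x by (intro mult_left_mono) auto
    then show ?thesis by (simp add: algebra_simps)
  qed
  also have "\<dots> \<le> exp x * \<theta>"
    using x by (intro mult_mono exp_ge_add_one_self) (auto simp: \<theta>_def x_def)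
  finally have "exp (- x) \<le> \<theta>" by (simp add: exp_minus field_simps)
  then have "exp (- (c * \<delta>)) / \<theta> \<le> exp (- x)"
  proof -
    have "exp (- (c * \<delta>)) = exp (- x) * exp (- x)" by (simp add: exp_add[symmetric] x_def)
    also have "\<dots> \<le> exp (- x) * \<theta>" using \<open>exp (- x) \<le> \<theta>\<close> by (intro mult_left_mono) auto
    finally show ?thesis using \<theta>0 by (simp add: divide_le_eq)
  qed
  then have "(exp (- (c * \<delta>)) / \<theta>) ^ n \<le> exp (- x * n)" for n
    using \<theta>0 power_mono[of "exp (- (c * \<delta>)) / \<theta>" "exp (- x)" n]
    by (simp add: exp_of_nat_mult[symmetric] mult.commute)
  moreover have "(\<integral>\<^sup>+t. tree_weight p t \<partial>count_space {t. nodes t = n \<and> \<delta> * n \<le> fringe_sum g t}) \<le>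
      ennreal ((exp (- (c * \<delta>)) / \<theta>) ^ n)" for n
    by (rule exponential_tail[where \<mu> = "\<delta> / 8"]) (use g c small mean \<delta> \<theta>0 in \<open>auto simp: \<theta>_def\<close>)
  ultimately have "(\<integral>\<^sup>+t. tree_weight p t \<partial>count_space {t. nodes t = n \<and> \<delta> * n \<le> fringe_sum g t}) \<le> ennreal (exp (- x * n))" for n
    by (meson ennreal_leI order_trans)
  then show ?thesis using that x(1) by blast
qed

section \<open>The mean contribution of the light subtrees\<close>

lemma nn_integral_by_nodes:
  "(\<integral>\<^sup>+t. f t \<partial>count_space {t. nodes t \<in> J}) =
   (\<integral>\<^sup>+j. (\<integral>\<^sup>+t. f t \<partial>count_space {t. nodes t = j}) \<partial>count_space J)"
proof -
  have "bij_betw snd (SIGMA j:J. {t. nodes t = j}) {t. nodes t \<in> J}"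
    by (rule bij_betwI[where g = "\<lambda>t. (nodes t, t)"]) auto
  from nn_integral_bij_count_space[OF this, of f, symmetric] show ?thesis
    by (simp add: nn_integral_count_space_Sigma)
qed

text \<open>\<open>sqrt_e1\<close> and \<open>sqrt_e2\<close> are the first two elementary symmetric
  polynomials in the square roots of the sizes. Being symmetric, they can be averaged over
  independent trees without sorting them.\<close>

primrec sqrt_e1 :: "otree list \<Rightarrow> real" where
  "sqrt_e1 [] = 0"
| "sqrt_e1 (t # ts) = sqrt (nodes t) + sqrt_e1 ts"

primrec sqrt_e2 :: "otree list \<Rightarrow> real" where
  "sqrt_e2 [] = 0"
| "sqrt_e2 (t # ts) = sqrt (nodes t) * sqrt_e1 ts + sqrt_e2 ts"

text \<open>
  The index \<open>a\<close> of a largest child is only required to have at least average size, which makes the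
  bound a sum over index triples that do not depend on the sorted order.
\<close>

primrec light_bound :: "otree \<Rightarrow> real" where
  "light_bound (Node ts) = (\<Sum>a | a < length ts \<and> sum_list (map nodes ts) \<le> length ts * nodes (ts ! a).
     sqrt_e2 (take a ts @ drop (Suc a) ts))"

lemma sqrt_e1_nonneg [simp]: "0 \<le> sqrt_e1 ts"
  by (induction ts) auto

lemma sqrt_e2_nonneg [simp]: "0 \<le> sqrt_e2 ts"
  by (induction ts) auto

lemma light_bound_nonneg: "0 \<le> light_bound t"
  by (cases t) (auto intro!: sum_nonneg)

context
  fixes p :: "nat pmf" and k :: nat
begin

text \<open>The truncated expectation E[sqrt |T|; |T| <= k]. Sizes in a forest with k nodes never
  exceed k, and for a critical law the terms are bounded by multiples of 1 / j, so the cutoff leaves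
  a harmonic sum.\<close>

definition sqrt_mean :: ennreal where
  "sqrt_mean = (\<integral>\<^sup>+t. tree_weight p t * ennreal (sqrt (nodes t)) \<partial>count_space {t. nodes t \<le> k})"

lemma forest_weight_total:
  "(\<integral>\<^sup>+ts. prod_list (map (tree_weight p) ts) \<partial>count_space {ts. length ts = m \<and> set ts \<subseteq> {t. nodes t \<le> k}}) \<le> 1"
proof -
  have "(\<integral>\<^sup>+t. tree_weight p t \<partial>count_space {t. nodes t \<le> k}) \<le> (\<integral>\<^sup>+t. tree_weight p t \<partial>count_space UNIV)"
    by (rule nn_integral_count_space_subset) simp
  also have "\<dots> \<le> 1" by (rule tree_weight_total)
  finally show ?thesis unfolding nn_integral_lists_prod by (intro power_le_one) auto
qed

lemma small_tree_weight_total: "(\<integral>\<^sup>+t. tree_weight p t \<partial>count_space {t. nodes t \<le> k}) \<le> 1"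
  using nn_integral_count_space_subset[of "{t. nodes t \<le> k}" UNIV "tree_weight p"] tree_weight_total[of p]
  by (meson order_trans subset_UNIV)

lemma forest_sqrt_e1:
  "(\<integral>\<^sup>+ts. prod_list (map (tree_weight p) ts) * ennreal (sqrt_e1 ts)
      \<partial>count_space {ts. length ts = m \<and> set ts \<subseteq> {t. nodes t \<le> k}}) \<le> of_nat m * sqrt_mean"
proof (induction m)
  case 0
  then show ?case by (simp only: nn_integral_lists_0) simp
next
  case (Suc m)
  let ?S = "{t. nodes t \<le> k}"
  let ?L = "{ts. length ts = m \<and> set ts \<subseteq> ?S}"
  let ?P = "\<lambda>ts. prod_list (map (tree_weight p) ts)"
  have "(\<integral>\<^sup>+ts. ?P ts * ennreal (sqrt_e1 ts) \<partial>count_space {ts. length ts = Suc m \<and> set ts \<subseteq> ?S}) =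
    (\<integral>\<^sup>+t. (\<integral>\<^sup>+ts. tree_weight p t * ennreal (sqrt (nodes t)) * ?P ts +
       tree_weight p t * (?P ts * ennreal (sqrt_e1 ts)) \<partial>count_space ?L) \<partial>count_space ?S)"
    unfolding nn_integral_lists_Suc
    by (intro nn_integral_cong) (simp add: ennreal_plus distrib_left mult_ac)
  also have "\<dots> = sqrt_mean * (\<integral>\<^sup>+ts. ?P ts \<partial>count_space ?L) +
      (\<integral>\<^sup>+t. tree_weight p t \<partial>count_space ?S) * (\<integral>\<^sup>+ts. ?P ts * ennreal (sqrt_e1 ts) \<partial>count_space ?L)"
    by (simp add: nn_integral_add nn_integral_cmult nn_integral_multc sqrt_mean_def)
  also have "\<dots> \<le> sqrt_mean * 1 + 1 * (of_nat m * sqrt_mean)"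
    by (intro add_mono mult_mono Suc.IH forest_weight_total small_tree_weight_total) auto
  finally show ?case by (simp add: distrib_right)
qed

text \<open>The square is cruder than a count of pairs, but it closes the induction through m + m^2
  \<le> (m + 1)^2.\<close>

lemma forest_sqrt_e2:
  "(\<integral>\<^sup>+ts. prod_list (map (tree_weight p) ts) * ennreal (sqrt_e2 ts)
      \<partial>count_space {ts. length ts = m \<and> set ts \<subseteq> {t. nodes t \<le> k}}) \<le> (of_nat m * sqrt_mean)\<^sup>2"
proof (induction m)
  case 0
  then show ?case by (simp only: nn_integral_lists_0) simp
next
  case (Suc m)
  let ?S = "{t. nodes t \<le> k}"
  let ?L = "{ts. length ts = m \<and> set ts \<subseteq> ?S}"
  let ?P = "\<lambda>ts. prod_list (map (tree_weight p) ts)"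
  have "(\<integral>\<^sup>+ts. ?P ts * ennreal (sqrt_e2 ts) \<partial>count_space {ts. length ts = Suc m \<and> set ts \<subseteq> ?S}) =
    (\<integral>\<^sup>+t. (\<integral>\<^sup>+ts. tree_weight p t * ennreal (sqrt (nodes t)) * (?P ts * ennreal (sqrt_e1 ts)) +
       tree_weight p t * (?P ts * ennreal (sqrt_e2 ts)) \<partial>count_space ?L) \<partial>count_space ?S)"
    unfolding nn_integral_lists_Suc
    by (intro nn_integral_cong) (simp add: ennreal_plus ennreal_mult distrib_left mult_ac)
  also have "\<dots> = sqrt_mean * (\<integral>\<^sup>+ts. ?P ts * ennreal (sqrt_e1 ts) \<partial>count_space ?L) +
      (\<integral>\<^sup>+t. tree_weight p t \<partial>count_space ?S) * (\<integral>\<^sup>+ts. ?P ts * ennreal (sqrt_e2 ts) \<partial>count_space ?L)"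
    by (simp add: nn_integral_add nn_integral_cmult nn_integral_multc sqrt_mean_def)
  also have "\<dots> \<le> sqrt_mean * (of_nat m * sqrt_mean) + 1 * (of_nat m * sqrt_mean)\<^sup>2"
    by (intro add_mono mult_mono Suc.IH forest_sqrt_e1 small_tree_weight_total) auto
  also have "\<dots> = (of_nat m + (of_nat m)\<^sup>2) * sqrt_mean\<^sup>2"
    by (simp add: power2_eq_square algebra_simps)
  also have "\<dots> \<le> (of_nat (Suc m))\<^sup>2 * sqrt_mean\<^sup>2"
  proof (rule mult_right_mono)
    have "m + m\<^sup>2 \<le> (Suc m)\<^sup>2" by (simp add: power2_eq_square)
    then have "(of_nat (m + m\<^sup>2) :: ennreal) \<le> of_nat ((Suc m)\<^sup>2)" by (simp only: of_nat_le_iff)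
    then show "of_nat m + (of_nat m)\<^sup>2 \<le> (of_nat (Suc m) :: ennreal)\<^sup>2" by (simp only: of_nat_add of_nat_power)
  qed simp
  finally show ?case by (simp add: power_mult_distrib)
qed

text \<open>
  Once the other trees are fixed, the size of the tree at index \<open>a\<close> is determined and at least \<open>k / d\<close>.
\<close>

lemma forest_light_index:
  assumes a: "a < d" and Q: "\<And>m. k \<le> d * m \<Longrightarrow> m > 0 \<Longrightarrow> size_mass p m \<le> Q"
  shows "(\<integral>\<^sup>+ts. prod_list (map (tree_weight p) ts) * ennreal (sqrt_e2 (take a ts @ drop (Suc a) ts))
      \<partial>count_space {ts. length ts = d \<and> sum_list (map nodes ts) = k \<and> k \<le> d * nodes (ts ! a)})
    \<le> Q * (of_nat d * sqrt_mean)\<^sup>2"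
proof -
  let ?P = "\<lambda>ts. prod_list (map (tree_weight p) ts)"
  let ?R = "\<lambda>zs. {t. nodes t + sum_list (map nodes zs) = k \<and> k \<le> d * nodes t}"
  let ?L = "{zs. length zs = d - 1 \<and> set zs \<subseteq> {t. nodes t \<le> k}}"
  let ?D = "{ts. length ts = d \<and> sum_list (map nodes ts) = k \<and> k \<le> d * nodes (ts ! a)}"
  have sum_take: "sum_list (map nodes (take a zs)) + sum_list (map nodes (drop a zs)) = sum_list (map nodes zs)" for zs
    by (metis append_take_drop_id map_append sum_list_append)
  have prod_take: "?P (take a zs) * ?P (drop a zs) = ?P zs" for zs
    by (metis append_take_drop_id map_append prod_list.append)
  have bij: "bij_betw (\<lambda>(zs, t). take a zs @ t # drop a zs) (SIGMA zs:?L. ?R zs) ?D"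
  proof (rule bij_betwI[where g = "\<lambda>ts. (take a ts @ drop (Suc a) ts, ts ! a)"])
    show "(\<lambda>(zs, t). take a zs @ t # drop a zs) \<in> (SIGMA zs:?L. ?R zs) \<rightarrow> ?D"
    proof (rule Pi_I)
      fix x assume "x \<in> (SIGMA zs:?L. ?R zs)"
      then obtain zs t where x: "x = (zs, t)"
        and z: "length zs = d - 1" "nodes t + sum_list (map nodes zs) = k" "k \<le> d * nodes t"
        by (cases x) auto
      have "sum_list (map nodes (take a zs @ t # drop a zs)) = nodes t + (sum_list (map nodes (take a zs)) + sum_list (map nodes (drop a zs)))"
        by simp
      then have "sum_list (map nodes (take a zs @ t # drop a zs)) = k" using z(2) by (simp only: sum_take)
      moreover have "length (take a zs @ t # drop a zs) = d" using z(1) a by simp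
      moreover have "(take a zs @ t # drop a zs) ! a = t" using z(1) a by (simp add: nth_append)
      ultimately show "(case x of (zs, t) \<Rightarrow> take a zs @ t # drop a zs) \<in> ?D"
        using z(3) by (simp only: x case_prod_conv mem_Collect_eq)
    qed
    show "(\<lambda>ts. (take a ts @ drop (Suc a) ts, ts ! a)) \<in> ?D \<rightarrow> (SIGMA zs:?L. ?R zs)"
    proof (rule Pi_I)
      fix ts assume ts: "ts \<in> ?D"
      then have "ts = take a ts @ ts ! a # drop (Suc a) ts" using a by (simp add: id_take_nth_drop)
      then have "sum_list (map nodes ts) = sum_list (map nodes (take a ts @ ts ! a # drop (Suc a) ts))"
        by simp
      then have s: "nodes (ts ! a) + sum_list (map nodes (take a ts @ drop (Suc a) ts)) = k"
        using ts by simp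
      have "nodes t \<le> k" if "t \<in> set (take a ts @ drop (Suc a) ts)" for t
      proof -
        have "nodes t \<le> sum_list (map nodes (take a ts @ drop (Suc a) ts))"
          by (rule member_le_sum_list) (use that in auto)
        then show ?thesis using s by linarith
      qed
      then show "(take a ts @ drop (Suc a) ts, ts ! a) \<in> (SIGMA zs:?L. ?R zs)"
        using ts a s by auto
    qed
  next
    fix x assume "x \<in> (SIGMA zs:?L. ?R zs)"
    then obtain zs t where x: "x = (zs, t)" and z: "length zs = d - 1" by (cases x) auto
    then have "length (take a zs) = a" using a by simp
    then show "(\<lambda>ts. (take a ts @ drop (Suc a) ts, ts ! a)) (case x of (zs, t) \<Rightarrow> take a zs @ t # drop a zs) = x"
      by (simp add: x nth_append)
  next
    fix ts assume "ts \<in> ?D"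
    then have "a < length ts" using a by simp
    from id_take_nth_drop[OF this] this
    show "(case (take a ts @ drop (Suc a) ts, ts ! a) of (zs, t) \<Rightarrow> take a zs @ t # drop a zs) = ts"
      by simp
  qed
  have "(\<integral>\<^sup>+ts. ?P ts * ennreal (sqrt_e2 (take a ts @ drop (Suc a) ts)) \<partial>count_space ?D) =
    (\<integral>\<^sup>+(zs, t). ?P (take a zs @ t # drop a zs) * ennreal (sqrt_e2 (take a (take a zs @ t # drop a zs) @ drop (Suc a) (take a zs @ t # drop a zs)))
       \<partial>count_space (SIGMA zs:?L. ?R zs))"
    using nn_integral_bij_count_space[OF bij, of "\<lambda>ts. ?P ts * ennreal (sqrt_e2 (take a ts @ drop (Suc a) ts))"]
    by (simp only: case_prod_unfold)
  also have "\<dots> = (\<integral>\<^sup>+zs. (\<integral>\<^sup>+t. (?P zs * ennreal (sqrt_e2 zs)) * tree_weight p t \<partial>count_space (?R zs)) \<partial>count_space ?L)"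
    unfolding nn_integral_count_space_Sigma
  proof (intro nn_integral_cong)
    fix zs t assume "zs \<in> space (count_space ?L)"
    then have "length (take a zs) = a" using a by simp
    moreover have "?P (take a zs @ t # drop a zs) = ?P zs * tree_weight p t"
      using prod_take[of zs] by (simp add: mult.left_commute mult.commute)
    ultimately show "(case (zs, t) of (zs, t) \<Rightarrow> ?P (take a zs @ t # drop a zs) *
        ennreal (sqrt_e2 (take a (take a zs @ t # drop a zs) @ drop (Suc a) (take a zs @ t # drop a zs)))) =
       ?P zs * ennreal (sqrt_e2 zs) * tree_weight p t"
      by (simp add: mult_ac)
  qed
  also have "\<dots> \<le> (\<integral>\<^sup>+zs. (?P zs * ennreal (sqrt_e2 zs)) * Q \<partial>count_space ?L)"
  proof (rule nn_integral_mono)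
    fix zs
    have "(\<integral>\<^sup>+t. tree_weight p t \<partial>count_space (?R zs)) \<le> Q"
    proof (cases "?R zs = {}")
      case True
      show ?thesis unfolding True by (simp add: nn_integral_count_space_finite)
    next
      case False
      define m where "m = k - sum_list (map nodes zs)"
      obtain t where t: "nodes t = m" "k \<le> d * nodes t" using False by (auto simp: m_def)
      have "(\<integral>\<^sup>+t. tree_weight p t \<partial>count_space (?R zs)) \<le> size_mass p m"
        unfolding size_mass_def by (rule nn_integral_count_space_subset) (auto simp: m_def)
      also have "\<dots> \<le> Q" using Q[of m] t nodes_pos[of t] by simp
      finally show ?thesis .
    qed
    then show "(\<integral>\<^sup>+t. (?P zs * ennreal (sqrt_e2 zs)) * tree_weight p t \<partial>count_space (?R zs)) \<le> ?P zs * ennreal (sqrt_e2 zs) * Q"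
      by (simp add: nn_integral_cmult mult_left_mono)
  qed
  also have "\<dots> = Q * (\<integral>\<^sup>+zs. ?P zs * ennreal (sqrt_e2 zs) \<partial>count_space ?L)"
    by (subst nn_integral_multc) (auto simp: mult.commute)
  also have "\<dots> \<le> Q * (of_nat (d - 1) * sqrt_mean)\<^sup>2"
    by (intro mult_left_mono forest_sqrt_e2) simp
  also have "\<dots> \<le> Q * (of_nat d * sqrt_mean)\<^sup>2"
    by (intro mult_left_mono power_mono mult_right_mono) auto
  finally show ?thesis .
qed

lemma forest_light:
  assumes "\<And>m. k \<le> d * m \<Longrightarrow> m > 0 \<Longrightarrow> size_mass p m \<le> Q"
  shows "(\<integral>\<^sup>+ts. prod_list (map (tree_weight p) ts) * ennreal (light_bound (Node ts))
      \<partial>count_space {ts. length ts = d \<and> sum_list (map nodes ts) = k})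
    \<le> of_nat d * (Q * (of_nat d * sqrt_mean)\<^sup>2)"
proof -
  let ?P = "\<lambda>ts. prod_list (map (tree_weight p) ts)"
  let ?F = "{ts. length ts = d \<and> sum_list (map nodes ts) = k}"
  let ?D = "\<lambda>a. {ts. k \<le> d * nodes (ts ! a)}"
  have "(\<integral>\<^sup>+ts. ?P ts * ennreal (light_bound (Node ts)) \<partial>count_space ?F) =
     (\<integral>\<^sup>+ts. (\<Sum>a<d. ?P ts * ennreal (sqrt_e2 (take a ts @ drop (Suc a) ts)) * indicator (?D a) ts) \<partial>count_space ?F)"
  proof (rule nn_integral_cong)
    fix ts assume "ts \<in> space (count_space ?F)"
    then have ts: "length ts = d" "sum_list (map nodes ts) = k" by auto
    have "ennreal (light_bound (Node ts)) =
        (\<Sum>a | a < d \<and> k \<le> d * nodes (ts ! a). ennreal (sqrt_e2 (take a ts @ drop (Suc a) ts)))"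
      by (simp add: ts sum_ennreal)
    also have "\<dots> = (\<Sum>a<d. ennreal (sqrt_e2 (take a ts @ drop (Suc a) ts)) * indicator (?D a) ts)"
      by (rule sum.mono_neutral_cong_left) auto
    finally show "?P ts * ennreal (light_bound (Node ts)) =
       (\<Sum>a<d. ?P ts * ennreal (sqrt_e2 (take a ts @ drop (Suc a) ts)) * indicator (?D a) ts)"
      by (simp only: sum_distrib_left mult.assoc)
  qed
  also have "\<dots> = (\<Sum>a<d. \<integral>\<^sup>+ts. ?P ts * ennreal (sqrt_e2 (take a ts @ drop (Suc a) ts)) * indicator (?D a) ts \<partial>count_space ?F)"
    by (rule nn_integral_sum) simp
  also have "\<dots> = (\<Sum>a<d. \<integral>\<^sup>+ts. ?P ts * ennreal (sqrt_e2 (take a ts @ drop (Suc a) ts)) \<partial>count_space (?F \<inter> ?D a))"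
    by (simp only: nn_integral_count_space_restrict)
  also have "\<dots> \<le> (\<Sum>a<d. Q * (of_nat d * sqrt_mean)\<^sup>2)"
  proof (rule sum_mono)
    fix a assume "a \<in> {..<d}"
    moreover have "?F \<inter> ?D a = {ts. length ts = d \<and> sum_list (map nodes ts) = k \<and> k \<le> d * nodes (ts ! a)}" by auto
    ultimately show "(\<integral>\<^sup>+ts. ?P ts * ennreal (sqrt_e2 (take a ts @ drop (Suc a) ts)) \<partial>count_space (?F \<inter> ?D a))
       \<le> Q * (of_nat d * sqrt_mean)\<^sup>2"
      using forest_light_index[OF _ assms, of a d] by simp
  qed
  finally show ?thesis by simp
qed

end

section \<open>Power bounds for tree sizes and for the light subtrees\<close>

context critical_offspring
begin

lemma size_mass_eq:
  assumes "n > 0"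
  shows "size_mass p n = ennreal (pmf (walk p n) (n - 1) / n)"
proof -
  have "ennreal (1 / real n) * of_nat n = 1"
    using assms by (simp add: ennreal_of_nat_eq_real_of_nat ennreal_mult[symmetric])
  then have "size_mass p n = ennreal (1 / real n) * (of_nat n * size_mass p n)"
    by (metis mult.assoc mult_1)
  also have "\<dots> = ennreal (pmf (walk p n) (n - 1) / n)"
    by (simp add: size_mass_walk[OF assms] ennreal_mult[symmetric])
  finally show ?thesis .
qed

lemma size_mass_upper: "\<exists>C>0. \<forall>n>0. size_mass p n \<le> ennreal (C * real n powr (- (3/2)))"
proof -
  obtain C where C: "\<And>n j. pmf (walk p n) j \<le> C / sqrt (real n + 1)" using walk_upper by blast
  have "size_mass p n \<le> ennreal ((\<bar>C\<bar> + 1) * real n powr (- (3/2)))" if n: "n > 0" for n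
  proof -
    have "pmf (walk p n) (n - 1) \<le> C / sqrt (real n + 1)" by (rule C)
    also have "\<dots> \<le> (\<bar>C\<bar> + 1) / sqrt (real n)"
      using n by (intro frac_le) auto
    finally have "pmf (walk p n) (n - 1) / n \<le> (\<bar>C\<bar> + 1) / sqrt (real n) / n"
      using n by (intro divide_right_mono) auto
    also have "\<dots> = (\<bar>C\<bar> + 1) * real n powr (- (3/2))"
    proof -
      have "real n powr (3/2) = real n powr (1 + 1/2)" by simp
      also have "\<dots> = real n * sqrt (real n)" using n by (simp only: powr_add powr_half_sqrt) simp
      finally show ?thesis by (simp add: powr_minus field_simps)
    qed
    finally show ?thesis using size_mass_eq[OF n] by (simp add: ennreal_leI)
  qed
  then show ?thesis by (intro exI[of _ "\<bar>C\<bar> + 1"]) auto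
qed

text \<open>The logarithm is traded for the power 1/8. Its square costs k^(1/4), which turns
  k^(-3/2) into the still summable k^(-5/4). The 9 is 1 + 8, from ln x \<le> 8 * x^(1/8).\<close>

lemma harm_le_powr:
  assumes "k > 0"
  shows "(\<Sum>j=1..k. 1 / real j) \<le> 9 * real k powr (1/8)"
proof -
  have "(\<Sum>j=1..k. 1 / real j) \<le> 1 + ln (real k)"
    using assms
  proof (induction k rule: nat_induct_non_zero)
    case (Suc k)
    have "ln (real k / real (Suc k)) \<le> real k / real (Suc k) - 1"
      using Suc.hyps by (intro ln_le_minus_one) auto
    also have "\<dots> = - (1 / real (Suc k))" by (simp add: field_simps)
    finally have "1 / real (Suc k) \<le> ln (real (Suc k)) - ln (real k)"
      using Suc.hyps by (simp add: ln_div)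
    then show ?case using Suc.IH by simp
  qed simp
  moreover have "ln (real k) \<le> 8 * real k powr (1/8)"
    using assms ln_powr_bound[of "real k" "1/8"] by simp
  moreover have "1 \<le> real k powr (1/8)" using assms by (simp add: ge_one_powr_ge_zero)
  ultimately show ?thesis by linarith
qed

lemma sqrt_mean_upper: "\<exists>C>0. \<forall>k>0. sqrt_mean p k \<le> ennreal (C * real k powr (1/8))"
proof -
  obtain C where C: "C > 0" "\<And>n. n > 0 \<Longrightarrow> size_mass p n \<le> ennreal (C * real n powr (- (3/2)))"
    using size_mass_upper by blast
  have "sqrt_mean p k \<le> ennreal (C * 9 * real k powr (1/8))" if k: "k > 0" for k
  proof -
    have "sqrt_mean p k = (\<integral>\<^sup>+t. tree_weight p t * ennreal (sqrt (nodes t)) \<partial>count_space {t. nodes t \<in> {..k}})"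
      by (simp add: sqrt_mean_def)
    also have "\<dots> = (\<Sum>j\<le>k. \<integral>\<^sup>+t. tree_weight p t * ennreal (sqrt (nodes t)) \<partial>count_space {t. nodes t = j})"
      unfolding nn_integral_by_nodes by (simp add: nn_integral_count_space_finite)
    also have "\<dots> = (\<Sum>j\<le>k. size_mass p j * ennreal (sqrt j))"
    proof (rule sum.cong)
      fix j
      have "(\<integral>\<^sup>+t. tree_weight p t * ennreal (sqrt (nodes t)) \<partial>count_space {t. nodes t = j}) =
          (\<integral>\<^sup>+t. tree_weight p t * ennreal (sqrt j) \<partial>count_space {t. nodes t = j})"
        by (intro nn_integral_cong) simp
      then show "(\<integral>\<^sup>+t. tree_weight p t * ennreal (sqrt (nodes t)) \<partial>count_space {t. nodes t = j}) = size_mass p j * ennreal (sqrt j)"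
        by (simp add: nn_integral_multc size_mass_def)
    qed simp
    also have "\<dots> = (\<Sum>j=1..k. size_mass p j * ennreal (sqrt j))"
      by (rule sum.mono_neutral_right) (auto simp: not_less_eq_eq)
    also have "\<dots> \<le> (\<Sum>j=1..k. ennreal (C * (1 / real j)))"
    proof (rule sum_mono)
      fix j assume "j \<in> {1..k}"
      then have j: "j > 0" by simp
      have "size_mass p j * ennreal (sqrt j) \<le> ennreal (C * real j powr (- (3/2))) * ennreal (sqrt j)"
        using C(2)[OF j] by (rule mult_right_mono) simp
      also have "\<dots> = ennreal (C * (real j powr (- (3/2)) * real j powr (1/2)))"
        using C(1) by (simp add: ennreal_mult[symmetric] powr_half_sqrt mult.assoc)
      also have "real j powr (- (3/2)) * real j powr (1/2) = 1 / real j"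
      proof -
        have "real j powr (- (3/2)) * real j powr (1/2) = real j powr (- (3/2) + 1/2)"
          by (rule powr_add[symmetric])
        also have "- (3/2) + 1/2 = (- 1 :: real)" by simp
        finally show ?thesis using j by (simp add: powr_minus_divide)
      qed
      finally show "size_mass p j * ennreal (sqrt j) \<le> ennreal (C * (1 / real j))" .
    qed
    also have "\<dots> = ennreal (C * (\<Sum>j=1..k. 1 / real j))"
      using C(1) by (simp add: sum_ennreal sum_distrib_left)
    also have "\<dots> \<le> ennreal (C * (9 * real k powr (1/8)))"
      using C(1) harm_le_powr[OF k] by (intro ennreal_leI mult_left_mono) auto
    finally show ?thesis by (simp add: mult.assoc)
  qed
  then show ?thesis using C(1) by (intro exI[of _ "C * 9"]) auto
qed

lemma nn_integral_offspring_5: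
  "(\<integral>\<^sup>+d. ennreal (pmf p d) * ennreal (real d ^ 5) \<partial>count_space UNIV) = ennreal (measure_pmf.expectation p (\<lambda>i. real i ^ 5))"
  using nn_integral_eq_integral[OF integrable_offspring_5] nn_integral_measure_pmf[of p "\<lambda>d. ennreal (real d ^ 5)"]
  by simp

text \<open>In \<open>k\<close> the bound is k^(-3/2), for the large child, times the square of
  k^(1/8), for the pair of other children. In the degree it is d * d^2 * d^(3/2), at most d^5, and
  the fifth moment makes the sum over \<open>d\<close> converge.\<close>

lemma light_mean_upper:
  "\<exists>C>0. \<forall>n>0. (\<integral>\<^sup>+t. tree_weight p t * ennreal (light_bound t) \<partial>count_space {t. nodes t = n}) \<le>
     ennreal (C * real n powr (- (5/4)))"
proof -
  obtain C1 where C1: "C1 > 0" "\<And>n. n > 0 \<Longrightarrow> size_mass p n \<le> ennreal (C1 * real n powr (- (3/2)))"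
    using size_mass_upper by blast
  obtain C2 where C2: "C2 > 0" "\<And>k. k > 0 \<Longrightarrow> sqrt_mean p k \<le> ennreal (C2 * real k powr (1/8))"
    using sqrt_mean_upper by blast
  define M5 where "M5 = measure_pmf.expectation p (\<lambda>i. real i ^ 5)"
  have M5: "M5 \<ge> 0" unfolding M5_def by (rule integral_nonneg_AE) auto
  define C where "C = M5 * C1 * C2\<^sup>2"
  have C: "C \<ge> 0" using M5 C1 by (simp add: C_def)
  have main: "(\<integral>\<^sup>+t. tree_weight p t * ennreal (light_bound t) \<partial>count_space {t. nodes t = Suc k}) \<le>
     ennreal (C * real k powr (- (5/4)))" if k: "k > 0" for k
  proof -
    let ?P = "\<lambda>ts. prod_list (map (tree_weight p) ts)"
    let ?F = "\<lambda>d. {ts. length ts = d \<and> sum_list (map nodes ts) = k}"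
    have "bij_betw (\<lambda>(d, ts). Node ts) (SIGMA d:UNIV. ?F d) {t. nodes t = Suc k}"
    proof (rule bij_betwI[where g = "case_otree (\<lambda>ts. (length ts, ts))"])
      show "case_otree (\<lambda>ts. (length ts, ts)) \<in> {t. nodes t = Suc k} \<rightarrow> (SIGMA d:UNIV. ?F d)"
      proof
        fix t assume "t \<in> {t. nodes t = Suc k}"
        then show "case_otree (\<lambda>ts. (length ts, ts)) t \<in> (SIGMA d:UNIV. ?F d)"
          by (cases t) (simp add: nodes_Node del: code.simps)
      qed
    qed (auto simp: nodes_Node simp del: code.simps split: otree.splits)
    from nn_integral_bij_count_space[OF this, of "\<lambda>t. tree_weight p t * ennreal (light_bound t)"]
    have "(\<integral>\<^sup>+t. tree_weight p t * ennreal (light_bound t) \<partial>count_space {t. nodes t = Suc k}) =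
        (\<integral>\<^sup>+d. (\<integral>\<^sup>+ts. tree_weight p (Node ts) * ennreal (light_bound (Node ts)) \<partial>count_space (?F d)) \<partial>count_space UNIV)"
      by (simp only: case_prod_unfold nn_integral_count_space_Sigma fst_conv snd_conv)
    also have "\<dots> = (\<integral>\<^sup>+d. ennreal (pmf p d) * (\<integral>\<^sup>+ts. ?P ts * ennreal (light_bound (Node ts)) \<partial>count_space (?F d)) \<partial>count_space UNIV)"
    proof (rule nn_integral_cong)
      fix d
      have "(\<integral>\<^sup>+ts. tree_weight p (Node ts) * ennreal (light_bound (Node ts)) \<partial>count_space (?F d)) =
          (\<integral>\<^sup>+ts. ennreal (pmf p d) * (?P ts * ennreal (light_bound (Node ts))) \<partial>count_space (?F d))"
        by (intro nn_integral_cong) (simp add: tree_weight_Node mult.assoc del: code.simps light_bound.simps)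
      then show "(\<integral>\<^sup>+ts. tree_weight p (Node ts) * ennreal (light_bound (Node ts)) \<partial>count_space (?F d)) =
         ennreal (pmf p d) * (\<integral>\<^sup>+ts. ?P ts * ennreal (light_bound (Node ts)) \<partial>count_space (?F d))"
        by (simp add: nn_integral_cmult del: light_bound.simps)
    qed
    also have "\<dots> \<le> (\<integral>\<^sup>+d. ennreal (pmf p d) * (ennreal (real d ^ 5) * ennreal (C1 * C2\<^sup>2 * real k powr (- (5/4)))) \<partial>count_space UNIV)"
    proof (intro nn_integral_mono mult_left_mono)
      fix d
      show "(\<integral>\<^sup>+ts. ?P ts * ennreal (light_bound (Node ts)) \<partial>count_space (?F d)) \<le>
          ennreal (real d ^ 5) * ennreal (C1 * C2\<^sup>2 * real k powr (- (5/4)))"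
      proof (cases "d = 0")
        case True
        then have e: "?F d = {}" using k by auto
        show ?thesis unfolding e by (simp add: nn_integral_count_space_finite)
      next
        case False
        \<comment> \<open>A child of at least average size has at least k / d nodes, and the bound
          of \<open>size_mass_upper\<close> decreases in the size.\<close>
        define Q where "Q = C1 * (real k / real d) powr (- (3/2))"
        have Q: "Q \<ge> 0" using C1 by (simp add: Q_def)
        have "size_mass p m \<le> ennreal Q" if "k \<le> d * m" "m > 0" for m
        proof -
          have "real k / real d \<le> real m"
            using that(1) False by (simp add: divide_le_eq mult.commute flip: of_nat_mult)
          then have "C1 * real m powr (- (3/2)) \<le> Q"
            unfolding Q_def using C1(1) False k by (intro mult_left_mono powr_mono2') auto
          then show ?thesis using C1(2)[OF that(2)] by (meson ennreal_leI order_trans)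
        qed
        from forest_light[of k d p "ennreal Q", OF this]
        have "(\<integral>\<^sup>+ts. ?P ts * ennreal (light_bound (Node ts)) \<partial>count_space (?F d)) \<le>
            of_nat d * (ennreal Q * (of_nat d * sqrt_mean p k)\<^sup>2)" by simp
        also have "\<dots> \<le> of_nat d * (ennreal Q * (of_nat d * ennreal (C2 * real k powr (1/8)))\<^sup>2)"
          by (intro mult_left_mono power_mono C2(2) k) auto
        also have "\<dots> = ennreal (real d * (Q * (real d * (C2 * real k powr (1/8)))\<^sup>2))"
          using Q C2(1) by (simp add: ennreal_mult ennreal_of_nat_eq_real_of_nat ennreal_power[symmetric])
        also have "real d * (Q * (real d * (C2 * real k powr (1/8)))\<^sup>2) \<le> real d ^ 5 * (C1 * C2\<^sup>2 * real k powr (- (5/4)))"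
        proof -
          have q: "Q = C1 * (real k powr (- (3/2)) * real d powr (3/2))"
            using False k by (simp add: Q_def powr_divide powr_minus divide_simps)
          have kk: "real k powr (- (3/2)) * (real k powr (1/8))\<^sup>2 = real k powr (- (5/4))"
            using k by (simp add: power2_eq_square powr_add[symmetric])
          have "real d * (Q * (real d * (C2 * real k powr (1/8)))\<^sup>2) =
              (real d powr (3/2) * real d ^ 3) * (C1 * C2\<^sup>2 * (real k powr (- (3/2)) * (real k powr (1/8))\<^sup>2))"
            by (simp add: q power_mult_distrib power2_eq_square power3_eq_cube mult_ac)
          also have "\<dots> \<le> real d ^ 5 * (C1 * C2\<^sup>2 * (real k powr (- (3/2)) * (real k powr (1/8))\<^sup>2))"
          proof (rule mult_right_mono)
            have "real d powr (3/2) \<le> real d powr 2" using False by (intro powr_mono) auto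
            also have "\<dots> = real d ^ 2" using False by (simp add: powr_numeral)
            finally have "real d powr (3/2) * real d ^ 3 \<le> real d ^ 2 * real d ^ 3" by (rule mult_right_mono) simp
            then show "real d powr (3/2) * real d ^ 3 \<le> real d ^ 5" by (simp add: power_add[symmetric])
          qed (use C1 in simp)
          finally show ?thesis by (simp only: kk)
        qed
        finally have "(\<integral>\<^sup>+ts. ?P ts * ennreal (light_bound (Node ts)) \<partial>count_space (?F d)) \<le>
            ennreal (real d ^ 5 * (C1 * C2\<^sup>2 * real k powr (- (5/4))))"
          by (simp add: ennreal_leI del: light_bound.simps)
        then show ?thesis using C1 by (simp add: ennreal_mult del: light_bound.simps)
      qed
    qed simp
    also have "\<dots> = ennreal M5 * ennreal (C1 * C2\<^sup>2 * real k powr (- (5/4)))"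
      unfolding M5_def nn_integral_offspring_5[symmetric]
      by (simp add: mult.assoc[symmetric] nn_integral_multc)
    also have "\<dots> = ennreal (C * real k powr (- (5/4)))"
      using M5 C1 by (simp add: C_def ennreal_mult[symmetric] mult_ac)
    finally show ?thesis .
  qed
  have "(\<integral>\<^sup>+t. tree_weight p t * ennreal (light_bound t) \<partial>count_space {t. nodes t = n}) \<le>
      ennreal ((4 * C + 1) * real n powr (- (5/4)))" if n: "n > 0" for n
  proof (cases "n = 1")
    case True
    have "light_bound t = 0" if "nodes t = 1" for t
      using that by (cases t) (auto simp: nodes_Node simp del: code.simps)
    then have "(\<integral>\<^sup>+t. tree_weight p t * ennreal (light_bound t) \<partial>count_space {t. nodes t = n}) =
      (\<integral>\<^sup>+t. 0 \<partial>count_space {t. nodes t = n})"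
      using True by (intro nn_integral_cong) simp
    then show ?thesis by simp
  next
    case False
    then obtain k where k: "n = Suc k" "k > 0" using n by (cases n) auto
    \<comment> \<open>The children have k = n - 1 nodes in total, at least n / 2 when n exceeds 1.
      Returning from \<open>k\<close> to \<open>n\<close> thus costs 2^(5/4), at most 4.\<close>
    have "real k powr (- (5/4)) \<le> (real n / 2) powr (- (5/4))"
      using k by (intro powr_mono2') auto
    also have "\<dots> = 2 powr (5/4) * real n powr (- (5/4))"
      using n by (simp add: powr_divide powr_minus divide_simps)
    also have "(2::real) powr (5/4) \<le> 2 powr 2" by (intro powr_mono) auto
    finally have "real k powr (- (5/4)) \<le> 4 * real n powr (- (5/4))"
      by (simp add: mult_right_mono powr_numeral)
    then have "C * real k powr (- (5/4)) \<le> C * (4 * real n powr (- (5/4)))"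
      using C by (rule mult_left_mono)
    also have "\<dots> \<le> (4 * C + 1) * real n powr (- (5/4))" by (simp add: distrib_right)
    finally show ?thesis using main[OF k(2)] unfolding k(1)[symmetric] by (meson ennreal_leI order_trans)
  qed
  then show ?thesis using C by (intro exI[of _ "4 * C + 1"]) auto
qed

end

section \<open>Galton--Watson trees as random ordered trees\<close>

primrec children :: "otree \<Rightarrow> otree list" where
  "children (Node ts) = ts"

abbreviation outdeg :: "otree \<Rightarrow> nat" where
  "outdeg t \<equiv> length (children t)"

primrec positions :: "otree \<Rightarrow> tree" where
  "positions (Node ts) = insert [] (\<Union>i<length ts. (#) i ` (map positions ts ! i))"

text \<open>Meaningful for words in \<open>positions t\<close>; elsewhere the list access is
  unspecified.\<close>

primrec subtree_at :: "otree \<Rightarrow> nat list \<Rightarrow> otree" where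
  "subtree_at t [] = t"
| "subtree_at t (i # v) = subtree_at (children t ! i) v"

lemma Nil_in_positions [simp]: "[] \<in> positions t"
  by (cases t) simp

lemma Cons_in_positions [simp]:
  "i # v \<in> positions t \<longleftrightarrow> i < outdeg t \<and> v \<in> positions (children t ! i)"
  by (cases t) (auto simp: image_iff)

lemma positions_eq: "positions t = insert [] (\<Union>i<outdeg t. (#) i ` positions (children t ! i))"
  (is "_ = ?R")
proof (rule set_eqI)
  show "v \<in> positions t \<longleftrightarrow> v \<in> ?R" for v by (cases v) auto
qed

declare positions.simps [simp del]

lemma finite_positions [simp]: "finite (positions t)"
proof (induction t)
  case (Node ts)
  then show ?case by (subst positions_eq) auto
qed

lemma sum_positions:
  "(\<Sum>v\<in>positions t. f v) = f [] + (\<Sum>i<outdeg t. \<Sum>v\<in>positions (children t ! i). f (i # v))"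
proof -
  have "sum f (\<Union>i<outdeg t. (#) i ` positions (children t ! i)) = (\<Sum>i<outdeg t. \<Sum>v\<in>positions (children t ! i). f (i # v))"
    by (subst sum.UNION_disjoint) (auto simp: sum.reindex)
  then show ?thesis by (subst positions_eq) (simp add: image_iff)
qed

lemma prod_positions:
  "(\<Prod>v\<in>positions t. f v) = f [] * (\<Prod>i<outdeg t. \<Prod>v\<in>positions (children t ! i). f (i # v))"
proof -
  have "prod f (\<Union>i<outdeg t. (#) i ` positions (children t ! i)) = (\<Prod>i<outdeg t. \<Prod>v\<in>positions (children t ! i). f (i # v))"
    by (subst prod.UNION_disjoint) (auto simp: prod.reindex)
  then show ?thesis by (subst positions_eq) (simp add: image_iff)
qed

lemma fringe_sum_eq_sum: "fringe_sum f t = (\<Sum>v\<in>positions t. f (subtree_at t v))"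
proof (induction t)
  case (Node ts)
  have "sum_list (map (fringe_sum f) ts) = (\<Sum>i<length ts. fringe_sum f (ts ! i))"
    by (simp add: sum_list_sum_nth atLeast0LessThan)
  also have "\<dots> = (\<Sum>i<length ts. \<Sum>v\<in>positions (ts ! i). f (subtree_at (ts ! i) v))"
    by (intro sum.cong Node) auto
  finally show ?case by (subst sum_positions) simp
qed

lemma card_positions: "card (positions t) = nodes t"
proof -
  have "nodes t = fringe_sum (\<lambda>_. 1) t"
    using fringe_sum_positions[of "\<lambda>_. 1 :: nat" t "[]"] by simp
  then show ?thesis by (simp add: fringe_sum_eq_sum)
qed

lemma subtree_at_append: "subtree_at t (v @ w) = subtree_at (subtree_at t v) w"
  by (induction v arbitrary: t) auto

lemma append_in_positions:
  "v @ w \<in> positions t \<longleftrightarrow> v \<in> positions t \<and> w \<in> positions (subtree_at t v)"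
  by (induction v arbitrary: t) auto

lemma snoc_in_positions:
  "v @ [i] \<in> positions t \<longleftrightarrow> v \<in> positions t \<and> i < outdeg (subtree_at t v)"
  by (simp add: append_in_positions)

lemma subtree_positions:
  assumes "v \<in> positions t"
  shows "subtree (positions t) v = (@) v ` positions (subtree_at t v)"
  using assms by (auto simp: subtree_def prefix_def append_in_positions)

lemma card_subtree_positions:
  assumes "v \<in> positions t"
  shows "card (subtree (positions t) v) = nodes (subtree_at t v)"
  by (simp add: subtree_positions[OF assms] card_image inj_on_def card_positions)

lemma positions_inject: "positions t = positions u \<Longrightarrow> t = u"
proof (induction t arbitrary: u)
  case (Node ts)
  have iff: "i # v \<in> positions (Node ts) \<longleftrightarrow> i # v \<in> positions u" for i v using Node.prems by simp
  have "i < length ts \<longleftrightarrow> i < outdeg u" for i using iff[of i "[]"] by simp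
  then have len: "length ts = outdeg u" by (metis linorder_neqE_nat less_irrefl)
  have "ts ! i = children u ! i" if "i < length ts" for i
  proof (rule Node.IH)
    show "positions (ts ! i) = positions (children u ! i)"
      using iff[of i] that len by auto
  qed (use that in simp)
  then have "ts = children u" using len by (intro nth_equalityI) auto
  then show ?case by (cases u) simp
qed

lemma tree_weight_positions:
  "tree_weight p t = (\<Prod>v\<in>positions t. ennreal (pmf p (outdeg (subtree_at t v))))"
proof (induction t)
  case (Node ts)
  have "prod_list (map (tree_weight p) ts) = (\<Prod>i<length ts. tree_weight p (ts ! i))"
    by (simp add: prod.list_conv_set_nth atLeast0LessThan)
  also have "\<dots> = (\<Prod>i<length ts. \<Prod>v\<in>positions (ts ! i). ennreal (pmf p (outdeg (subtree_at (ts ! i) v))))"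
    by (intro prod.cong Node) auto
  finally show ?case by (subst prod_positions) (simp add: tree_weight_Node del: code.simps)
qed

text \<open>The inductive definition lengthens words at their end, while recursion on ordered trees
  starts at the root. This decomposition at the root connects the two.\<close>

lemma gw_tree_Cons: "i # v \<in> gw_tree X \<longleftrightarrow> i < X [] \<and> v \<in> gw_tree (\<lambda>w. X (i # w))"
proof
  have "v = i # w \<Longrightarrow> i < X [] \<and> w \<in> gw_tree (\<lambda>w. X (i # w))" if "v \<in> gw_tree X" for v w
    using that
  proof (induction arbitrary: w)
    case (child v j)
    show ?case
    proof (cases v)
      case Nil
      then show ?thesis using child by (auto intro: gw_tree.root)
    next
      case (Cons k u)
      then have "k = i" "w = u @ [j]" using child.prems by auto
      then show ?thesis using child.IH[of u] child.hyps Cons by (auto intro: gw_tree.child)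
    qed
  qed simp
  then show "i # v \<in> gw_tree X \<Longrightarrow> i < X [] \<and> v \<in> gw_tree (\<lambda>w. X (i # w))" by blast
next
  assume a: "i < X [] \<and> v \<in> gw_tree (\<lambda>w. X (i # w))"
  then have "v \<in> gw_tree (\<lambda>w. X (i # w))" by simp
  then show "i # v \<in> gw_tree X"
  proof induction
    case root
    show ?case using gw_tree.child[OF gw_tree.root, of i X] a by simp
  next
    case (child v j)
    then show ?case using gw_tree.child[of "i # v" X j] by simp
  qed
qed

text \<open>It expresses the event of seeing a given finite tree by the coordinates at its nodes
  alone, which makes it a cylinder of the product measure.\<close>

lemma gw_tree_eq_positions:
  "gw_tree X = positions t \<longleftrightarrow> (\<forall>v\<in>positions t. X v = outdeg (subtree_at t v))"
proof
  assume eq: "gw_tree X = positions t"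
  show "\<forall>v\<in>positions t. X v = outdeg (subtree_at t v)"
  proof
    fix v assume v: "v \<in> positions t"
    have "i < X v \<longleftrightarrow> i < outdeg (subtree_at t v)" for i
    proof -
      have "i < X v \<longleftrightarrow> v @ [i] \<in> gw_tree X"
        using v eq by (auto intro: gw_tree.child elim: gw_tree.cases)
      then show ?thesis using v eq by (simp add: snoc_in_positions)
    qed
    then show "X v = outdeg (subtree_at t v)" by (metis linorder_neqE_nat less_irrefl)
  qed
next
  assume X: "\<forall>v\<in>positions t. X v = outdeg (subtree_at t v)"
  have "v \<in> positions t" if "v \<in> gw_tree X" for v
    using that by induction (use X in \<open>auto simp: snoc_in_positions\<close>)
  moreover have "v \<in> positions t \<Longrightarrow> v \<in> gw_tree X" for v
    by (induction v rule: rev_induct) (use X in \<open>auto simp: snoc_in_positions intro: gw_tree.intros\<close>)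
  ultimately show "gw_tree X = positions t" by blast
qed

text \<open>Each branch is strictly smaller than the tree, since its shifted copy misses the root;
  hence the induction on the cardinality.\<close>

lemma finite_gw_tree_positions: "finite (gw_tree X) \<Longrightarrow> \<exists>t. gw_tree X = positions t"
proof (induction "card (gw_tree X)" arbitrary: X rule: less_induct)
  case less
  let ?Y = "\<lambda>i w. X (i # w)"
  have sub: "(#) i ` gw_tree (?Y i) \<subset> gw_tree X" if "i < X []" for i
    using that gw_tree.root[of X] by (auto simp: gw_tree_Cons)
  have "\<exists>t. gw_tree (?Y i) = positions t" if "i < X []" for i
  proof (rule less.hyps)
    have "card ((#) i ` gw_tree (?Y i)) < card (gw_tree X)"
      using sub[OF that] less.prems by (rule psubset_card_mono[rotated])
    then show "card (gw_tree (?Y i)) < card (gw_tree X)" by (simp add: card_image)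
    show "finite (gw_tree (?Y i))"
      using finite_subset[OF psubset_imp_subset[OF sub[OF that]] less.prems] by (simp add: finite_image_iff)
  qed
  then obtain c where c: "\<And>i. i < X [] \<Longrightarrow> gw_tree (?Y i) = positions (c i)" by metis
  have "v \<in> gw_tree X \<longleftrightarrow> v \<in> positions (Node (map c [0..<X []]))" for v
    by (cases v) (auto simp: gw_tree.root gw_tree_Cons c)
  then show ?case by blast
qed

lemma gw_tree_event:
  "{X. gw_tree X = positions t} =
     prod_emb UNIV (\<lambda>_. measure_pmf p) (positions t) (Pi\<^sub>E (positions t) (\<lambda>v. {outdeg (subtree_at t v)}))"
  by (auto simp: gw_tree_eq_positions prod_emb_def PiE_iff extensional_def)

lemma emeasure_gw_tree:
  "{X. gw_tree X = positions t} \<in> sets (offspring_space p)" (is ?A)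
  "emeasure (offspring_space p) {X. gw_tree X = positions t} = tree_weight p t" (is ?B)
proof -
  interpret product_prob_space "\<lambda>_ :: nat list. measure_pmf p" UNIV
    by unfold_locales
  show ?A unfolding gw_tree_event[of t p] offspring_space_def
    by (rule sets_PiM_I) auto
  show ?B unfolding gw_tree_event[of t p] offspring_space_def
    by (subst emeasure_PiM_emb) (auto simp: tree_weight_positions emeasure_pmf_single)
qed

text \<open>There are countably many ordered trees, so the event is a countable disjoint union of
  cylinders for every predicate \<open>Q\<close>.\<close>

lemma emeasure_gw_size:
  "emeasure (offspring_space p) {X. Q (gw_tree X) \<and> has_size n (gw_tree X)} =
    (\<integral>\<^sup>+t. tree_weight p t \<partial>count_space {t. nodes t = n \<and> Q (positions t)})"
proof -
  let ?T = "{t. nodes t = n \<and> Q (positions t)}"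
  have "{X. Q (gw_tree X) \<and> has_size n (gw_tree X)} = (\<Union>t\<in>?T. {X. gw_tree X = positions t})"
    using finite_gw_tree_positions by (fastforce simp: has_size_def card_positions)
  moreover have "emeasure (offspring_space p) (\<Union>t\<in>?T. {X. gw_tree X = positions t}) =
      (\<integral>\<^sup>+t. emeasure (offspring_space p) {X. gw_tree X = positions t} \<partial>count_space ?T)"
    by (rule emeasure_UN_countable)
      (auto simp: emeasure_gw_tree disjoint_family_on_def dest: positions_inject)
  ultimately show ?thesis by (simp add: emeasure_gw_tree)
qed

lemma space_offspring_space [simp]: "space (offspring_space p) = UNIV"
  by (simp add: offspring_space_def space_PiM)

lemma cond_gw_prob_eq:
  "cond_gw_prob p n Q =
    enn2real (\<integral>\<^sup>+t. tree_weight p t \<partial>count_space {t. nodes t = n \<and> Q (positions t)}) / enn2real (size_mass p n)"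
  using emeasure_gw_size[of p Q n] emeasure_gw_size[of p "\<lambda>_. True" n]
  by (simp add: cond_gw_prob_def cond_prob_def measure_def size_mass_def)

lemma sizes_iff: "n \<in> sizes p \<longleftrightarrow> n \<ge> 1 \<and> enn2real (size_mass p n) > 0"
  using emeasure_gw_size[of p "\<lambda>_. True" n]
  by (simp add: sizes_def measure_def size_mass_def)

section \<open>The size of the trimmed 2-heavy tree\<close>

text \<open>The order of siblings in terms of their indices, with \<open>s\<close> the subtree
  sizes. Ties follow the index because preorder restricted to siblings is index order.
  \<open>rank_child\<close> identifies \<open>pred_count\<close> with the rank counted from
  0.\<close>

definition earlier :: "(nat \<Rightarrow> nat) \<Rightarrow> nat \<Rightarrow> nat \<Rightarrow> bool" where
  "earlier s j i \<longleftrightarrow> s i < s j \<or> s j = s i \<and> j < i"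

definition pred_count :: "nat \<Rightarrow> (nat \<Rightarrow> nat) \<Rightarrow> nat \<Rightarrow> nat" where
  "pred_count d s i = card {j. j < d \<and> earlier s j i}"

lemma pred_count_less:
  assumes "earlier s j i" "j < d"
  shows "pred_count d s j < pred_count d s i"
  unfolding pred_count_def
proof (rule psubset_card_mono)
  show "{k. k < d \<and> earlier s k j} \<subset> {k. k < d \<and> earlier s k i}"
    using assms by (auto simp: earlier_def)
qed simp

lemma earlier_total: "i \<noteq> j \<Longrightarrow> earlier s i j \<or> earlier s j i"
  by (auto simp: earlier_def)

lemma inj_on_pred_count: "inj_on (pred_count d s) {..<d}"
proof (rule inj_onI)
  fix i j assume "i \<in> {..<d}" "j \<in> {..<d}" "pred_count d s i = pred_count d s j"
  then show "i = j"
    using earlier_total[of i j s] pred_count_less[of s i j d] pred_count_less[of s j i d] by auto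
qed

lemma card_pred_count_less_2: "card {i. i < d \<and> pred_count d s i < 2} \<le> 2"
proof -
  have "card {i. i < d \<and> pred_count d s i < 2} = card (pred_count d s ` {i. i < d \<and> pred_count d s i < 2})"
    by (intro card_image[symmetric] inj_on_subset[OF inj_on_pred_count]) auto
  also have "\<dots> \<le> card {..<2::nat}" by (intro card_mono) auto
  finally show ?thesis by simp
qed

lemma sqrt_le_sqrt_e1: "t \<in> set ts \<Longrightarrow> sqrt (nodes t) \<le> sqrt_e1 ts"
  by (induction ts) (auto intro: add_increasing)

lemma sum_nodes_le_sqrt_e1:
  assumes "\<And>t. t \<in> set ts \<Longrightarrow> nodes t \<le> m"
  shows "real (sum_list (map nodes ts)) \<le> sqrt m * sqrt_e1 ts"
  using assms
proof (induction ts)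
  case (Cons t ts)
  have "real (nodes t) = sqrt (nodes t) * sqrt (nodes t)" by simp
  also have "\<dots> \<le> sqrt m * sqrt (nodes t)"
    using Cons.prems[of t] by (intro mult_right_mono) auto
  finally show ?case using Cons by (simp add: distrib_left)
qed simp

text \<open>Every tree other than a largest one is paired with one at least as big, and its size is
  at most the geometric mean of the pair. If the new tree \<open>t\<close> is not larger than the
  old maximum, it is paired with that; otherwise all old trees are paired with
  \<open>t\<close>.\<close>

lemma sum_nodes_le_sqrt_e2:
  "ts \<noteq> [] \<Longrightarrow> real (sum_list (map nodes ts)) \<le> sqrt_e2 ts + real (Max (nodes ` set ts))"
proof (induction ts)
  case (Cons t ts)
  show ?case
  proof (cases "ts = []")
    case False
    define m where "m = Max (nodes ` set ts)"
    have IH: "real (sum_list (map nodes ts)) \<le> sqrt_e2 ts + real m"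
      using Cons.IH False by (simp add: m_def)
    have le: "nodes u \<le> m" if "u \<in> set ts" for u using that by (simp add: m_def)
    have "m \<in> nodes ` set ts" unfolding m_def by (rule Max_in) (use False in auto)
    then obtain u where u: "u \<in> set ts" "m = nodes u" by auto
    have max: "Max (nodes ` set (t # ts)) = max (nodes t) m" using False by (simp add: m_def)
    show ?thesis
    proof (cases "nodes t \<le> m")
      case True
      have "real (nodes t) = sqrt (nodes t) * sqrt (nodes t)" by simp
      also have "\<dots> \<le> sqrt (nodes t) * sqrt m" using True by (intro mult_left_mono) auto
      also have "\<dots> \<le> sqrt (nodes t) * sqrt_e1 ts"
        using sqrt_le_sqrt_e1[OF u(1)] u(2) by (intro mult_left_mono) auto
      finally show ?thesis using IH True unfolding max by simp
    next
      case False
      have "real (sum_list (map nodes ts)) \<le> sqrt (nodes t) * sqrt_e1 ts"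
        by (rule sum_nodes_le_sqrt_e1) (use False le in fastforce)
      then show ?thesis using False unfolding max by (simp add: add_increasing2)
    qed
  qed simp
qed simp

text \<open>Let \<open>m\<close> and \<open>b\<close> be the first and second child in rank order.
  After \<open>m\<close> is removed the largest size is at most that of \<open>b\<close>, so
  \<open>sqrt_e2\<close> of the rest covers everything of rank at least 3. The index
  \<open>m\<close> occurs in the sum of \<open>light_bound\<close> because a maximum is at least the
  average.\<close>

lemma light_children_le:
  fixes ts :: "otree list"
  defines "s \<equiv> (\<lambda>i. nodes (ts ! i))" and "d \<equiv> length ts"
  shows "real (\<Sum>i | i < d \<and> 2 \<le> pred_count d s i. s i) \<le> light_bound (Node ts)"
proof (cases "d < 2")
  case True
  have "pred_count d s i < 2" for i
  proof -
    have "pred_count d s i \<le> card {..<d}" unfolding pred_count_def by (rule card_mono) auto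
    then show ?thesis using True by simp
  qed
  then have "{i. i < d \<and> 2 \<le> pred_count d s i} = {}" by (auto simp: not_le)
  then show ?thesis using light_bound_nonneg[of "Node ts"] by (simp only:) simp
next
  case False
  have least: "\<exists>m\<in>A. \<forall>j\<in>A. j \<noteq> m \<longrightarrow> earlier s m j" if "A \<noteq> {}" "A \<subseteq> {..<d}" for A
  proof -
    have "finite A" using that(2) by (rule finite_subset) simp
    then have fin: "finite (pred_count d s ` A)" by simp
    then have "Min (pred_count d s ` A) \<in> pred_count d s ` A" using that(1) by (intro Min_in) auto
    then obtain m where "m \<in> A" "pred_count d s m = Min (pred_count d s ` A)" by auto
    then have m: "m \<in> A" "\<And>j. j \<in> A \<Longrightarrow> pred_count d s m \<le> pred_count d s j"
      using fin by auto
    have "earlier s m j" if "j \<in> A" "j \<noteq> m" for j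
    proof -
      have "j < d" using that(1) \<open>A \<subseteq> {..<d}\<close> by auto
      then show ?thesis
        using m(2)[OF that(1)] pred_count_less[of s j m d] earlier_total[OF that(2)] by fastforce
    qed
    then show ?thesis using m(1) by blast
  qed
  obtain m where m: "m < d" "\<And>j. j < d \<Longrightarrow> j \<noteq> m \<Longrightarrow> earlier s m j"
    using least[of "{..<d}"] False by fastforce
  \<comment> \<open>With two or more children, 0 or 1 is an index different from \<open>m\<close>,
    so a second child exists.\<close>
  have "(if m = 0 then 1 else 0) \<in> {..<d} - {m}" using False by auto
  then have "{..<d} - {m} \<noteq> {}" by blast
  then obtain b where b: "b < d" "b \<noteq> m" "\<And>j. j < d \<Longrightarrow> j \<noteq> m \<Longrightarrow> j \<noteq> b \<Longrightarrow> earlier s b j"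
    using least[of "{..<d} - {m}"] by auto
  have "pred_count d s m < 2"
  proof -
    have e: "{j. j < d \<and> earlier s j m} = {}" using m by (fastforce simp: earlier_def)
    show ?thesis unfolding pred_count_def e by simp
  qed
  moreover have "pred_count d s b < 2"
  proof -
    have "{j. j < d \<and> earlier s j b} \<subseteq> {m}" using b by (fastforce simp: earlier_def)
    then have "pred_count d s b \<le> card {m}" unfolding pred_count_def by (rule card_mono[rotated]) simp
    then show ?thesis by simp
  qed
  ultimately have "{i. i < d \<and> 2 \<le> pred_count d s i} \<subseteq> {..<d} - {m} - {b}" by (auto simp: not_le[symmetric])
  then have "(\<Sum>i | i < d \<and> 2 \<le> pred_count d s i. s i) \<le> (\<Sum>i\<in>{..<d} - {m} - {b}. s i)"
    by (intro sum_mono2) auto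
  then have 1: "(\<Sum>i | i < d \<and> 2 \<le> pred_count d s i. s i) + s b \<le> (\<Sum>i\<in>{..<d} - {m}. s i)"
    using b by (simp add: sum.remove[of "{..<d} - {m}" b] del: sum_diff1_nat)
  define zs where "zs = take m ts @ drop (Suc m) ts"
  have tot: "sum_list (map nodes ts) = (\<Sum>i<d. s i)"
    by (simp add: sum_list_sum_nth atLeast0LessThan s_def d_def)
  have "ts = take m ts @ ts ! m # drop (Suc m) ts"
    using m(1) by (intro id_take_nth_drop) (simp add: d_def)
  then have "sum_list (map nodes ts) = sum_list (map nodes (take m ts @ ts ! m # drop (Suc m) ts))"
    by simp
  then have "sum_list (map nodes ts) = s m + sum_list (map nodes zs)"
    by (simp add: zs_def s_def)
  moreover have "(\<Sum>i<d. s i) = s m + (\<Sum>i\<in>{..<d} - {m}. s i)"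
    using m(1) by (simp add: sum.remove)
  ultimately have zs: "sum_list (map nodes zs) = (\<Sum>i\<in>{..<d} - {m}. s i)"
    using tot by simp
  have "length zs = d - 1" using m(1) by (simp add: zs_def d_def)
  then have ne: "zs \<noteq> []" using False by auto
  have "nodes t \<le> s b" if "t \<in> set zs" for t
  proof -
    have "\<exists>j<d. j \<noteq> m \<and> t = ts ! j"
      using that unfolding zs_def d_def set_append
    proof (elim UnE)
      assume "t \<in> set (take m ts)"
      then obtain j where "j < m" "j < length ts" "t = ts ! j" by (auto simp: in_set_conv_nth)
      then show "\<exists>j<length ts. j \<noteq> m \<and> t = ts ! j" by (intro exI[of _ j]) simp
    next
      assume "t \<in> set (drop (Suc m) ts)"
      then obtain j where "j < length ts - Suc m" "t = ts ! (Suc m + j)" by (auto simp: in_set_conv_nth)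
      then show "\<exists>j<length ts. j \<noteq> m \<and> t = ts ! j" by (intro exI[of _ "Suc m + j"]) simp
    qed
    then obtain j where j: "j < d" "j \<noteq> m" "t = ts ! j" by blast
    have "s j \<le> s b" using b(3)[OF j(1,2)] by (cases "j = b") (auto simp: earlier_def)
    then show ?thesis by (simp add: j s_def)
  qed
  then have "Max (nodes ` set zs) \<le> s b" using ne by simp
  then have "real (sum_list (map nodes zs)) \<le> sqrt_e2 zs + real (s b)"
    using sum_nodes_le_sqrt_e2[OF ne] by linarith
  then have "real (\<Sum>i | i < d \<and> 2 \<le> pred_count d s i. s i) \<le> sqrt_e2 zs"
    using 1 zs by linarith
  also have "\<dots> \<le> light_bound (Node ts)"
  proof -
    have "(\<Sum>i<d. s i) \<le> (\<Sum>i<d. s m)"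
    proof (rule sum_mono)
      fix i assume "i \<in> {..<d}"
      then show "s i \<le> s m" using m(2)[of i] by (cases "i = m") (auto simp: earlier_def)
    qed
    then have "sum_list (map nodes ts) \<le> length ts * nodes (ts ! m)"
      by (simp add: tot s_def d_def)
    then have "m \<in> {a. a < length ts \<and> sum_list (map nodes ts) \<le> length ts * nodes (ts ! a)}"
      using m(1) by (simp add: d_def)
    then show ?thesis
      unfolding zs_def light_bound.simps
      by (rule member_le_sum) auto
  qed
  finally show ?thesis .
qed

lemma rank_child:
  assumes "v @ [i] \<in> positions t"
  shows "rank (positions t) (v @ [i]) =
    pred_count (outdeg (subtree_at t v)) (\<lambda>j. nodes (children (subtree_at t v) ! j)) i + 1"
proof -
  let ?T = "positions t" and ?d = "outdeg (subtree_at t v)"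
  let ?s = "\<lambda>j. nodes (children (subtree_at t v) ! j)"
  have v: "v \<in> ?T" and i: "i < ?d" using assms by (auto simp: snoc_in_positions)
  have sib: "siblings ?T (v @ [i]) = (\<lambda>j. v @ [j]) ` {..<?d}"
    using v by (auto simp: siblings_def is_parent_def snoc_in_positions)
  have card: "card (subtree ?T (v @ [j])) = ?s j" if "j < ?d" for j
    using card_subtree_positions[of "v @ [j]" t] v that by (simp add: snoc_in_positions subtree_at_append)
  have "ranked_before ?T (v @ [j]) (v @ [i]) \<longleftrightarrow> earlier ?s j i" if "j < ?d" for j
    by (simp add: ranked_before_def earlier_def card[OF that] card[OF i] preorder_less_def lexord_same_pref_iff)
  then have "{u \<in> siblings ?T (v @ [i]). ranked_before ?T u (v @ [i])} = (\<lambda>j. v @ [j]) ` {j. j < ?d \<and> earlier ?s j i}"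
    unfolding sib by auto
  then show ?thesis
    by (simp add: rank_def pred_count_def card_image inj_on_def)
qed

lemma two_heavy_child:
  assumes "v \<in> two_heavy (positions t)" "v @ [i] \<in> positions t"
  shows "v @ [i] \<in> two_heavy (positions t) \<longleftrightarrow> rank (positions t) (v @ [i]) \<le> 2"
  using assms by (auto simp: two_heavy_def prefix_snoc)

lemma T1_subset: "T1 M T \<subseteq> two_heavy T" "T1 M T \<subseteq> T"
  by (auto simp: T1_def two_heavy_def)

definition large_light :: "nat \<Rightarrow> otree \<Rightarrow> real" where
  "large_light L t = (if L < nodes t then light_bound t else 0)"

text \<open>The charge 1 + 2 * M + L for each \<open>u\<close> in \<open>T1\<close> consists of
  \<open>u\<close> itself, at most two trimmed children of rank at most 2, and all light children in
  case the subtree at \<open>u\<close> has at most \<open>L\<close> nodes. Larger subtrees are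
  charged to \<open>large_light\<close>.\<close>

lemma nodes_le_T1:
  assumes M: "1 \<le> M" "M \<le> nodes t"
  shows "real (nodes t) \<le> real (card (T1 M (positions t))) * (1 + 2 * real M + real L) + fringe_sum (large_light L) t"
proof -
  let ?T = "positions t"
  let ?T1 = "T1 M ?T"
  let ?d = "\<lambda>u. outdeg (subtree_at t u)"
  let ?s = "\<lambda>u j. nodes (children (subtree_at t u) ! j)"
  let ?E = "\<lambda>u. {i. i < ?d u \<and> u @ [i] \<notin> ?T1}"
  have fin: "finite ?T1" using T1_subset(2) finite_positions by (rule finite_subset)
  have root: "[] \<in> ?T1"
    using M(2) card_subtree_positions[of "[]" t] by (simp add: T1_def two_heavy_def)
  have cover: "v \<in> ?T1 \<or> (\<exists>u\<in>?T1. \<exists>i\<in>?E u. v \<in> subtree ?T (u @ [i]))" if "v \<in> ?T" for v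
    using that
  proof (induction v rule: rev_induct)
    case (snoc j w)
    then have w: "w \<in> ?T" "j < ?d w" by (auto simp: snoc_in_positions)
    from snoc.IH[OF w(1)] show ?case
    proof (elim disjE bexE)
      assume wT: "w \<in> ?T1"
      show ?case
      proof (cases "w @ [j] \<in> ?T1")
        case False
        then show ?thesis using wT w snoc.prems by (intro disjI2 bexI[of _ w] bexI[of _ j]) (auto simp: subtree_def)
      qed simp
    next
      fix u i assume "u \<in> ?T1" "i \<in> ?E u" "w \<in> subtree ?T (u @ [i])"
      then show ?case using snoc.prems by (intro disjI2 bexI[of _ u] bexI[of _ i]) (auto simp: subtree_def intro: prefix_prefix)
    qed
  qed (simp add: root)
  have child_size: "card (subtree ?T (u @ [i])) = ?s u i" if "u \<in> ?T" "i < ?d u" for u i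
    using card_subtree_positions[of "u @ [i]" t] that by (simp add: snoc_in_positions subtree_at_append)
  have inner: "real (\<Sum>i\<in>?E u. ?s u i) \<le> 2 * real M + real L + large_light L (subtree_at t u)" if u: "u \<in> ?T1" for u
  proof -
    have uT: "u \<in> ?T" and uH: "u \<in> two_heavy ?T" using u T1_subset[of M ?T] by auto
    let ?r = "pred_count (?d u) (?s u)"
    obtain ts where ts: "subtree_at t u = Node ts" by (cases "subtree_at t u")
    define A where "A = {i. i < ?d u \<and> ?r i < 2}"
    define B where "B = {i. i < ?d u \<and> 2 \<le> ?r i}"
    \<comment> \<open>A child of rank at most 2 of a node of \<open>T1\<close> is 2-heavy, so it can
      be missing from \<open>T1\<close> only through its size.\<close>
    have small: "?s u i \<le> M" if "i \<in> A" "u @ [i] \<notin> ?T1" for i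
    proof -
      have i: "i < ?d u" "?r i < 2" using that by (auto simp: A_def)
      then have iT: "u @ [i] \<in> ?T" using uT by (simp add: snoc_in_positions)
      have "u @ [i] \<in> two_heavy ?T"
        using two_heavy_child[OF uH iT] rank_child[OF iT] i(2) by simp
      then show ?thesis using that(2) child_size[OF uT i(1)] by (simp add: T1_def)
    qed
    have "(\<Sum>i\<in>?E u. ?s u i) \<le> (\<Sum>i\<in>(?E u \<inter> A) \<union> B. ?s u i)"
      by (rule sum_mono2) (auto simp: A_def B_def)
    also have "\<dots> \<le> (\<Sum>i\<in>?E u \<inter> A. ?s u i) + (\<Sum>i\<in>B. ?s u i)"
      by (subst sum.union_disjoint) (auto simp: A_def B_def)
    also have "(\<Sum>i\<in>?E u \<inter> A. ?s u i) \<le> (\<Sum>i\<in>?E u \<inter> A. M)"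
      by (rule sum_mono) (use small in auto)
    also have "\<dots> \<le> 2 * M"
    proof -
      have "card (?E u \<inter> A) \<le> card A" by (rule card_mono) (auto simp: A_def)
      also have "\<dots> \<le> 2" unfolding A_def by (rule card_pred_count_less_2)
      finally show ?thesis by simp
    qed
    finally have 1: "real (\<Sum>i\<in>?E u. ?s u i) \<le> 2 * real M + real (\<Sum>i\<in>B. ?s u i)" by linarith
    have 2: "real (\<Sum>i\<in>B. ?s u i) \<le> light_bound (subtree_at t u)"
      using light_children_le[of ts] by (simp add: ts B_def)
    have "(\<Sum>i\<in>B. ?s u i) \<le> (\<Sum>i<?d u. ?s u i)" by (rule sum_mono2) (auto simp: B_def)
    also have "\<dots> \<le> nodes (subtree_at t u)"
      by (simp add: ts nodes_Node sum_list_sum_nth atLeast0LessThan del: code.simps)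
    finally have 3: "(\<Sum>i\<in>B. ?s u i) \<le> nodes (subtree_at t u)" .
    have "real (\<Sum>i\<in>B. ?s u i) \<le> real L + large_light L (subtree_at t u)"
    proof (cases "L < nodes (subtree_at t u)")
      case True
      then have "large_light L (subtree_at t u) = light_bound (subtree_at t u)" by (simp add: large_light_def)
      then show ?thesis using 2 by linarith
    next
      case False
      then have "large_light L (subtree_at t u) = 0" by (simp add: large_light_def)
      then show ?thesis using 3 False by linarith
    qed
    then show ?thesis using 1 by linarith
  qed
  have "nodes t = card ?T" by (simp add: card_positions)
  also have "\<dots> \<le> card (?T1 \<union> (\<Union>u\<in>?T1. \<Union>i\<in>?E u. subtree ?T (u @ [i])))"
    by (intro card_mono) (use cover fin in \<open>auto simp: subtree_def\<close>)
  also have "\<dots> \<le> card ?T1 + card (\<Union>u\<in>?T1. \<Union>i\<in>?E u. subtree ?T (u @ [i]))"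
    by (rule card_Un_le)
  also have "card (\<Union>u\<in>?T1. \<Union>i\<in>?E u. subtree ?T (u @ [i])) \<le> (\<Sum>u\<in>?T1. card (\<Union>i\<in>?E u. subtree ?T (u @ [i])))"
    by (rule card_UN_le[OF fin])
  also have "\<dots> \<le> (\<Sum>u\<in>?T1. \<Sum>i\<in>?E u. ?s u i)"
  proof (rule sum_mono)
    fix u assume "u \<in> ?T1"
    then have u: "u \<in> ?T" using T1_subset(2) by blast
    have "card (\<Union>i\<in>?E u. subtree ?T (u @ [i])) \<le> (\<Sum>i\<in>?E u. card (subtree ?T (u @ [i])))"
      by (rule card_UN_le) simp
    also have "\<dots> = (\<Sum>i\<in>?E u. ?s u i)"
      by (rule sum.cong) (auto simp: child_size[OF u])
    finally show "card (\<Union>i\<in>?E u. subtree ?T (u @ [i])) \<le> (\<Sum>i\<in>?E u. ?s u i)" .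
  qed
  finally have "nodes t \<le> card ?T1 + (\<Sum>u\<in>?T1. \<Sum>i\<in>?E u. ?s u i)" by simp
  then have "real (nodes t) \<le> real (card ?T1) + (\<Sum>u\<in>?T1. real (\<Sum>i\<in>?E u. ?s u i))"
    by (simp only: of_nat_add[symmetric] of_nat_sum[symmetric] of_nat_le_iff)
  also have "\<dots> \<le> real (card ?T1) + (\<Sum>u\<in>?T1. 2 * real M + real L + large_light L (subtree_at t u))"
    by (intro add_left_mono sum_mono inner)
  also have "\<dots> = real (card ?T1) * (1 + 2 * real M + real L) + (\<Sum>u\<in>?T1. large_light L (subtree_at t u))"
    by (simp add: sum.distrib algebra_simps)
  also have "(\<Sum>u\<in>?T1. large_light L (subtree_at t u)) \<le> fringe_sum (large_light L) t"
    unfolding fringe_sum_eq_sum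
    by (intro sum_mono2 T1_subset) (auto simp: large_light_def light_bound_nonneg)
  finally show ?thesis by simp
qed

section \<open>Conclusion\<close>

text \<open>By the mean value theorem each term is at most 4 times a decrement of x^(-1/4), and the
  decrements telescope.\<close>

lemma sum_powr_tail:
  assumes "L > 0"
  shows "(\<Sum>k=Suc L..N. real k powr (- (5/4))) \<le> 4 * real L powr (- (1/4))"
proof -
  have step: "real (Suc k) powr (- (5/4)) \<le> 4 * (real k powr (- (1/4)) - real (Suc k) powr (- (1/4)))" if "k > 0" for k
  proof -
    have "\<exists>z>real k. z < real (Suc k) \<and> real (Suc k) powr (- (1/4)) - real k powr (- (1/4)) =
        (real (Suc k) - real k) * (- (1/4) * z powr (- (1/4) - 1))"
      using that by (intro MVT2) (auto intro!: derivative_eq_intros)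
    then obtain z where z: "real k < z" "z < real (Suc k)"
      "real (Suc k) powr (- (1/4)) - real k powr (- (1/4)) = - (1/4) * z powr (- (5/4))"
      by auto
    have "real (Suc k) powr (- (5/4)) \<le> z powr (- (5/4))"
      using z that by (intro powr_mono2') auto
    moreover have "4 * (real k powr (- (1/4)) - real (Suc k) powr (- (1/4))) = z powr (- (5/4))"
      by (subst minus_diff_eq[symmetric], subst z(3)) simp
    ultimately show ?thesis by (simp only:)
  qed
  have main: "(\<Sum>k=Suc L..N. real k powr (- (5/4))) \<le> 4 * (real L powr (- (1/4)) - real N powr (- (1/4)))" if "L \<le> N" for N
    using that
  proof (induction N rule: dec_induct)
    case (step N)
    have "(\<Sum>k=Suc L..Suc N. real k powr (- (5/4))) = (\<Sum>k=Suc L..N. real k powr (- (5/4))) + real (Suc N) powr (- (5/4))"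
      using step.hyps by simp
    also have "\<dots> \<le> 4 * (real L powr (- (1/4)) - real N powr (- (1/4))) +
        4 * (real N powr (- (1/4)) - real (Suc N) powr (- (1/4)))"
      using step.IH assms step.hyps by (intro add_mono \<open>\<And>k. k > 0 \<Longrightarrow> real (Suc k) powr (- (5/4)) \<le> 4 * (real k powr (- (1/4)) - real (Suc k) powr (- (1/4)))\<close>) auto
    finally show ?case by (simp add: algebra_simps)
  qed simp
  show ?thesis
  proof (cases "L \<le> N")
    case True
    have "4 * (real L powr (- (1/4)) - real N powr (- (1/4))) \<le> 4 * real L powr (- (1/4))" by simp
    with main[OF True] show ?thesis by (rule order_trans)
  qed simp
qed

lemma sum_inverse_sqrt: "(\<Sum>j=1..n. 1 / sqrt (real j)) \<le> 2 * sqrt (real n)"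
proof (induction n)
  case (Suc n)
  let ?a = "sqrt (real n)" and ?b = "sqrt (real (Suc n))"
  have "1 = (?b - ?a) * (?b + ?a)" by (simp add: algebra_simps)
  also have "\<dots> \<le> (?b - ?a) * (2 * ?b)" by (intro mult_left_mono) auto
  finally have "1 / ?b \<le> (?b - ?a) * (2 * ?b) / ?b" by (rule divide_right_mono) simp
  also have "\<dots> = 2 * (?b - ?a)" by (simp del: of_nat_Suc)
  finally have "1 / ?b \<le> 2 * (?b - ?a)" .
  moreover have "(\<Sum>j=1..Suc n. 1 / sqrt (real j)) = (\<Sum>j=1..n. 1 / sqrt (real j)) + 1 / ?b" by simp
  ultimately have "(\<Sum>j=1..Suc n. 1 / sqrt (real j)) \<le> 2 * ?a + 2 * (?b - ?a)"
    using Suc.IH by (simp only: add_mono)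
  then show ?case by (simp only: right_diff_distrib add_diff_cancel_left' add_diff_eq)
qed simp

text \<open>The convolution is split at n / 2. Below it the root factor is at most 2 / sqrt n and
  the powers sum to a tail at \<open>L\<close>. Above it the power is at most 4 * n^(-5/4) and the
  roots sum to at most 2 * sqrt n.\<close>

lemma sum_powr_sqrt:
  assumes "L > 0" "n > 0"
  shows "(\<Sum>k=Suc L..n. real k powr (- (5/4)) * (1 / sqrt (real (n - k) + 1))) \<le>
    8 * real L powr (- (1/4)) / sqrt (real n) + 8 * real n powr (- (3/4))"
proof -
  have "(\<Sum>k=Suc L..n. real k powr (- (5/4)) * (1 / sqrt (real (n - k) + 1))) \<le>
    (\<Sum>k=Suc L..n. real k powr (- (5/4)) * (2 / sqrt (real n)) + 4 * real n powr (- (5/4)) * (1 / sqrt (real (n - k) + 1)))"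
  proof (rule sum_mono)
    fix k assume k: "k \<in> {Suc L..n}"
    show "real k powr (- (5/4)) * (1 / sqrt (real (n - k) + 1)) \<le>
      real k powr (- (5/4)) * (2 / sqrt (real n)) + 4 * real n powr (- (5/4)) * (1 / sqrt (real (n - k) + 1))"
    proof (cases "2 * k \<le> n")
      case True
      have "sqrt (real n) \<le> sqrt (4 * (real (n - k) + 1))"
        using True by (intro real_sqrt_le_mono) (simp add: of_nat_diff)
      also have "\<dots> = 2 * sqrt (real (n - k) + 1)" by (simp only: real_sqrt_mult real_sqrt_four)
      finally have "1 / sqrt (real (n - k) + 1) \<le> 2 / sqrt (real n)"
        using assms by (simp add: divide_simps)
      then have "real k powr (- (5/4)) * (1 / sqrt (real (n - k) + 1)) \<le> real k powr (- (5/4)) * (2 / sqrt (real n))"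
        by (rule mult_left_mono) simp
      then show ?thesis by (simp add: add_increasing2)
    next
      case False
      have "real k powr (- (5/4)) \<le> (real n / 2) powr (- (5/4))"
        using False assms by (intro powr_mono2') auto
      also have "\<dots> = 2 powr (5/4) * real n powr (- (5/4))"
        using assms by (simp add: powr_divide powr_minus divide_simps)
      also have "\<dots> \<le> 2 powr 2 * real n powr (- (5/4))" by (intro mult_right_mono powr_mono) auto
      finally have "real k powr (- (5/4)) \<le> 4 * real n powr (- (5/4))" by (simp add: powr_numeral)
      then have "real k powr (- (5/4)) * (1 / sqrt (real (n - k) + 1)) \<le> 4 * real n powr (- (5/4)) * (1 / sqrt (real (n - k) + 1))"
        by (rule mult_right_mono) simp
      then show ?thesis by (simp add: add_increasing)
    qed
  qed
  also have "\<dots> = (\<Sum>k=Suc L..n. real k powr (- (5/4))) * (2 / sqrt (real n)) +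
      4 * real n powr (- (5/4)) * (\<Sum>k=Suc L..n. 1 / sqrt (real (n - k) + 1))"
    by (simp only: sum.distrib sum_distrib_left sum_distrib_right)
  also have "\<dots> \<le> 4 * real L powr (- (1/4)) * (2 / sqrt (real n)) + 4 * real n powr (- (5/4)) * (2 * sqrt (real n))"
  proof (intro add_mono mult_right_mono mult_left_mono sum_powr_tail assms)
    have "(\<Sum>k=Suc L..n. 1 / sqrt (real (n - k) + 1)) \<le> (\<Sum>k=1..n. 1 / sqrt (real (n - k) + 1))"
      by (rule sum_mono2) auto
    also have "\<dots> = (\<Sum>j=1..n. 1 / sqrt (real j))"
      by (rule sum.reindex_bij_witness[where i = "\<lambda>j. n + 1 - j" and j = "\<lambda>k. n + 1 - k"]) (auto simp: of_nat_diff)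
    finally show "(\<Sum>k=Suc L..n. 1 / sqrt (real (n - k) + 1)) \<le> 2 * sqrt (real n)"
      using sum_inverse_sqrt[of n] by linarith
  qed auto
  also have "4 * real n powr (- (5/4)) * (2 * sqrt (real n)) = 8 * real n powr (- (3/4))"
  proof -
    have "real n powr (- (5/4)) * real n powr (1/2) = real n powr (- (5/4) + 1/2)" by (rule powr_add[symmetric])
    then show ?thesis by (simp add: powr_half_sqrt)
  qed
  finally show ?thesis by simp
qed

lemma fringe_sum_ennreal:
  assumes "\<And>t. 0 \<le> f t"
  shows "fringe_sum (\<lambda>t. ennreal (f t)) t = ennreal (fringe_sum f t)"
  unfolding fringe_sum_eq_sum using assms by (simp add: sum_ennreal)

lemma fringe_sum_add: "fringe_sum (\<lambda>t. f t + g t) t = fringe_sum f t + fringe_sum g t"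
  unfolding fringe_sum_eq_sum by (rule sum.distrib)

definition medium_light :: "nat \<Rightarrow> nat \<Rightarrow> otree \<Rightarrow> real" where
  "medium_light L K t = (if L < nodes t \<and> nodes t \<le> K then light_bound t else 0)"

lemma large_light_split: "L \<le> K \<Longrightarrow> large_light L t = medium_light L K t + large_light K t"
  by (auto simp: large_light_def medium_light_def)

text \<open>It provides the uniform bound on \<open>medium_light L K\<close> for fixed
  \<open>K\<close> that the exponential estimate demands.\<close>

lemma finite_nodes_le: "finite {t. nodes t \<le> K}"
proof (rule finite_imageD)
  have "a \<le> K" if "nodes t \<le> K" "a \<in> set (code t)" for a t
    using sum_list_code[of t] member_le_sum_list[OF that(2)] that(1) by simp
  then show "finite (code ` {t. nodes t \<le> K})"
    by (intro finite_subset[OF _ finite_lists_length_le[of "{..K}" K]]) auto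
qed (simp add: inj_on_def)

lemma nn_integral_count_space_split:
  "(\<integral>\<^sup>+x. f x \<partial>count_space A) =
   (\<integral>\<^sup>+x. f x \<partial>count_space (A \<inter> B)) + (\<integral>\<^sup>+x. f x \<partial>count_space (A - B))"
proof -
  have ind: "(\<integral>\<^sup>+x. f x \<partial>count_space S) = (\<integral>\<^sup>+x. f x * indicator S x \<partial>count_space UNIV)" for S
    by (rule nn_integral_count_space_indicator) simp
  have "(\<integral>\<^sup>+x. f x \<partial>count_space A) = (\<integral>\<^sup>+x. f x * indicator (A \<inter> B) x + f x * indicator (A - B) x \<partial>count_space UNIV)"
    unfolding ind[of A] by (intro nn_integral_cong) (auto split: split_indicator)
  then show ?thesis by (simp add: nn_integral_add nn_integral_count_space_indicator)
qed

lemma nn_integral_count_space_Un_le: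
  assumes "C \<subseteq> A \<union> B"
  shows "(\<integral>\<^sup>+x. f x \<partial>count_space C) \<le> (\<integral>\<^sup>+x. f x \<partial>count_space A) + (\<integral>\<^sup>+x. f x \<partial>count_space B)"
  unfolding nn_integral_count_space_split[where A = C and B = A] using assms
  by (intro add_mono nn_integral_count_space_subset) auto

lemma size_mass_finite: "size_mass p n < top"
proof -
  have "size_mass p n \<le> (\<integral>\<^sup>+t. tree_weight p t \<partial>count_space UNIV)"
    unfolding size_mass_def by (rule nn_integral_count_space_subset) simp
  also have "\<dots> \<le> 1" by (rule tree_weight_total)
  finally show ?thesis by (rule le_less_trans) simp
qed

lemma cond_gw_prob_mono:
  assumes "\<And>t. nodes t = n \<Longrightarrow> Q (positions t) \<Longrightarrow> R (positions t)"
  shows "cond_gw_prob p n Q \<le> cond_gw_prob p n R"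
  unfolding cond_gw_prob_eq
proof (intro divide_right_mono enn2real_mono nn_integral_count_space_subset)
  have "(\<integral>\<^sup>+t. tree_weight p t \<partial>count_space {t. nodes t = n \<and> R (positions t)}) \<le> size_mass p n"
    unfolding size_mass_def by (rule nn_integral_count_space_subset) auto
  also have "\<dots> < top" by (rule size_mass_finite)
  finally show "(\<integral>\<^sup>+t. tree_weight p t \<partial>count_space {t. nodes t = n \<and> R (positions t)}) < top" .
qed (use assms in auto)

lemma cond_gw_prob_nonneg: "0 \<le> cond_gw_prob p n Q"
  by (simp add: cond_gw_prob_eq)

text \<open>For \<open>n\<close> outside \<open>sizes p\<close> the denominator is 0 and both
  conditional probabilities take the default value 0.\<close>

lemma cond_gw_prob_not:
  assumes "n \<in> sizes p"
  shows "cond_gw_prob p n Q = 1 - cond_gw_prob p n (\<lambda>T. \<not> Q T)"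
proof -
  let ?I = "\<lambda>Q. \<integral>\<^sup>+t. tree_weight p t \<partial>count_space {t. nodes t = n \<and> Q (positions t)}"
  have sets: "{t. nodes t = n} \<inter> {t. Q (positions t)} = {t. nodes t = n \<and> Q (positions t)}"
    "{t. nodes t = n} - {t. Q (positions t)} = {t. nodes t = n \<and> \<not> Q (positions t)}" by auto
  have eq: "size_mass p n = ?I Q + ?I (\<lambda>T. \<not> Q T)"
    unfolding size_mass_def sets[symmetric] by (rule nn_integral_count_space_split)
  then have "?I Q < top" "?I (\<lambda>T. \<not> Q T) < top"
    using size_mass_finite[of p n] by simp_all
  then have "enn2real (size_mass p n) = enn2real (?I Q) + enn2real (?I (\<lambda>T. \<not> Q T))"
    unfolding eq by (rule enn2real_plus)
  moreover have "x / z = 1 - y / z" if "z = x + y" "z > 0" for x y z :: real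
    using that by (simp add: field_simps)
  ultimately show ?thesis
    using assms unfolding cond_gw_prob_eq sizes_iff by blast
qed

section \<open>Tail estimates for the conditioned tree\<close>

context critical_offspring
begin

abbreviation size_prob :: "nat \<Rightarrow> real" where
  "size_prob n \<equiv> enn2real (size_mass p n)"

lemma size_prob_lower:
  "\<exists>c>0. \<forall>\<^sub>F n in sequentially. n \<in> sizes p \<longrightarrow> c * real n powr (- (3/2)) \<le> size_prob n"
proof -
  obtain c where c: "c > 0"
    "\<forall>\<^sub>F n in sequentially. pmf (walk p n) (n - 1) > 0 \<longrightarrow> c / sqrt (real n) \<le> pmf (walk p n) (n - 1)"
    using walk_lower by blast
  have "\<forall>\<^sub>F n in sequentially. n \<in> sizes p \<longrightarrow> c * real n powr (- (3/2)) \<le> size_prob n"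
    using c(2) eventually_gt_at_top[of 0]
  proof eventually_elim
    case (elim n)
    show ?case
    proof
      assume "n \<in> sizes p"
      have eq: "size_prob n = pmf (walk p n) (n - 1) / n"
        using elim(2) by (simp add: size_mass_eq)
      then have "pmf (walk p n) (n - 1) > 0"
        using \<open>n \<in> sizes p\<close> elim(2) by (simp add: sizes_iff zero_less_divide_iff)
      then have "c / sqrt (real n) / n \<le> size_prob n"
        unfolding eq using elim(1) by (intro divide_right_mono) auto
      moreover have "c / sqrt (real n) / n = c * real n powr (- (3/2))"
      proof -
        have "real n powr (3/2) = real n powr (1 + 1/2)" by simp
        also have "\<dots> = real n * sqrt (real n)" using elim(2) by (simp only: powr_add powr_half_sqrt) simp
        finally show ?thesis by (simp add: powr_minus field_simps)
      qed
      ultimately show "c * real n powr (- (3/2)) \<le> size_prob n" by simp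
    qed
  qed
  then show ?thesis using c(1) by blast
qed

text \<open>Uniformity in \<open>K\<close> matters: \<open>L\<close> is fixed by this bound before
  \<open>K\<close> is chosen.\<close>

lemma medium_light_mean:
  "\<exists>C>0. \<forall>L>0. \<forall>K. (\<integral>\<^sup>+t. tree_weight p t * ennreal (medium_light L K t) \<partial>count_space UNIV) \<le>
     ennreal (C * real L powr (- (1/4)))"
proof -
  obtain C where C: "C > 0" "\<And>n. n > 0 \<Longrightarrow>
     (\<integral>\<^sup>+t. tree_weight p t * ennreal (light_bound t) \<partial>count_space {t. nodes t = n}) \<le> ennreal (C * real n powr (- (5/4)))"
    using light_mean_upper by blast
  have "(\<integral>\<^sup>+t. tree_weight p t * ennreal (medium_light L K t) \<partial>count_space UNIV) \<le> ennreal (C * 4 * real L powr (- (1/4)))"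
    if L: "L > 0" for L K
  proof -
    have "(\<integral>\<^sup>+t. tree_weight p t * ennreal (medium_light L K t) \<partial>count_space UNIV) =
        (\<integral>\<^sup>+t. tree_weight p t * ennreal (light_bound t) * indicator {t. nodes t \<in> {Suc L..K}} t \<partial>count_space UNIV)"
      by (intro nn_integral_cong) (auto simp: medium_light_def split: split_indicator)
    also have "\<dots> = (\<integral>\<^sup>+t. tree_weight p t * ennreal (light_bound t) \<partial>count_space {t. nodes t \<in> {Suc L..K}})"
      by (simp only: nn_integral_count_space_restrict Int_UNIV_left)
    also have "\<dots> = (\<Sum>k=Suc L..K. \<integral>\<^sup>+t. tree_weight p t * ennreal (light_bound t) \<partial>count_space {t. nodes t = k})"
      unfolding nn_integral_by_nodes by (simp add: nn_integral_count_space_finite)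
    also have "\<dots> \<le> (\<Sum>k=Suc L..K. ennreal (C * real k powr (- (5/4))))"
      by (intro sum_mono C(2)) auto
    also have "\<dots> = ennreal (C * (\<Sum>k=Suc L..K. real k powr (- (5/4))))"
      using C(1) by (simp add: sum_ennreal sum_distrib_left)
    also have "\<dots> \<le> ennreal (C * (4 * real L powr (- (1/4))))"
      using C(1) by (intro ennreal_leI mult_left_mono sum_powr_tail L) auto
    finally show ?thesis by (simp add: mult.assoc)
  qed
  then show ?thesis using C(1) by (intro exI[of _ "C * 4"]) auto
qed

text \<open>The mean is restricted to |T| = n but not normalised. Dividing by n * P(|T| = n), of
  order n^(-1/2), leaves K^(-1/4) + n^(-1/4).\<close>

lemma large_light_mean:
  "\<exists>C>0. \<forall>n>0. \<forall>K>0. (\<integral>\<^sup>+t. tree_weight p t * ennreal (fringe_sum (large_light K) t) \<partial>count_space {t. nodes t = n}) \<le>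
     ennreal (C * (real K powr (- (1/4)) / sqrt (real n) + real n powr (- (3/4))))"
proof -
  obtain C where C: "C > 0" "\<And>n. n > 0 \<Longrightarrow>
     (\<integral>\<^sup>+t. tree_weight p t * ennreal (light_bound t) \<partial>count_space {t. nodes t = n}) \<le> ennreal (C * real n powr (- (5/4)))"
    using light_mean_upper by blast
  obtain D0 where D0: "\<And>n j. pmf (walk p n) j \<le> D0 / sqrt (real n + 1)" using walk_upper by blast
  define D where "D = \<bar>D0\<bar> + 1"
  have D: "D > 0" "pmf (walk p n) j \<le> D * (1 / sqrt (real n + 1))" for n j
  proof -
    have "D0 / sqrt (real n + 1) \<le> D / sqrt (real n + 1)" by (intro divide_right_mono) (auto simp: D_def)
    then show "pmf (walk p n) j \<le> D * (1 / sqrt (real n + 1))" using D0[of n j] by simp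
  qed (simp add: D_def)
  have "(\<integral>\<^sup>+t. tree_weight p t * ennreal (fringe_sum (large_light K) t) \<partial>count_space {t. nodes t = n}) \<le>
     ennreal (C * D * 8 * (real K powr (- (1/4)) / sqrt (real n) + real n powr (- (3/4))))" if n: "n > 0" and K: "K > 0" for n K
  proof -
    let ?u = "\<lambda>k. pmf (walk p (n - k)) (n - k)"
    have nonneg: "0 \<le> large_light K t" for t by (simp add: large_light_def light_bound_nonneg)
    have "(\<integral>\<^sup>+t. tree_weight p t * ennreal (fringe_sum (large_light K) t) \<partial>count_space {t. nodes t = n}) =
       (\<integral>\<^sup>+s. tree_weight p s * ennreal (large_light K s) * ennreal (?u (nodes s)) \<partial>count_space {s. nodes s \<le> n})"
      unfolding fringe_sum_ennreal[OF nonneg, symmetric] by (rule nn_integral_fringe_sum_walk)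
    also have "\<dots> = (\<integral>\<^sup>+s. (tree_weight p s * ennreal (light_bound s) * ennreal (?u (nodes s))) * indicator {t. K < nodes t} s \<partial>count_space {s. nodes s \<le> n})"
      by (intro nn_integral_cong) (auto simp: large_light_def split: split_indicator)
    also have "\<dots> = (\<integral>\<^sup>+s. tree_weight p s * ennreal (light_bound s) * ennreal (?u (nodes s)) \<partial>count_space {s. nodes s \<in> {Suc K..n}})"
      unfolding nn_integral_count_space_restrict by (intro arg_cong2[where f = nn_integral] arg_cong[where f = count_space]) auto
    also have "\<dots> = (\<Sum>k=Suc K..n. \<integral>\<^sup>+s. tree_weight p s * ennreal (light_bound s) * ennreal (?u (nodes s)) \<partial>count_space {s. nodes s = k})"
      unfolding nn_integral_by_nodes by (simp add: nn_integral_count_space_finite)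
    also have "\<dots> = (\<Sum>k=Suc K..n. (\<integral>\<^sup>+s. tree_weight p s * ennreal (light_bound s) \<partial>count_space {s. nodes s = k}) * ennreal (?u k))"
    proof (rule sum.cong)
      fix k
      have "(\<integral>\<^sup>+s. tree_weight p s * ennreal (light_bound s) * ennreal (?u (nodes s)) \<partial>count_space {s. nodes s = k}) =
         (\<integral>\<^sup>+s. tree_weight p s * ennreal (light_bound s) * ennreal (?u k) \<partial>count_space {s. nodes s = k})"
        by (intro nn_integral_cong) simp
      then show "(\<integral>\<^sup>+s. tree_weight p s * ennreal (light_bound s) * ennreal (?u (nodes s)) \<partial>count_space {s. nodes s = k}) =
         (\<integral>\<^sup>+s. tree_weight p s * ennreal (light_bound s) \<partial>count_space {s. nodes s = k}) * ennreal (?u k)"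
        by (simp add: nn_integral_multc)
    qed simp
    also have "\<dots> \<le> (\<Sum>k=Suc K..n. ennreal (C * real k powr (- (5/4))) * ennreal (D * (1 / sqrt (real (n - k) + 1))))"
      by (intro sum_mono mult_mono C(2) ennreal_leI D(2)) auto
    also have "\<dots> = (\<Sum>k=Suc K..n. ennreal (C * D * (real k powr (- (5/4)) * (1 / sqrt (real (n - k) + 1)))))"
      using C(1) D(1) by (intro sum.cong refl) (simp add: ennreal_mult[symmetric] mult_ac)
    also have "\<dots> = ennreal (C * D * (\<Sum>k=Suc K..n. real k powr (- (5/4)) * (1 / sqrt (real (n - k) + 1))))"
      unfolding sum_distrib_left using C(1) D(1) by (intro sum_ennreal) (auto intro!: mult_nonneg_nonneg)
    also have "\<dots> \<le> ennreal (C * D * (8 * real K powr (- (1/4)) / sqrt (real n) + 8 * real n powr (- (3/4))))"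
      using C(1) D(1) by (intro ennreal_leI mult_left_mono sum_powr_sqrt n K) auto
    finally show ?thesis by (simp add: algebra_simps)
  qed
  then show ?thesis using C(1) D(1) by (intro exI[of _ "C * D * 8"]) auto
qed

lemma large_light_tail:
  assumes "n > 0"
    and "(\<integral>\<^sup>+t. tree_weight p t * ennreal (fringe_sum (large_light K) t) \<partial>count_space {t. nodes t = n}) \<le> ennreal E"
    and "0 \<le> E"
  shows "(\<integral>\<^sup>+t. tree_weight p t \<partial>count_space {t. nodes t = n \<and> 1/4 * real n \<le> fringe_sum (large_light K) t}) \<le> ennreal (4 / n * E)"
proof -
  let ?F = "\<lambda>t. fringe_sum (large_light K) t"
  let ?A = "{t. nodes t = n \<and> 1/4 * real n \<le> ?F t}"
  have "(\<integral>\<^sup>+t. tree_weight p t \<partial>count_space ?A) \<le> (\<integral>\<^sup>+t. ennreal (4 / n) * (tree_weight p t * ennreal (?F t)) \<partial>count_space ?A)"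
  proof (rule nn_integral_mono)
    fix t assume "t \<in> space (count_space ?A)"
    then have "1 \<le> 4 / n * ?F t" using assms(1) by (simp add: field_simps)
    then have "1 \<le> ennreal (4 / n * ?F t)" by simp
    moreover have "ennreal (4 / n * ?F t) = ennreal (4 / n) * ennreal (?F t)" by (rule ennreal_mult') simp
    ultimately have "1 \<le> ennreal (4 / n) * ennreal (?F t)" by (simp only:)
    then have "tree_weight p t * 1 \<le> tree_weight p t * (ennreal (4 / n) * ennreal (?F t))"
      by (rule mult_left_mono) simp
    then show "tree_weight p t \<le> ennreal (4 / n) * (tree_weight p t * ennreal (?F t))"
      by (simp add: mult_ac)
  qed
  also have "\<dots> \<le> (\<integral>\<^sup>+t. ennreal (4 / n) * (tree_weight p t * ennreal (?F t)) \<partial>count_space {t. nodes t = n})"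
    by (rule nn_integral_count_space_subset) auto
  also have "\<dots> \<le> ennreal (4 / n) * ennreal E"
    using assms(2) by (simp add: nn_integral_cmult mult_left_mono)
  also have "\<dots> = ennreal (4 / n * E)" by (rule ennreal_mult[symmetric]) (use assms in auto)
  finally show ?thesis .
qed

text \<open>The order of the choices is essential: \<open>L\<close>, and with it \<open>v\<close>,
  is fixed first, and only then does \<open>K\<close> depend on \<epsilon>.\<close>

lemma T1_linear:
  fixes M :: nat
  assumes M: "M \<ge> 1"
  obtains v where "0 < v" "v \<le> 1/2"
    "((\<lambda>n. cond_gw_prob p n (\<lambda>T. real (card (T1 M T)) < v * real n)) \<longlongrightarrow> 0) (inf sequentially (principal (sizes p)))"
proof -
  obtain C1 where C1: "C1 > 0" "\<And>L K. L > 0 \<Longrightarrow>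
     (\<integral>\<^sup>+t. tree_weight p t * ennreal (medium_light L K t) \<partial>count_space UNIV) \<le> ennreal (C1 * real L powr (- (1/4)))"
    using medium_light_mean by blast
  obtain C2 where C2: "C2 > 0" "\<And>n K. n > 0 \<Longrightarrow> K > 0 \<Longrightarrow>
     (\<integral>\<^sup>+t. tree_weight p t * ennreal (fringe_sum (large_light K) t) \<partial>count_space {t. nodes t = n}) \<le>
     ennreal (C2 * (real K powr (- (1/4)) / sqrt (real n) + real n powr (- (3/4))))"
    using large_light_mean by blast
  obtain c where c: "c > 0" "\<forall>\<^sub>F n in sequentially. n \<in> sizes p \<longrightarrow> c * real n powr (- (3/2)) \<le> size_prob n"
    using size_prob_lower by blast
  have small: "\<exists>K\<ge>L. K > 0 \<and> B * real K powr (- (1/4)) < a" if "a > 0" for a B :: real and L :: nat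
  proof -
    have "((\<lambda>K. B * real K powr (- (1/4))) \<longlongrightarrow> 0) sequentially" by real_asymp
    then have "\<forall>\<^sub>F K in sequentially. B * real K powr (- (1/4)) < a"
      using that by (rule order_tendstoD)
    then have "\<forall>\<^sub>F K in sequentially. B * real K powr (- (1/4)) < a \<and> K > 0 \<and> K \<ge> L"
      by (intro eventually_conj eventually_gt_at_top eventually_ge_at_top)
    from eventually_happens'[OF sequentially_bot this] show ?thesis by blast
  qed
  \<comment> \<open>Here 1/32 is \<delta> / 8 for \<delta> = 1/4, the mean allowed by
    \<open>bounded_fringe_tail\<close>.\<close>
  obtain L where L: "L > 0" "C1 * real L powr (- (1/4)) < 1/32"
    using small[of "1/32" 0 C1] by auto
  define W where "W = 1 + 2 * real M + real L"
  \<comment> \<open>As \<open>W\<close> is the charge per node of \<open>T1\<close>, fewer than v *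
    n nodes account for at most n / 2, and the other half must come from large light
    subtrees.\<close>
  define v where "v = 1 / (2 * W)"
  have W: "W \<ge> 1" by (simp add: W_def)
  have v: "0 < v" "v \<le> 1/2" "v * W = 1/2" using W by (auto simp: v_def)
  let ?bad = "\<lambda>n T. real (card (T1 M T)) < v * real n"
  show ?thesis
  proof (rule that[OF v(1,2)], rule tendstoI)
    fix \<epsilon> :: real assume \<epsilon>: "\<epsilon> > 0"
    obtain K where K: "K \<ge> L" "K > 0" "4 * C2 / c * real K powr (- (1/4)) < \<epsilon> / 3"
      using small[of "\<epsilon> / 3" L "4 * C2 / c"] \<epsilon> by auto
    define B where "B = Max (insert 0 (light_bound ` {t. nodes t \<le> K}))"
    have B: "medium_light L K t \<le> B" for t
      using finite_nodes_le[of K] by (auto simp: medium_light_def B_def)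
    have mean: "(\<integral>\<^sup>+t. tree_weight p t * ennreal (medium_light L K t) \<partial>count_space UNIV) \<le> ennreal (1/4 / 8)"
      using C1(2)[OF L(1), of K] L(2) by (elim order_trans) (auto intro: ennreal_leI)
    obtain e where e: "e > 0" "\<And>n. (\<integral>\<^sup>+t. tree_weight p t \<partial>count_space
        {t. nodes t = n \<and> 1/4 * real n \<le> fringe_sum (medium_light L K) t}) \<le> ennreal (exp (- e * real n))"
    proof (rule bounded_fringe_tail[where g = "medium_light L K" and B = B and L = K and \<delta> = "1/4" and p = p])
      show "0 \<le> medium_light L K t" for t by (simp add: medium_light_def light_bound_nonneg)
      show "medium_light L K t \<noteq> 0 \<Longrightarrow> nodes t \<le> K" for t by (simp add: medium_light_def split: if_splits)
    qed (rule B, simp, rule mean, rule that)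
    have lim1: "\<forall>\<^sub>F n in sequentially. exp (- e * real n) * real n powr (3/2) / c < \<epsilon> / 3"
    proof (rule order_tendstoD(2))
      show "(\<lambda>n. exp (- e * real n) * real n powr (3/2) / c) \<longlonglongrightarrow> 0" using e(1) c(1) by real_asymp
    qed (use \<epsilon> in simp)
    have lim2: "\<forall>\<^sub>F n in sequentially. 4 * C2 / c * real n powr (- (1/4)) < \<epsilon> / 3"
    proof (rule order_tendstoD(2))
      show "(\<lambda>n. 4 * C2 / c * real n powr (- (1/4))) \<longlonglongrightarrow> 0" by real_asymp
    qed (use \<epsilon> in simp)
    have "\<forall>\<^sub>F n in sequentially. n \<in> sizes p \<longrightarrow> cond_gw_prob p n (?bad n) < \<epsilon>"
      using lim1 lim2 c(2) eventually_ge_at_top[of M]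
    proof eventually_elim
      case (elim n)
      then have n: "n > 0" using M by simp
      define E where "E = C2 * (real K powr (- (1/4)) / sqrt (real n) + real n powr (- (3/4)))"
      have E: "E \<ge> 0" using C2(1) by (simp add: E_def)
      have sub: "{t. nodes t = n \<and> ?bad n (positions t)} \<subseteq>
          {t. nodes t = n \<and> 1/4 * real n \<le> fringe_sum (medium_light L K) t} \<union>
          {t. nodes t = n \<and> 1/4 * real n \<le> fringe_sum (large_light K) t}"
      proof
        fix t assume "t \<in> {t. nodes t = n \<and> ?bad n (positions t)}"
        then have t: "nodes t = n" "?bad n (positions t)" by auto
        have "real (card (T1 M (positions t))) * W \<le> v * real n * W"
          using t(2) W by (intro mult_right_mono) auto
        also have "\<dots> = (v * W) * real n" by (simp only: mult_ac)
        also have "\<dots> = real n / 2" using v(3) by simp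
        finally have "real n / 2 \<le> fringe_sum (large_light L) t"
          using nodes_le_T1[of M t L] M elim(4) t(1) by (simp add: W_def)
        also have "fringe_sum (large_light L) t = fringe_sum (medium_light L K) t + fringe_sum (large_light K) t"
        proof -
          have "large_light L = (\<lambda>t. medium_light L K t + large_light K t)"
            by (rule ext) (rule large_light_split[OF K(1)])
          then show ?thesis by (simp only: fringe_sum_add)
        qed
        finally show "t \<in> {t. nodes t = n \<and> 1/4 * real n \<le> fringe_sum (medium_light L K) t} \<union>
          {t. nodes t = n \<and> 1/4 * real n \<le> fringe_sum (large_light K) t}"
          using t(1) by (simp only: Un_iff mem_Collect_eq) linarith
      qed
      have "(\<integral>\<^sup>+t. tree_weight p t \<partial>count_space {t. nodes t = n \<and> ?bad n (positions t)}) \<le>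
          ennreal (exp (- e * n)) + ennreal (4 / n * E)"
        using C2(2)[OF n K(2)] e(2)[of n]
        by (intro order_trans[OF nn_integral_count_space_Un_le[OF sub]] add_mono large_light_tail n E) (auto simp: E_def)
      also have "\<dots> = ennreal (exp (- e * n) + 4 / n * E)" using E by (simp add: ennreal_plus)
      finally have num: "enn2real (\<integral>\<^sup>+t. tree_weight p t \<partial>count_space {t. nodes t = n \<and> ?bad n (positions t)}) \<le>
          exp (- e * n) + 4 / n * E"
        using E by (intro enn2real_leI) auto
      show ?case
      proof
        assume "n \<in> sizes p"
        then have den: "c * real n powr (- (3/2)) \<le> size_prob n" using elim(3) by simp
        \<comment> \<open>In the \<open>K\<close> term the 1 / n of the Markov bound, the 1 / sqrt n
          of the mean and the n^(3/2) of the conditioning cancel exactly; the other two terms vanish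
          as n grows.\<close>
        have "cond_gw_prob p n (?bad n) \<le> (exp (- e * n) + 4 / n * E) / (c * real n powr (- (3/2)))"
          unfolding cond_gw_prob_eq using num den E c(1) n by (intro frac_le) auto
        also have "\<dots> = exp (- e * real n) * real n powr (3/2) / c +
            4 * C2 / c * real K powr (- (1/4)) + 4 * C2 / c * real n powr (- (1/4))"
        proof -
          have p1: "real n powr (3/2) / n / sqrt (real n) = 1"
          proof -
            have "real n powr (3/2) = real n powr (1 + 1/2)" by simp
            also have "\<dots> = real n * sqrt (real n)" using n by (simp only: powr_add powr_half_sqrt) simp
            finally show ?thesis using n by simp
          qed
          have p2: "real n powr (3/2) / n * real n powr (- (3/4)) = real n powr (- (1/4))"
          proof -
            have "real n powr (3/2) * real n powr (- 1) * real n powr (- (3/4)) = real n powr (3/2 + (- 1) + - (3/4))"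
              by (simp only: powr_add)
            then show ?thesis using n by (simp add: powr_minus_divide)
          qed
          have "(exp (- e * n) + 4 / n * E) / (c * real n powr (- (3/2))) = (exp (- e * n) + 4 / n * E) * real n powr (3/2) / c"
            using n by (simp add: powr_minus field_simps)
          also have "\<dots> = exp (- e * real n) * real n powr (3/2) / c +
            4 * C2 / c * (real K powr (- (1/4)) * (real n powr (3/2) / n / sqrt (real n)) + real n powr (3/2) / n * real n powr (- (3/4)))"
            by (simp add: E_def algebra_simps add_divide_distrib)
          finally show ?thesis unfolding p1 p2 by (simp add: algebra_simps)
        qed
        also have "\<dots> < \<epsilon>" using elim(1,2) K(3) by linarith
        finally show "cond_gw_prob p n (?bad n) < \<epsilon>" .
      qed
    qed
    then show "\<forall>\<^sub>F n in inf sequentially (principal (sizes p)). dist (cond_gw_prob p n (?bad n)) 0 < \<epsilon>"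
      by (simp add: eventually_inf_principal cond_gw_prob_nonneg)
  qed
qed

lemma V3_not_linear:
  fixes M :: nat
  assumes "M \<ge> 1"
  shows "\<exists>\<gamma>::real. 0 < \<gamma> \<and> \<gamma> < 1 \<and>
    ((\<lambda>n. cond_gw_prob p n (\<lambda>T. real (card (V3 M T)) \<ge> \<gamma> * real n)) \<longlongrightarrow> 0) (inf sequentially (principal (sizes p)))"
proof -
  obtain v where v: "0 < v" "v \<le> 1/2"
    and lim: "((\<lambda>n. cond_gw_prob p n (\<lambda>T. real (card (T1 M T)) < v * real n)) \<longlongrightarrow> 0) (inf sequentially (principal (sizes p)))"
    using T1_linear[OF assms] .
  \<comment> \<open>The threshold uses v / 2 instead of \<open>v\<close> so that a large
    \<open>V3\<close> leaves at most v * n / 2 nodes to \<open>T1\<close>, strictly fewer than v *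
    n.\<close>
  have "cond_gw_prob p n (\<lambda>T. real (card (V3 M T)) \<ge> (1 - v / 2) * real n) \<le>
      cond_gw_prob p n (\<lambda>T. real (card (T1 M T)) < v * real n)" if "n > 0" for n
  proof (rule cond_gw_prob_mono)
    fix t assume t: "nodes t = n" "real (card (V3 M (positions t))) \<ge> (1 - v / 2) * real n"
    have "card (V3 M (positions t)) \<le> card (positions t - T1 M (positions t))"
      by (rule card_mono) (auto simp: V3_def)
    also have "\<dots> = n - card (T1 M (positions t))"
      using T1_subset(2)[of M "positions t"] t(1)
      by (subst card_Diff_subset) (auto intro: finite_subset simp: card_positions)
    finally have "card (V3 M (positions t)) \<le> n - card (T1 M (positions t))" .
    moreover have "card (T1 M (positions t)) \<le> n"
      using card_mono[OF finite_positions T1_subset(2)[of M "positions t"]] t(1) by (simp add: card_positions)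
    ultimately have "real (card (V3 M (positions t))) + real (card (T1 M (positions t))) \<le> real n" by linarith
    moreover have "(1 - v / 2) * real n = real n - v * real n / 2" by (simp add: algebra_simps)
    moreover have "v * real n > 0" using v that by simp
    ultimately show "real (card (T1 M (positions t))) < v * real n" using t(2) by linarith
  qed
  then have "\<forall>\<^sub>F n in inf sequentially (principal (sizes p)).
      cond_gw_prob p n (\<lambda>T. real (card (V3 M T)) \<ge> (1 - v / 2) * real n) \<le> cond_gw_prob p n (\<lambda>T. real (card (T1 M T)) < v * real n)"
    by (auto simp: eventually_inf_principal sizes_def)
  then have "((\<lambda>n. cond_gw_prob p n (\<lambda>T. real (card (V3 M T)) \<ge> (1 - v / 2) * real n)) \<longlongrightarrow> 0) (inf sequentially (principal (sizes p)))"
    by (rule tendsto_sandwich[OF _ _ tendsto_const lim, rotated]) (simp add: cond_gw_prob_nonneg)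
  then show ?thesis using v by (intro exI[of _ "1 - v / 2"]) auto
qed

lemma two_heavy_linear:
  fixes M :: nat
  assumes "M \<ge> 1"
  shows "\<exists>\<upsilon>::real. \<upsilon> > 0 \<and>
    ((\<lambda>n. cond_gw_prob p n (\<lambda>T. real (card (two_heavy T)) \<ge> \<upsilon> * real n)) \<longlongrightarrow> 1) (inf sequentially (principal (sizes p)))"
proof -
  obtain v where v: "0 < v" "v \<le> 1/2"
    and lim: "((\<lambda>n. cond_gw_prob p n (\<lambda>T. real (card (T1 M T)) < v * real n)) \<longlongrightarrow> 0) (inf sequentially (principal (sizes p)))"
    using T1_linear[OF assms] .
  have le: "cond_gw_prob p n (\<lambda>T. \<not> real (card (two_heavy T)) \<ge> v * real n) \<le>
      cond_gw_prob p n (\<lambda>T. real (card (T1 M T)) < v * real n)" for n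
  proof (rule cond_gw_prob_mono)
    fix t assume t: "\<not> real (card (two_heavy (positions t))) \<ge> v * real n"
    have "finite (two_heavy (positions t))" by (rule finite_subset[OF _ finite_positions[of t]]) (auto simp: two_heavy_def)
    then have "card (T1 M (positions t)) \<le> card (two_heavy (positions t))" by (rule card_mono) (rule T1_subset)
    then show "real (card (T1 M (positions t))) < v * real n" using t by linarith
  qed
  have "((\<lambda>n. cond_gw_prob p n (\<lambda>T. \<not> real (card (two_heavy T)) \<ge> v * real n)) \<longlongrightarrow> 0) (inf sequentially (principal (sizes p)))"
    by (intro tendsto_sandwich[OF _ _ tendsto_const lim] always_eventually allI cond_gw_prob_nonneg le)
  from tendsto_diff[OF tendsto_const[of 1] this]
  have "((\<lambda>n. 1 - cond_gw_prob p n (\<lambda>T. \<not> real (card (two_heavy T)) \<ge> v * real n)) \<longlongrightarrow> 1) (inf sequentially (principal (sizes p)))"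
    by simp
  moreover have "\<forall>\<^sub>F n in inf sequentially (principal (sizes p)).
      1 - cond_gw_prob p n (\<lambda>T. \<not> real (card (two_heavy T)) \<ge> v * real n) = cond_gw_prob p n (\<lambda>T. real (card (two_heavy T)) \<ge> v * real n)"
    unfolding eventually_inf_principal using cond_gw_prob_not[where p = p] by (intro always_eventually) metis
  ultimately have "((\<lambda>n. cond_gw_prob p n (\<lambda>T. real (card (two_heavy T)) \<ge> v * real n)) \<longlongrightarrow> 1) (inf sequentially (principal (sizes p)))"
    by (rule Lim_transform_eventually)
  then show ?thesis using v by blast
qed

end

theorem theorem4:
  fixes p :: "nat pmf" and M :: nat
  assumes "integrable (measure_pmf p) (\<lambda>i. real i)"
    and "measure_pmf.expectation p (\<lambda>i. real i) = 1"
    and "integrable (measure_pmf p) (\<lambda>i. real i ^ 2)"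
    and "0 < measure_pmf.expectation p (\<lambda>i. real i ^ 2) - 1"
    and "M \<ge> 2"
    and "integrable (measure_pmf p) (\<lambda>i. real i ^ 5)"
  shows "(\<exists>\<gamma>::real. 0 < \<gamma> \<and> \<gamma> < 1 \<and>
            ((\<lambda>n. cond_gw_prob p n (\<lambda>T. real (card (V3 M T)) \<ge> \<gamma> * real n)) \<longlongrightarrow> 0)
              (inf sequentially (principal (sizes p)))) \<and>
         (\<exists>\<upsilon>::real. \<upsilon> > 0 \<and>
            ((\<lambda>n. cond_gw_prob p n (\<lambda>T. real (card (two_heavy T)) \<ge> \<upsilon> * real n)) \<longlongrightarrow> 1)
              (inf sequentially (principal (sizes p))))"
proof -
  interpret critical_offspring p by unfold_locales (fact assms)+
  have "M \<ge> 1" using assms(5) by simp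
  then show ?thesis using V3_not_linear two_heavy_linear by blast
qed

end
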